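(* Let $g:R\to S$ be a homomorphism of commutative Noetherian rings, and let $g^*:\operatorname{Spec} S\to\operatorname{Spec} R$ be the induced map $\mathfrak q\mapsto g^{-1}(\mathfrak q)$. Let $L$ be a finitely generated $R$-module, and let $M$ be an $S$-module which is injective as an $R$-module (via restriction of scalars along $g$). (1) For any $\mathfrak p\in\operatorname{Spec} R$, we have $g^*\big(\operatorname{Coass}_S(0:_M\mathfrak p)\big)=\operatorname{Coass}_R(0:_M\mathfrak p)\subseteq\{\mathfrak p\}$. (2) $\operatorname{Coass}_S\operatorname{Hom}_R(L,M)=\bigcup_{\mathfrak p\in\operatorname{Ass}_R L}\operatorname{Coass}_S(0:_M\mathfrak p)$.
   Context: For a commutative Noetherian ring $A$ and an $A$-module $N$, a prime $P\in\operatorname{Spec} A$ is coassociated to $N$ if there is a nonzero factor module $N'$ of $N$ which is hollow (i.e. $N'$ cannot be written as the sum of two proper submodules) such that $P=\{a\in A\mid aN'\neq N'\}$. The set of all such primes is denoted $\operatorname{Coass}_A N$. $\operatorname{Ass}_R L$ is the set of associated primes of $L$. $(0:_M\mathfrak p)=\{z\in M\mid \mathfrak p z=0\}$, where $\mathfrak p$ acts through $g$; it is an $S$-submodule of $M$. $\operatorname{Hom}_R(L,M)$ is an $S$-module via the $S$-module structure of $M$. *)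

theory Defs
  imports "HOL-Algebra.Module" "HOL-Algebra.Ring_Divisibility"
begin

section \<open>Modules: homomorphisms, quotients, restriction of scalars\<close>

definition Spec :: "('r, 'a) ring_scheme \<Rightarrow> 'r set set"
  where "Spec R = {P. primeideal P R}"

definition spec_map :: "('r, 'a) ring_scheme \<Rightarrow> ('r \<Rightarrow> 's) \<Rightarrow> 's set \<Rightarrow> 'r set"
  where "spec_map R g Q = {r \<in> carrier R. g r \<in> Q}"

text \<open>Homomorphisms are extensional, so that equality of homomorphisms is equality of functions.\<close>

definition mod_homs ::
    "('r, 'a) ring_scheme \<Rightarrow> ('r, 'm, 'b) module_scheme \<Rightarrow> ('r, 'n, 'c) module_scheme \<Rightarrow> ('m \<Rightarrow> 'n) set"
  where "mod_homs R M N = {f \<in> carrier M \<rightarrow>\<^sub>E carrier N.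
    (\<forall>x\<in>carrier M. \<forall>y\<in>carrier M. f (x \<oplus>\<^bsub>M\<^esub> y) = f x \<oplus>\<^bsub>N\<^esub> f y) \<and>
    (\<forall>r\<in>carrier R. \<forall>x\<in>carrier M. f (r \<odot>\<^bsub>M\<^esub> x) = r \<odot>\<^bsub>N\<^esub> f x)}"

text \<open>
  The record of modules extends that of rings. The multiplication and unit fields carry no
  meaning for a module, whence the value \<open>undefined\<close> below.
\<close>

definition quot_module :: "('r, 'm, 'b) module_scheme \<Rightarrow> 'm set \<Rightarrow> ('r, 'm set) module"
  where "quot_module M K =
    \<lparr>carrier = a_rcosets\<^bsub>M\<^esub> K, monoid.mult = undefined, one = undefined, ring.zero = K, add = set_add M,
     smult = (\<lambda>a C. \<Union>x\<in>C. K +>\<^bsub>M\<^esub> (a \<odot>\<^bsub>M\<^esub> x))\<rparr>"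

definition restrict_scalars :: "('r \<Rightarrow> 's) \<Rightarrow> ('s, 'm, 'b) module_scheme \<Rightarrow> ('r, 'm) module"
  where "restrict_scalars g M =
    \<lparr>carrier = carrier M, monoid.mult = monoid.mult M, one = one M, ring.zero = ring.zero M, add = add M,
     smult = (\<lambda>r x. g r \<odot>\<^bsub>M\<^esub> x)\<rparr>"

text \<open>\<open>Hom\<^sub>R(L, M)\<close> for an \<open>R\<close>-module \<open>L\<close> and an \<open>S\<close>-module \<open>M\<close>, as an \<open>S\<close>-module.\<close>

definition hom_module ::
    "('r, 'a) ring_scheme \<Rightarrow> ('r \<Rightarrow> 's) \<Rightarrow> ('r, 'l, 'b) module_scheme \<Rightarrow> ('s, 'm, 'c) module_scheme
      \<Rightarrow> ('s, 'l \<Rightarrow> 'm) module"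
  where "hom_module R g L M =
    \<lparr>carrier = mod_homs R L (restrict_scalars g M), monoid.mult = undefined, one = undefined,
     ring.zero = (\<lambda>x\<in>carrier L. \<zero>\<^bsub>M\<^esub>),
     add = (\<lambda>f h. \<lambda>x\<in>carrier L. f x \<oplus>\<^bsub>M\<^esub> h x),
     smult = (\<lambda>s f. \<lambda>x\<in>carrier L. s \<odot>\<^bsub>M\<^esub> f x)\<rparr>"

definition fin_gen_module :: "('r, 'a) ring_scheme \<Rightarrow> ('r, 'm, 'b) module_scheme \<Rightarrow> bool"
  where "fin_gen_module R M \<longleftrightarrow> module R M \<and>
    (\<exists>F. finite F \<and> F \<subseteq> carrier M \<and> (\<lambda>N. submodule N R M) hull F = carrier M)"

text \<open>\<open>(0 :\<^sub>M I)\<close>\<close>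

definition zero_colon :: "('r, 'm, 'b) module_scheme \<Rightarrow> 'r set \<Rightarrow> 'm set"
  where "zero_colon M I = {z \<in> carrier M. \<forall>a\<in>I. a \<odot>\<^bsub>M\<^esub> z = \<zero>\<^bsub>M\<^esub>}"

section \<open>Associated and coassociated primes\<close>

definition Ass :: "('r, 'a) ring_scheme \<Rightarrow> ('r, 'm, 'b) module_scheme \<Rightarrow> 'r set set"
  where "Ass R M =
    {P \<in> Spec R. \<exists>x\<in>carrier M. P = {a \<in> carrier R. a \<odot>\<^bsub>M\<^esub> x = \<zero>\<^bsub>M\<^esub>}}"

definition hollow :: "('r, 'a) ring_scheme \<Rightarrow> ('r, 'm, 'b) module_scheme \<Rightarrow> bool"
  where "hollow R M \<longleftrightarrow> \<not> (\<exists>U V. submodule U R M \<and> submodule V R M \<and>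
    U \<noteq> carrier M \<and> V \<noteq> carrier M \<and> carrier M = U <+>\<^bsub>M\<^esub> V)"

definition Coass :: "('r, 'a) ring_scheme \<Rightarrow> ('r, 'm, 'b) module_scheme \<Rightarrow> 'r set set"
  where "Coass R N = {P \<in> Spec R. \<exists>K. submodule K R N \<and>
    (let N' = quot_module N K in
      carrier N' \<noteq> {\<zero>\<^bsub>N'\<^esub>} \<and> hollow R N' \<and>
      P = {a \<in> carrier R. (\<lambda>x. a \<odot>\<^bsub>N'\<^esub> x) ` carrier N' \<noteq> carrier N'})}"

section \<open>Injective modules\<close>

text \<open>
  A definition cannot quantify over types, so the test modules \<open>A\<close>, \<open>B\<close> range over the modules
  on one type \<open>'u\<close>. By Baer's criterion, the element type of the ring is already large enough:
  see \<open>injective_module_any_type\<close> below.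
\<close>

definition injective_module ::
    "'u itself \<Rightarrow> ('r, 'a) ring_scheme \<Rightarrow> ('r, 'm, 'b) module_scheme \<Rightarrow> bool"
  where "injective_module _ R M \<longleftrightarrow> module R M \<and>
    (\<forall>(A :: ('r, 'u) module) (B :: ('r, 'u) module). \<forall>i \<in> mod_homs R A B. \<forall>f \<in> mod_homs R A M.
      module R A \<and> module R B \<and> inj_on i (carrier A) \<longrightarrow>
      (\<exists>h \<in> mod_homs R B M. \<forall>x\<in>carrier A. h (i x) = f x))"

lemma injective_module_extend_ideal:
  fixes R :: "('r, 'a) ring_scheme" and M :: "('r, 'm, 'b) module_scheme"
  assumes inj: "injective_module TYPE('r) R M" and I: "ideal I R"
    and \<phi>: "\<phi> \<in> I \<rightarrow> carrier M"
    and \<phi>_add: "\<And>a b. a \<in> I \<Longrightarrow> b \<in> I \<Longrightarrow> \<phi> (a \<oplus>\<^bsub>R\<^esub> b) = \<phi> a \<oplus>\<^bsub>M\<^esub> \<phi> b"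
    and \<phi>_smult: "\<And>r a. r \<in> carrier R \<Longrightarrow> a \<in> I \<Longrightarrow> \<phi> (r \<otimes>\<^bsub>R\<^esub> a) = r \<odot>\<^bsub>M\<^esub> \<phi> a"
  shows "\<exists>m\<in>carrier M. \<forall>a\<in>I. \<phi> a = a \<odot>\<^bsub>M\<^esub> m"
proof -
  interpret M: module R M using inj by (simp add: injective_module_def)
  interpret I: ideal I R by fact
  define B :: "('r, 'r) module" where
    "B = \<lparr>carrier = carrier R, monoid.mult = monoid.mult R, one = one R,
      ring.zero = ring.zero R, add = add R, smult = monoid.mult R\<rparr>"
  define A where "A = B\<lparr>carrier := I\<rparr>"
  have "abelian_group B"
    by (rule abelian_groupI)
      (auto simp: B_def M.R.a_ac intro: M.R.l_neg M.R.a_inv_closed)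
  then have B: "module R B"
    by (intro moduleI M.R.cring_axioms)
      (auto simp: B_def M.R.l_distr M.R.r_distr M.R.m_assoc)
  interpret B: module R B by fact
  have neg: "\<ominus>\<^bsub>B\<^esub> a = \<ominus>\<^bsub>R\<^esub> a" for a by (simp add: a_inv_def m_inv_def B_def)
  have "submodule I R B"
  proof (rule B.submoduleI)
    show "\<ominus>\<^bsub>B\<^esub> a \<in> I" if "a \<in> I" for a using that unfolding neg by simp
  qed (auto simp: B_def I.I_l_closed I.a_subset[THEN subsetD])
  then have A: "module R A" unfolding A_def by (rule submodule.submodule_is_module[OF _ B])
  have "(\<lambda>a\<in>I. a) \<in> mod_homs R A B"
    by (auto simp: mod_homs_def A_def B_def I.I_l_closed I.a_subset[THEN subsetD])
  moreover have "restrict \<phi> I \<in> mod_homs R A M"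
    using \<phi> by (auto simp: mod_homs_def A_def B_def \<phi>_add \<phi>_smult I.I_l_closed)
  moreover have "inj_on (\<lambda>a\<in>I. a) (carrier A)" by (auto simp: A_def)
  ultimately obtain h where h: "h \<in> mod_homs R B M"
    and ext: "\<forall>x\<in>carrier A. h ((\<lambda>a\<in>I. a) x) = restrict \<phi> I x"
    using inj A B unfolding injective_module_def by blast
  show ?thesis
  proof (intro bexI ballI)
    show "h \<one>\<^bsub>R\<^esub> \<in> carrier M" using h by (auto simp: mod_homs_def B_def)
    show "\<phi> a = a \<odot>\<^bsub>M\<^esub> h \<one>\<^bsub>R\<^esub>" if "a \<in> I" for a
    proof -
      have a: "a \<in> carrier R" using that I.a_subset by blast
      have "\<phi> a = h (a \<otimes>\<^bsub>R\<^esub> \<one>\<^bsub>R\<^esub>)" using ext that a by (auto simp: A_def)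
      also have "\<dots> = a \<odot>\<^bsub>M\<^esub> h \<one>\<^bsub>R\<^esub>" using h a by (auto simp: mod_homs_def B_def simp del: M.R.r_one)
      finally show ?thesis .
    qed
  qed
qed

text \<open>Baer's criterion, in the form that the type of test modules in injectivity is immaterial.\<close>

lemma injective_module_any_type:
  fixes R :: "('r, 'a) ring_scheme" and M :: "('r, 'm, 'b) module_scheme"
  assumes inj: "injective_module TYPE('r) R M"
  shows "injective_module TYPE('u) R M"
  unfolding injective_module_def
proof (intro conjI allI ballI impI)
  show M: "module R M" using inj by (simp add: injective_module_def)
  fix A B :: "('r, 'u) module" and i f
  assume i: "i \<in> mod_homs R A B" and f: "f \<in> mod_homs R A M"
    and AB: "module R A \<and> module R B \<and> inj_on i (carrier A)"
  interpret M: module R M by fact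
  interpret A: module R A using AB by blast
  interpret B: module R B using AB by blast
  define base where "base = (\<lambda>x. (i x, f x)) ` carrier A"
  define \<G> where "\<G> = {G. base \<subseteq> G \<and> G \<subseteq> carrier B \<times> carrier M \<and>
    (\<forall>y m y' m'. (y, m) \<in> G \<longrightarrow> (y', m') \<in> G \<longrightarrow> (y \<oplus>\<^bsub>B\<^esub> y', m \<oplus>\<^bsub>M\<^esub> m') \<in> G) \<and>
    (\<forall>r y m. r \<in> carrier R \<longrightarrow> (y, m) \<in> G \<longrightarrow> (r \<odot>\<^bsub>B\<^esub> y, r \<odot>\<^bsub>M\<^esub> m) \<in> G) \<and>
    (\<forall>y m m'. (y, m) \<in> G \<longrightarrow> (y, m') \<in> G \<longrightarrow> m = m')}"
  have "base \<in> \<G>"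
  proof -
    have "i (x \<oplus>\<^bsub>A\<^esub> y) = i x \<oplus>\<^bsub>B\<^esub> i y" "f (x \<oplus>\<^bsub>A\<^esub> y) = f x \<oplus>\<^bsub>M\<^esub> f y"
      if "x \<in> carrier A" "y \<in> carrier A" for x y
      using i f that by (auto simp: mod_homs_def)
    then have "(i x \<oplus>\<^bsub>B\<^esub> i y, f x \<oplus>\<^bsub>M\<^esub> f y) \<in> base" if "x \<in> carrier A" "y \<in> carrier A" for x y
      unfolding base_def using that by (intro image_eqI[of _ _ "x \<oplus>\<^bsub>A\<^esub> y"]) auto
    moreover have "(r \<odot>\<^bsub>B\<^esub> i x, r \<odot>\<^bsub>M\<^esub> f x) \<in> base" if "r \<in> carrier R" "x \<in> carrier A" for r x
      unfolding base_def using that i f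
      by (intro image_eqI[of _ _ "r \<odot>\<^bsub>A\<^esub> x"]) (auto simp: mod_homs_def)
    moreover have "base \<subseteq> carrier B \<times> carrier M" using i f by (auto simp: base_def mod_homs_def)
    moreover have "m = m'" if "(y, m) \<in> base" "(y, m') \<in> base" for y m m'
      using that AB by (auto simp: base_def inj_on_def)
    ultimately show ?thesis unfolding \<G>_def by (auto simp: base_def)
  qed
  have "\<exists>G\<in>\<G>. \<forall>G'\<in>\<G>. G \<subseteq> G' \<longrightarrow> G' = G"
  proof (rule subset_Zorn_nonempty)
    show "\<G> \<noteq> {}" using \<open>base \<in> \<G>\<close> by blast
    fix \<C> assume ne: "\<C> \<noteq> {}" and chain: "subset.chain \<G> \<C>"
    then have sub: "\<C> \<subseteq> \<G>" by (auto simp: subset.chain_def)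
    have two: "\<exists>G\<in>\<C>. u \<in> G \<and> v \<in> G" if "u \<in> \<Union>\<C>" "v \<in> \<Union>\<C>" for u v
      using that chain unfolding subset.chain_def by blast
    have "base \<subseteq> \<Union>\<C>" using ne sub unfolding \<G>_def by blast
    moreover have "\<Union>\<C> \<subseteq> carrier B \<times> carrier M" using sub unfolding \<G>_def by blast
    moreover have "(y \<oplus>\<^bsub>B\<^esub> y', m \<oplus>\<^bsub>M\<^esub> m') \<in> \<Union>\<C>" if "(y, m) \<in> \<Union>\<C>" "(y', m') \<in> \<Union>\<C>" for y m y' m'
      using two[OF that] sub unfolding \<G>_def by blast
    moreover have "(r \<odot>\<^bsub>B\<^esub> y, r \<odot>\<^bsub>M\<^esub> m) \<in> \<Union>\<C>" if "r \<in> carrier R" "(y, m) \<in> \<Union>\<C>" for r y m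
      using that sub unfolding \<G>_def by blast
    moreover have "m = m'" if "(y, m) \<in> \<Union>\<C>" "(y, m') \<in> \<Union>\<C>" for y m m'
    proof -
      from two[OF that] obtain G where "G \<in> \<C>" "(y, m) \<in> G" "(y, m') \<in> G" by blast
      with sub show ?thesis unfolding \<G>_def by blast
    qed
    ultimately show "\<Union>\<C> \<in> \<G>" unfolding \<G>_def by blast
  qed
  then obtain G where G: "G \<in> \<G>" and max: "\<And>G'. G' \<in> \<G> \<Longrightarrow> G \<subseteq> G' \<Longrightarrow> G' = G" by blast
  have G_base: "base \<subseteq> G" and G_car: "G \<subseteq> carrier B \<times> carrier M"
    and G_add: "\<And>y m y' m'. (y, m) \<in> G \<Longrightarrow> (y', m') \<in> G \<Longrightarrow> (y \<oplus>\<^bsub>B\<^esub> y', m \<oplus>\<^bsub>M\<^esub> m') \<in> G"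
    and G_smult: "\<And>r y m. r \<in> carrier R \<Longrightarrow> (y, m) \<in> G \<Longrightarrow> (r \<odot>\<^bsub>B\<^esub> y, r \<odot>\<^bsub>M\<^esub> m) \<in> G"
    and G_sv: "\<And>y m m'. (y, m) \<in> G \<Longrightarrow> (y, m') \<in> G \<Longrightarrow> m = m'"
    using G unfolding \<G>_def by blast+
  have G_zero: "(\<zero>\<^bsub>B\<^esub>, \<zero>\<^bsub>M\<^esub>) \<in> G"
  proof -
    have p: "(i \<zero>\<^bsub>A\<^esub>, f \<zero>\<^bsub>A\<^esub>) \<in> G" using G_base by (auto simp: base_def)
    from G_smult[OF M.R.zero_closed p] p G_car show ?thesis by auto
  qed
  have G_neg: "(\<ominus>\<^bsub>B\<^esub> y, \<ominus>\<^bsub>M\<^esub> m) \<in> G" if "(y, m) \<in> G" for y m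
    using G_smult[OF M.R.a_inv_closed[OF M.R.one_closed] that] that G_car
    by (auto simp: B.smult_l_minus M.smult_l_minus)
  have total: "\<exists>m. (y, m) \<in> G" if y: "y \<in> carrier B" for y
  proof -
    define I where "I = {r \<in> carrier R. \<exists>m. (r \<odot>\<^bsub>B\<^esub> y, m) \<in> G}"
    define \<phi> where "\<phi> r = (THE m. (r \<odot>\<^bsub>B\<^esub> y, m) \<in> G)" for r
    have \<phi>_eq: "\<phi> r = m" if "(r \<odot>\<^bsub>B\<^esub> y, m) \<in> G" for r m
      unfolding \<phi>_def using that G_sv by blast
    have \<phi>_in: "(r \<odot>\<^bsub>B\<^esub> y, \<phi> r) \<in> G" if "r \<in> I" for r
      using that \<phi>_eq unfolding I_def by blast
    have IR: "I \<subseteq> carrier R" by (auto simp: I_def)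
    have I_add: "((a \<oplus>\<^bsub>R\<^esub> b) \<odot>\<^bsub>B\<^esub> y, \<phi> a \<oplus>\<^bsub>M\<^esub> \<phi> b) \<in> G" if "a \<in> I" "b \<in> I" for a b
      using G_add[OF \<phi>_in[OF that(1)] \<phi>_in[OF that(2)]] that IR y
      by (auto simp: B.smult_l_distr subset_iff)
    have I_smult: "((r \<otimes>\<^bsub>R\<^esub> a) \<odot>\<^bsub>B\<^esub> y, r \<odot>\<^bsub>M\<^esub> \<phi> a) \<in> G" if "r \<in> carrier R" "a \<in> I" for r a
      using G_smult[OF that(1) \<phi>_in[OF that(2)]] that IR y
      by (auto simp: B.smult_assoc1 subset_iff)
    have I_neg: "((\<ominus>\<^bsub>R\<^esub> a) \<odot>\<^bsub>B\<^esub> y, \<ominus>\<^bsub>M\<^esub> \<phi> a) \<in> G" if "a \<in> I" for a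
      using G_neg[OF \<phi>_in[OF that]] that IR y by (auto simp: B.smult_l_minus subset_iff)
    have "ideal I R"
    proof (rule idealI[OF M.R.ring_axioms])
      show "subgroup I (add_monoid R)"
      proof (rule M.R.add.subgroupI)
        have "\<zero>\<^bsub>R\<^esub> \<in> I" using G_zero y by (auto simp: I_def)
        then show "I \<noteq> {}" by blast
      qed (use IR in \<open>auto simp: I_def subset_iff dest: I_add I_neg intro: I_add[unfolded I_def] I_neg[unfolded I_def]\<close>)
      fix a x assume ax: "a \<in> I" "x \<in> carrier R"
      then show "x \<otimes>\<^bsub>R\<^esub> a \<in> I" using I_smult[OF ax(2,1)] IR by (auto simp: I_def)
      then show "a \<otimes>\<^bsub>R\<^esub> x \<in> I" using ax IR by (auto simp: M.R.m_comm subset_iff)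
    qed
    then have "\<exists>m\<in>carrier M. \<forall>a\<in>I. \<phi> a = a \<odot>\<^bsub>M\<^esub> m"
    proof (rule injective_module_extend_ideal[OF inj])
      show "\<phi> \<in> I \<rightarrow> carrier M" using \<phi>_in G_car by blast
      show "\<phi> (a \<oplus>\<^bsub>R\<^esub> b) = \<phi> a \<oplus>\<^bsub>M\<^esub> \<phi> b" if "a \<in> I" "b \<in> I" for a b
        using I_add[OF that] by (rule \<phi>_eq)
      show "\<phi> (r \<otimes>\<^bsub>R\<^esub> a) = r \<odot>\<^bsub>M\<^esub> \<phi> a" if "r \<in> carrier R" "a \<in> I" for r a
        using I_smult[OF that] by (rule \<phi>_eq)
    qed
    then obtain m where m: "m \<in> carrier M" and \<phi>m: "\<And>a. a \<in> I \<Longrightarrow> \<phi> a = a \<odot>\<^bsub>M\<^esub> m"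
      by blast
    define G' where
      "G' = {(d \<oplus>\<^bsub>B\<^esub> r \<odot>\<^bsub>B\<^esub> y, e \<oplus>\<^bsub>M\<^esub> r \<odot>\<^bsub>M\<^esub> m) | d e r. (d, e) \<in> G \<and> r \<in> carrier R}"
    have G'I: "(u, v) \<in> G'" if "u = d \<oplus>\<^bsub>B\<^esub> r \<odot>\<^bsub>B\<^esub> y" "v = e \<oplus>\<^bsub>M\<^esub> r \<odot>\<^bsub>M\<^esub> m" "(d, e) \<in> G" "r \<in> carrier R"
      for u v d e r using that by (auto simp: G'_def)
    have G'E: "\<exists>d e r. u = d \<oplus>\<^bsub>B\<^esub> r \<odot>\<^bsub>B\<^esub> y \<and> v = e \<oplus>\<^bsub>M\<^esub> r \<odot>\<^bsub>M\<^esub> m \<and> (d, e) \<in> G \<and>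
      r \<in> carrier R \<and> d \<in> carrier B \<and> e \<in> carrier M" if "(u, v) \<in> G'" for u v
      using that G_car unfolding G'_def by blast
    have "G \<subseteq> G'"
    proof (rule subrelI)
      fix d e assume "(d, e) \<in> G"
      then show "(d, e) \<in> G'" using G_car y m by (intro G'I[of _ d "\<zero>\<^bsub>R\<^esub>" _ e]) auto
    qed
    moreover have "G' \<in> \<G>"
    proof -
      have "base \<subseteq> G'" using G_base \<open>G \<subseteq> G'\<close> by blast
      moreover have "G' \<subseteq> carrier B \<times> carrier M" using G'E y m by fastforce
      moreover have "(u \<oplus>\<^bsub>B\<^esub> u', v \<oplus>\<^bsub>M\<^esub> v') \<in> G'" if uv: "(u, v) \<in> G'" "(u', v') \<in> G'" for u v u' v'
      proof -
        obtain d e r where 1: "u = d \<oplus>\<^bsub>B\<^esub> r \<odot>\<^bsub>B\<^esub> y" "v = e \<oplus>\<^bsub>M\<^esub> r \<odot>\<^bsub>M\<^esub> m" "(d, e) \<in> G"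
          "r \<in> carrier R" "d \<in> carrier B" "e \<in> carrier M" using G'E[OF uv(1)] by blast
        obtain d' e' r' where 2: "u' = d' \<oplus>\<^bsub>B\<^esub> r' \<odot>\<^bsub>B\<^esub> y" "v' = e' \<oplus>\<^bsub>M\<^esub> r' \<odot>\<^bsub>M\<^esub> m" "(d', e') \<in> G"
          "r' \<in> carrier R" "d' \<in> carrier B" "e' \<in> carrier M" using G'E[OF uv(2)] by blast
        show ?thesis
          by (rule G'I[OF _ _ G_add[OF 1(3) 2(3)], of _ "r \<oplus>\<^bsub>R\<^esub> r'"])
            (use 1 2 y m in \<open>auto simp: B.smult_l_distr M.smult_l_distr B.M.a_ac M.M.a_ac\<close>)
      qed
      moreover have "(s \<odot>\<^bsub>B\<^esub> u, s \<odot>\<^bsub>M\<^esub> v) \<in> G'" if s: "s \<in> carrier R" and uv: "(u, v) \<in> G'" for s u v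
      proof -
        obtain d e r where 1: "u = d \<oplus>\<^bsub>B\<^esub> r \<odot>\<^bsub>B\<^esub> y" "v = e \<oplus>\<^bsub>M\<^esub> r \<odot>\<^bsub>M\<^esub> m" "(d, e) \<in> G"
          "r \<in> carrier R" "d \<in> carrier B" "e \<in> carrier M" using G'E[OF uv] by blast
        show ?thesis
          by (rule G'I[OF _ _ G_smult[OF s 1(3)], of _ "s \<otimes>\<^bsub>R\<^esub> r"])
            (use 1 s y m in \<open>auto simp: B.smult_r_distr M.smult_r_distr B.smult_assoc1 M.smult_assoc1\<close>)
      qed
      moreover have "v = v'" if uv: "(u, v) \<in> G'" "(u, v') \<in> G'" for u v v'
      proof -
        obtain d e r where 1: "u = d \<oplus>\<^bsub>B\<^esub> r \<odot>\<^bsub>B\<^esub> y" "v = e \<oplus>\<^bsub>M\<^esub> r \<odot>\<^bsub>M\<^esub> m" "(d, e) \<in> G"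
          "r \<in> carrier R" "d \<in> carrier B" "e \<in> carrier M" using G'E[OF uv(1)] by blast
        obtain d' e' r' where 2: "u = d' \<oplus>\<^bsub>B\<^esub> r' \<odot>\<^bsub>B\<^esub> y" "v' = e' \<oplus>\<^bsub>M\<^esub> r' \<odot>\<^bsub>M\<^esub> m" "(d', e') \<in> G"
          "r' \<in> carrier R" "d' \<in> carrier B" "e' \<in> carrier M" using G'E[OF uv(2)] by blast
        define t where "t = r \<ominus>\<^bsub>R\<^esub> r'"
        have t: "t \<in> carrier R" "r = t \<oplus>\<^bsub>R\<^esub> r'"
          using 1(4) 2(4) by (auto simp: t_def M.R.minus_eq M.R.a_assoc M.R.l_neg)
        have cB: "t \<odot>\<^bsub>B\<^esub> y \<in> carrier B" "r' \<odot>\<^bsub>B\<^esub> y \<in> carrier B"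
          and cM: "t \<odot>\<^bsub>M\<^esub> m \<in> carrier M" "r' \<odot>\<^bsub>M\<^esub> m \<in> carrier M" using t 2 y m by auto
        have "(d \<oplus>\<^bsub>B\<^esub> t \<odot>\<^bsub>B\<^esub> y) \<oplus>\<^bsub>B\<^esub> r' \<odot>\<^bsub>B\<^esub> y = d' \<oplus>\<^bsub>B\<^esub> r' \<odot>\<^bsub>B\<^esub> y"
          using 1 2 t y cB by (simp add: B.smult_l_distr B.M.a_assoc)
        then have dd': "d \<oplus>\<^bsub>B\<^esub> t \<odot>\<^bsub>B\<^esub> y = d'"
          using 1(5) 2(5) cB by (simp add: B.M.add.right_cancel)
        then have ty: "t \<odot>\<^bsub>B\<^esub> y = d' \<oplus>\<^bsub>B\<^esub> \<ominus>\<^bsub>B\<^esub> d"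
          using 1(5) cB by (auto simp: B.M.a_ac B.M.r_neg1 B.M.r_neg2 simp flip: dd')
        have "(t \<odot>\<^bsub>B\<^esub> y, e' \<oplus>\<^bsub>M\<^esub> \<ominus>\<^bsub>M\<^esub> e) \<in> G"
          unfolding ty by (rule G_add[OF 2(3) G_neg[OF 1(3)]])
        then have "t \<odot>\<^bsub>M\<^esub> m = e' \<oplus>\<^bsub>M\<^esub> \<ominus>\<^bsub>M\<^esub> e"
          using \<phi>_eq[of t] \<phi>m[of t] t(1) unfolding I_def by fastforce
        then have "e \<oplus>\<^bsub>M\<^esub> t \<odot>\<^bsub>M\<^esub> m = e'"
          using 1(6) 2(6) by (simp add: M.M.a_lcomm[of e e'] M.M.r_neg)
        then have "v' = (e \<oplus>\<^bsub>M\<^esub> t \<odot>\<^bsub>M\<^esub> m) \<oplus>\<^bsub>M\<^esub> r' \<odot>\<^bsub>M\<^esub> m" using 2 by simp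
        also have "\<dots> = v" using 1 2 t m cM by (simp add: M.smult_l_distr M.M.a_assoc)
        finally show ?thesis by simp
      qed
      ultimately show ?thesis unfolding \<G>_def by blast
    qed
    ultimately have "G' = G" by (intro max)
    moreover have "(y, m) \<in> G'" using G_zero y m by (intro G'I[of _ "\<zero>\<^bsub>B\<^esub>" "\<one>\<^bsub>R\<^esub>" _ "\<zero>\<^bsub>M\<^esub>"]) auto
    ultimately show ?thesis by blast
  qed
  define h where "h = (\<lambda>y\<in>carrier B. THE m. (y, m) \<in> G)"
  have h_in: "(y, h y) \<in> G" if "y \<in> carrier B" for y
    using total[OF that] that theI[of "\<lambda>m. (y, m) \<in> G"] G_sv by (auto simp: h_def)
  have h_eq: "h y = m" if "(y, m) \<in> G" for y m
    using that h_in G_sv G_car by blast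
  show "\<exists>h\<in>mod_homs R B M. \<forall>x\<in>carrier A. h (i x) = f x"
  proof (intro bexI ballI)
    show "h (i x) = f x" if "x \<in> carrier A" for x
      using that G_base by (intro h_eq) (auto simp: base_def)
    have "h \<in> carrier B \<rightarrow>\<^sub>E carrier M" using h_in G_car by (auto simp: h_def PiE_def)
    then show "h \<in> mod_homs R B M"
      by (auto simp: mod_homs_def intro!: h_eq G_add G_smult h_in)
  qed
qed

section \<open>The constructions yield modules\<close>

lemma module_restrict_scalars:
  assumes "cring R" "module S M" "g \<in> ring_hom R S"
  shows "module R (restrict_scalars g M)"
proof -
  interpret M: module S M by fact
  have ag: "abelian_group (restrict_scalars g M)"
    by (rule abelian_groupI)
      (auto simp: restrict_scalars_def M.M.a_ac intro: M.M.l_neg M.M.a_inv_closed)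
  show ?thesis
    by (rule moduleI[OF assms(1) ag])
      (use assms(3) in \<open>auto simp: restrict_scalars_def ring_hom_closed ring_hom_add ring_hom_mult
        ring_hom_one M.smult_l_distr M.smult_r_distr M.smult_assoc1\<close>)
qed

lemma submodule_zero_colon:
  assumes "module S M" "cring R" "g \<in> ring_hom R S" "I \<subseteq> carrier R"
  shows "submodule (zero_colon (restrict_scalars g M) I) S M"
proof -
  interpret M: module S M by fact
  have gc: "g a \<in> carrier S" if "a \<in> I" for a using assms that by (auto simp: ring_hom_closed)
  show ?thesis
  proof (rule M.submoduleI, goal_cases)
    case (5 a x)
    then have "g b \<odot>\<^bsub>M\<^esub> (a \<odot>\<^bsub>M\<^esub> x) = a \<odot>\<^bsub>M\<^esub> (g b \<odot>\<^bsub>M\<^esub> x)" if "b \<in> I" for b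
      using gc[OF that] by (auto simp: zero_colon_def restrict_scalars_def
          M.R.m_comm simp flip: M.smult_assoc1)
    with 5 show ?case by (auto simp: zero_colon_def restrict_scalars_def)
  qed (auto simp: zero_colon_def restrict_scalars_def M.smult_r_distr M.smult_r_minus gc)
qed

lemma module_quot_module:
  assumes "module R M" "submodule K R M"
  shows "module R (quot_module M K)"
proof -
  interpret M: module R M by fact
  have K: "subgroup K (add_monoid M)" using assms(2) by (rule submodule.axioms)
  interpret K: additive_subgroup K M by (rule additive_subgroup.intro) (fact K)
  interpret K: abelian_subgroup K M
    by (rule abelian_subgroupI3[OF K.additive_subgroup_axioms M.abelian_group_axioms])
  have KM: "K \<subseteq> carrier M" by (rule K.a_subset)
  have smult: "(\<Union>z\<in>K +>\<^bsub>M\<^esub> x. K +>\<^bsub>M\<^esub> (a \<odot>\<^bsub>M\<^esub> z)) = K +>\<^bsub>M\<^esub> (a \<odot>\<^bsub>M\<^esub> x)"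
    if a: "a \<in> carrier R" and x: "x \<in> carrier M" for a x
  proof -
    have "K +>\<^bsub>M\<^esub> (a \<odot>\<^bsub>M\<^esub> z) = K +>\<^bsub>M\<^esub> (a \<odot>\<^bsub>M\<^esub> x)" if z: "z \<in> K +>\<^bsub>M\<^esub> x" for z
    proof -
      obtain k where k: "k \<in> K" "z = k \<oplus>\<^bsub>M\<^esub> x" using z by (auto simp: a_r_coset_def')
      have ak: "a \<odot>\<^bsub>M\<^esub> k \<in> K" using submodule.smult_closed[OF assms(2) a k(1)] .
      have "a \<odot>\<^bsub>M\<^esub> z = a \<odot>\<^bsub>M\<^esub> k \<oplus>\<^bsub>M\<^esub> a \<odot>\<^bsub>M\<^esub> x" using k KM a x by (auto simp: M.smult_r_distr)
      then have "a \<odot>\<^bsub>M\<^esub> z \<in> K +>\<^bsub>M\<^esub> (a \<odot>\<^bsub>M\<^esub> x)" using ak by (auto simp: a_r_coset_def')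
      then show ?thesis using K.a_repr_independence' a x by auto
    qed
    moreover have "x \<in> K +>\<^bsub>M\<^esub> x" using K.a_rcos_self x by blast
    ultimately show ?thesis by blast
  qed
  have add: "(K +>\<^bsub>M\<^esub> x) <+>\<^bsub>M\<^esub> (K +>\<^bsub>M\<^esub> y) = K +>\<^bsub>M\<^esub> (x \<oplus>\<^bsub>M\<^esub> y)"
    if "x \<in> carrier M" "y \<in> carrier M" for x y using K.a_rcos_sum that by blast
  have K0: "K = K +>\<^bsub>M\<^esub> \<zero>\<^bsub>M\<^esub>" using M.a_coset_add_zero[OF KM] by simp
  have car: "carrier (quot_module M K) = (\<lambda>x. K +>\<^bsub>M\<^esub> x) ` carrier M"
    by (auto simp: quot_module_def A_RCOSETS_def')
  have ag: "abelian_group (quot_module M K)"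
  proof (rule abelian_groupI, goal_cases)
    case 2 show ?case unfolding car using K0 by (auto simp: quot_module_def)
  next
    case (5 x) then show ?case unfolding car using add[OF M.M.zero_closed] K0 by (auto simp: quot_module_def)
  next
    case (6 x)
    then obtain z where z: "z \<in> carrier M" "x = K +>\<^bsub>M\<^esub> z" unfolding car by blast
    then show ?case unfolding car
      by (intro bexI[of _ "K +>\<^bsub>M\<^esub> (\<ominus>\<^bsub>M\<^esub> z)"]) (auto simp: quot_module_def add M.M.l_neg K0[symmetric])
  qed (auto simp: car, auto simp: quot_module_def add M.M.a_ac)
  show ?thesis
    by (rule moduleI[OF M.R.cring_axioms ag])
      (auto simp: car, auto simp: quot_module_def add smult
        M.smult_l_distr M.smult_r_distr M.smult_assoc1)
qed

lemma module_hom_module: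
  assumes "module R L" "module S M" "g \<in> ring_hom R S"
  shows "module S (hom_module R g L M)"
proof -
  interpret L: module R L by fact
  interpret M: module S M by fact
  let ?H = "mod_homs R L (restrict_scalars g M)"
  have H: "f \<in> ?H \<longleftrightarrow> f \<in> carrier L \<rightarrow>\<^sub>E carrier M \<and>
    (\<forall>x\<in>carrier L. \<forall>y\<in>carrier L. f (x \<oplus>\<^bsub>L\<^esub> y) = f x \<oplus>\<^bsub>M\<^esub> f y) \<and>
    (\<forall>r\<in>carrier R. \<forall>x\<in>carrier L. f (r \<odot>\<^bsub>L\<^esub> x) = g r \<odot>\<^bsub>M\<^esub> f x)" for f
    by (auto simp: mod_homs_def restrict_scalars_def)
  have val: "f x \<in> carrier M" if "f \<in> ?H" "x \<in> carrier L" for f x using that by (auto simp: H)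
  have gc: "g r \<in> carrier S" if "r \<in> carrier R" for r using assms(3) that by (rule ring_hom_closed)
  have eqI: "f = h" if "f \<in> ?H" "h \<in> carrier L \<rightarrow>\<^sub>E carrier M" "\<And>x. x \<in> carrier L \<Longrightarrow> f x = h x" for f h
    using that by (intro PiE_ext[of f "carrier L" "\<lambda>_. carrier M" h]) (auto simp: H)
  have add: "(\<lambda>x\<in>carrier L. f x \<oplus>\<^bsub>M\<^esub> h x) \<in> ?H" if "f \<in> ?H" "h \<in> ?H" for f h
    using that val unfolding H by (auto simp: M.M.a_ac M.smult_r_distr gc Pi_iff PiE_mem)
  have smult: "(\<lambda>x\<in>carrier L. s \<odot>\<^bsub>M\<^esub> f x) \<in> ?H" if "s \<in> carrier S" "f \<in> ?H" for s f
  proof -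
    have "s \<odot>\<^bsub>M\<^esub> (g r \<odot>\<^bsub>M\<^esub> m) = g r \<odot>\<^bsub>M\<^esub> (s \<odot>\<^bsub>M\<^esub> m)" if "r \<in> carrier R" "m \<in> carrier M" for r m
      using that \<open>s \<in> carrier S\<close> gc by (simp add: M.R.m_comm flip: M.smult_assoc1)
    moreover have "f x \<in> carrier M" if "x \<in> carrier L" for x using \<open>f \<in> ?H\<close> that by (rule val)
    ultimately show ?thesis using that unfolding H by (auto simp: M.smult_r_distr gc)
  qed
  have zero: "(\<lambda>x\<in>carrier L. \<zero>\<^bsub>M\<^esub>) \<in> ?H" unfolding H by (auto simp: gc)
  have ag: "abelian_group (hom_module R g L M)"
  proof (rule abelian_groupI, goal_cases)
    case (6 f)
    then have f: "f \<in> ?H" by (simp add: hom_module_def)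
    show ?case
      by (rule bexI[of _ "\<lambda>x\<in>carrier L. (\<ominus>\<^bsub>S\<^esub> \<one>\<^bsub>S\<^esub>) \<odot>\<^bsub>M\<^esub> f x"])
        (use f val smult[of "\<ominus>\<^bsub>S\<^esub> \<one>\<^bsub>S\<^esub>" f] in
          \<open>auto simp: hom_module_def M.smult_l_minus M.M.l_neg intro!: restrict_ext\<close>)
  qed (auto simp: hom_module_def add zero val M.M.a_ac intro!: restrict_ext,
      (rule eqI[symmetric]; auto simp: val)?)
  show ?thesis
    by (rule moduleI[OF M.R.cring_axioms ag])
      (auto simp: hom_module_def smult val M.smult_l_distr M.smult_r_distr M.smult_assoc1
        intro!: restrict_ext, (rule eqI[symmetric]; auto simp: val)?)
qed

end

theory Submission
  imports Defs
begin

text \<open>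
  All notions are rephrased for submodules of the given modules: \<open>hollow_over R N K\<close> says that \<open>N / K\<close> is
  a nonzero hollow module, and \<open>coass_prime R N K\<close> is the prime that it contributes (\<open>Coass_eq\<close>).

  For the first part, let \<open>Z = (0 :\<^sub>M p)\<close>. A scalar in \<open>p\<close> kills \<open>Z\<close>. A scalar \<open>r \<notin> p\<close> acts surjectively on \<open>Z\<close>,
  because \<open>Z\<close> inherits from \<open>M\<close> that it is injective over the domain \<open>R / p\<close>, hence divisible. Both
  properties pass to the nonzero quotients of \<open>Z\<close>; so \<open>p\<close> is the only possible element of \<open>Coass\<^sub>R Z\<close>, and
  every element of \<open>Coass\<^sub>S Z\<close> contracts to \<open>p\<close>. It remains to know that \<open>Coass\<^sub>R Z\<close> and \<open>Coass\<^sub>S Z\<close> are empty only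
  if \<open>Z = 0\<close>, that is, that a nonzero module over a Noetherian ring has a hollow quotient
  (\<open>exists_hollow_over\<close>). It has a quotient with simple essential socle; such a module is Artinian; and
  an Artinian module has a hollow quotient by a minimality argument.

  For the second part, let \<open>H = Hom(L, M)\<close> and let \<open>perp X = Hom(L / X, M)\<close>, a submodule of \<open>H\<close>. As \<open>M\<close> is
  injective over \<open>R\<close>, \<open>perp\<close> turns intersections into sums, \<open>perp (0 :\<^sub>L r) = r H\<close>, and
  \<open>perp X / perp (X + R x) \<cong> (0 :\<^sub>M (X : x))\<close>. With \<open>X = 0\<close> and \<open>p = (0 : x)\<close> the last statement exhibits \<open>(0 :\<^sub>M p)\<close>
  as a quotient of \<open>H\<close> for \<open>p \<in> Ass L\<close>, which proves one inclusion. For the other one, let \<open>H / K\<close> be hollow with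
  prime \<open>Q\<close>. Choosing \<open>X\<close> maximal with \<open>perp X + K = H\<close>, and then \<open>x\<close> with \<open>p = (X : x)\<close> prime, one finds \<open>Q\<close> in
  \<open>Coass\<^sub>S (0 :\<^sub>M p)\<close> (\<open>Coass_hom_subset\<close>). By the first part \<open>p\<close> is the contraction of \<open>Q\<close>, which puts it into
  \<open>Ass L\<close> (\<open>contraction_in_Ass\<close>), although the choice of \<open>x\<close> only made it an element of \<open>Ass (L / X)\<close>.
\<close>

section \<open>Submodules and linear maps\<close>

lemma mem_set_add_iff: "x \<in> A <+>\<^bsub>M\<^esub> B \<longleftrightarrow> (\<exists>a\<in>A. \<exists>b\<in>B. x = a \<oplus>\<^bsub>M\<^esub> b)"
  by (auto simp: set_add_def')

context module
begin

lemma submodule_iff: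
  "submodule H R M \<longleftrightarrow> H \<subseteq> carrier M \<and> \<zero>\<^bsub>M\<^esub> \<in> H \<and> (\<forall>x\<in>H. \<forall>y\<in>H. x \<oplus>\<^bsub>M\<^esub> y \<in> H)
    \<and> (\<forall>a\<in>carrier R. \<forall>x\<in>H. a \<odot>\<^bsub>M\<^esub> x \<in> H)"
proof
  assume H: "submodule H R M"
  then show "H \<subseteq> carrier M \<and> \<zero>\<^bsub>M\<^esub> \<in> H \<and> (\<forall>x\<in>H. \<forall>y\<in>H. x \<oplus>\<^bsub>M\<^esub> y \<in> H)
    \<and> (\<forall>a\<in>carrier R. \<forall>x\<in>H. a \<odot>\<^bsub>M\<^esub> x \<in> H)"
    using submoduleE[OF H] subgroup.one_closed[OF submodule.axioms(1)[OF H]] by auto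
next
  assume *: "H \<subseteq> carrier M \<and> \<zero>\<^bsub>M\<^esub> \<in> H \<and> (\<forall>x\<in>H. \<forall>y\<in>H. x \<oplus>\<^bsub>M\<^esub> y \<in> H)
    \<and> (\<forall>a\<in>carrier R. \<forall>x\<in>H. a \<odot>\<^bsub>M\<^esub> x \<in> H)"
  have "\<ominus>\<^bsub>M\<^esub> x \<in> H" if "x \<in> H" for x
  proof -
    have "(\<ominus> \<one>) \<odot>\<^bsub>M\<^esub> x \<in> H" using * that by blast
    moreover have "x \<in> carrier M" using * that by blast
    ultimately show ?thesis by (simp add: smult_l_minus)
  qed
  with * show "submodule H R M" by (intro submoduleI) auto
qed

lemma submodule_carrier: "submodule (carrier M) R M"
  by (simp add: submodule_iff)

lemma submodule_zero: "submodule {\<zero>\<^bsub>M\<^esub>} R M"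
  by (simp add: submodule_iff)

lemma submodule_minus_closed:
  assumes "submodule H R M" "x \<in> H" "y \<in> H"
  shows "x \<ominus>\<^bsub>M\<^esub> y \<in> H"
  using submoduleE[OF assms(1)] assms(2,3) by (simp add: M.minus_eq)

lemma submodule_Int:
  "submodule U R M \<Longrightarrow> submodule V R M \<Longrightarrow> submodule (U \<inter> V) R M"
  unfolding submodule_iff by blast

lemma submodule_set_add:
  assumes "submodule U R M" "submodule V R M"
  shows "submodule (U <+>\<^bsub>M\<^esub> V) R M"
proof -
  note UV = assms[unfolded submodule_iff]
  have "\<zero>\<^bsub>M\<^esub> \<in> U <+>\<^bsub>M\<^esub> V"
    using UV unfolding mem_set_add_iff by (intro bexI[of _ "\<zero>\<^bsub>M\<^esub>"]) auto
  moreover have "x \<oplus>\<^bsub>M\<^esub> y \<in> U <+>\<^bsub>M\<^esub> V" if xy: "x \<in> U <+>\<^bsub>M\<^esub> V" "y \<in> U <+>\<^bsub>M\<^esub> V" for x y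
  proof -
    obtain u v u' v' where *: "x = u \<oplus>\<^bsub>M\<^esub> v" "y = u' \<oplus>\<^bsub>M\<^esub> v'" "u \<in> U" "u' \<in> U" "v \<in> V" "v' \<in> V"
      using xy unfolding mem_set_add_iff by blast
    then have "x \<oplus>\<^bsub>M\<^esub> y = (u \<oplus>\<^bsub>M\<^esub> u') \<oplus>\<^bsub>M\<^esub> (v \<oplus>\<^bsub>M\<^esub> v')"
      using UV by (simp add: M.a_ac subset_iff)
    with * UV show ?thesis unfolding mem_set_add_iff by blast
  qed
  moreover have "a \<odot>\<^bsub>M\<^esub> x \<in> U <+>\<^bsub>M\<^esub> V" if ax: "a \<in> carrier R" "x \<in> U <+>\<^bsub>M\<^esub> V" for a x
  proof -
    obtain u v where *: "x = u \<oplus>\<^bsub>M\<^esub> v" "u \<in> U" "v \<in> V"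
      using ax(2) unfolding mem_set_add_iff by blast
    then have "a \<odot>\<^bsub>M\<^esub> x = a \<odot>\<^bsub>M\<^esub> u \<oplus>\<^bsub>M\<^esub> a \<odot>\<^bsub>M\<^esub> v"
      using UV ax(1) by (simp add: smult_r_distr subset_iff)
    with * UV ax(1) show ?thesis unfolding mem_set_add_iff by blast
  qed
  moreover have "U <+>\<^bsub>M\<^esub> V \<subseteq> carrier M"
    using UV by (auto simp: mem_set_add_iff subset_iff)
  ultimately show ?thesis unfolding submodule_iff by blast
qed

lemma set_add_upper1:
  assumes "submodule U R M" "submodule V R M"
  shows "U \<subseteq> U <+>\<^bsub>M\<^esub> V"
proof
  fix x assume "x \<in> U"
  moreover from this assms have "x = x \<oplus>\<^bsub>M\<^esub> \<zero>\<^bsub>M\<^esub>" "\<zero>\<^bsub>M\<^esub> \<in> V" by (auto simp: submodule_iff)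
  ultimately show "x \<in> U <+>\<^bsub>M\<^esub> V" unfolding mem_set_add_iff by blast
qed

lemma set_add_upper2:
  assumes "submodule U R M" "submodule V R M"
  shows "V \<subseteq> U <+>\<^bsub>M\<^esub> V"
proof
  fix x assume "x \<in> V"
  moreover from this assms have "x = \<zero>\<^bsub>M\<^esub> \<oplus>\<^bsub>M\<^esub> x" "\<zero>\<^bsub>M\<^esub> \<in> U" by (auto simp: submodule_iff)
  ultimately show "x \<in> U <+>\<^bsub>M\<^esub> V" unfolding mem_set_add_iff by blast
qed

lemma set_add_least:
  "submodule W R M \<Longrightarrow> U \<subseteq> W \<Longrightarrow> V \<subseteq> W \<Longrightarrow> U <+>\<^bsub>M\<^esub> V \<subseteq> W"
  by (auto simp: submodule_iff mem_set_add_iff subset_iff)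

lemma set_add_mono: "U \<subseteq> U' \<Longrightarrow> V \<subseteq> V' \<Longrightarrow> U <+>\<^bsub>M\<^esub> V \<subseteq> U' <+>\<^bsub>M\<^esub> V'"
  unfolding set_add_def' by blast

lemma submodule_scalar_image:
  assumes a: "a \<in> carrier R" and U: "submodule U R M"
  shows "submodule ((\<lambda>x. a \<odot>\<^bsub>M\<^esub> x) ` U) R M"
proof -
  note U' = U[unfolded submodule_iff]
  have "\<zero>\<^bsub>M\<^esub> \<in> (\<lambda>x. a \<odot>\<^bsub>M\<^esub> x) ` U"
    using U' a by (intro image_eqI[of _ _ "\<zero>\<^bsub>M\<^esub>"]) auto
  moreover have "a \<odot>\<^bsub>M\<^esub> x \<oplus>\<^bsub>M\<^esub> a \<odot>\<^bsub>M\<^esub> y \<in> (\<lambda>x. a \<odot>\<^bsub>M\<^esub> x) ` U" if "x \<in> U" "y \<in> U" for x y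
    using that U' a by (intro image_eqI[of _ _ "x \<oplus>\<^bsub>M\<^esub> y"]) (auto simp: smult_r_distr subset_iff)
  moreover have "b \<odot>\<^bsub>M\<^esub> (a \<odot>\<^bsub>M\<^esub> x) \<in> (\<lambda>x. a \<odot>\<^bsub>M\<^esub> x) ` U" if "b \<in> carrier R" "x \<in> U" for b x
    using that U' a
    by (intro image_eqI[of _ _ "b \<odot>\<^bsub>M\<^esub> x"]) (auto simp: R.m_comm subset_iff simp flip: smult_assoc1)
  ultimately show ?thesis using U' a by (auto simp: submodule_iff)
qed

lemma submodule_cyclic:
  assumes "x \<in> carrier M"
  shows "submodule ((\<lambda>a. a \<odot>\<^bsub>M\<^esub> x) ` carrier R) R M"
proof -
  have "\<zero>\<^bsub>M\<^esub> \<in> (\<lambda>a. a \<odot>\<^bsub>M\<^esub> x) ` carrier R"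
    using assms by (intro image_eqI[of _ _ "\<zero>"]) auto
  moreover have "a \<odot>\<^bsub>M\<^esub> x \<oplus>\<^bsub>M\<^esub> b \<odot>\<^bsub>M\<^esub> x \<in> (\<lambda>a. a \<odot>\<^bsub>M\<^esub> x) ` carrier R"
    if "a \<in> carrier R" "b \<in> carrier R" for a b
    using that assms by (intro image_eqI[of _ _ "a \<oplus> b"]) (auto simp: smult_l_distr)
  moreover have "b \<odot>\<^bsub>M\<^esub> (a \<odot>\<^bsub>M\<^esub> x) \<in> (\<lambda>a. a \<odot>\<^bsub>M\<^esub> x) ` carrier R"
    if "a \<in> carrier R" "b \<in> carrier R" for a b
    using that assms by (intro image_eqI[of _ _ "b \<otimes> a"]) (auto simp: smult_assoc1)
  ultimately show ?thesis using assms by (auto simp: submodule_iff)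
qed

lemma mem_cyclic: "x \<in> carrier M \<Longrightarrow> x \<in> (\<lambda>a. a \<odot>\<^bsub>M\<^esub> x) ` carrier R"
  by (rule image_eqI[of _ _ "\<one>"]) auto

lemma eq_minus_add: "x \<in> carrier M \<Longrightarrow> y \<in> carrier M \<Longrightarrow> x = y \<oplus>\<^bsub>M\<^esub> (x \<ominus>\<^bsub>M\<^esub> y)"
  by (simp add: M.minus_eq M.a_lcomm[of y x] M.r_neg)

lemma add_minus_cancel_left:
  "x \<in> carrier M \<Longrightarrow> y \<in> carrier M \<Longrightarrow> (x \<oplus>\<^bsub>M\<^esub> y) \<ominus>\<^bsub>M\<^esub> x = y"
  by (simp add: M.minus_eq M.a_comm[of x y] M.a_assoc M.r_neg)

text \<open>
  The ideal \<open>(X : x)\<close>; with \<open>X = {0}\<close> it is the annihilator of \<open>x\<close>.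
\<close>

lemma ideal_colon:
  assumes X: "submodule X R M" and x: "x \<in> carrier M"
  shows "ideal {r \<in> carrier R. r \<odot>\<^bsub>M\<^esub> x \<in> X} R"
proof (rule idealI[OF R.ring_axioms])
  note X' = X[unfolded submodule_iff]
  have neg: "(\<ominus> a) \<odot>\<^bsub>M\<^esub> x \<in> X" if "a \<in> carrier R" "a \<odot>\<^bsub>M\<^esub> x \<in> X" for a
    using that x submoduleE(3)[OF X] by (simp add: smult_l_minus)
  show "subgroup {r \<in> carrier R. r \<odot>\<^bsub>M\<^esub> x \<in> X} (add_monoid R)"
    by (rule R.add.subgroupI) (use X' x neg in \<open>auto simp: smult_l_distr intro!: exI[of _ \<zero>] simp flip: a_inv_def\<close>)
  show "r \<otimes> a \<in> {r \<in> carrier R. r \<odot>\<^bsub>M\<^esub> x \<in> X}"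
    if "a \<in> {r \<in> carrier R. r \<odot>\<^bsub>M\<^esub> x \<in> X}" "r \<in> carrier R" for a r
    using that x X' by (auto simp: smult_assoc1)
  then show "a \<otimes> r \<in> {r \<in> carrier R. r \<odot>\<^bsub>M\<^esub> x \<in> X}"
    if "a \<in> {r \<in> carrier R. r \<odot>\<^bsub>M\<^esub> x \<in> X}" "r \<in> carrier R" for a r
    using that by (subst R.m_comm) auto
qed

end

text \<open>
  Linear maps are needed on submodules \<open>X\<close> of \<open>M\<close>, not only on all of \<open>M\<close>: the comparison of
  \<open>Hom(L, M)\<close> with \<open>(0 : p)\<close> below is by a map which is defined on a submodule. No
  extensionality is imposed, so that evaluation \<open>\<lambda>f. f x\<close> qualifies as it stands.
\<close>

definition linear_on ::
    "('r, 'a) ring_scheme \<Rightarrow> ('r, 'm, 'b) module_scheme \<Rightarrow> 'm set \<Rightarrow> ('r, 'n, 'c) module_scheme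
      \<Rightarrow> ('m \<Rightarrow> 'n) \<Rightarrow> bool"
  where "linear_on R M X N f \<longleftrightarrow> f \<in> X \<rightarrow> carrier N \<and>
    (\<forall>x\<in>X. \<forall>y\<in>X. f (x \<oplus>\<^bsub>M\<^esub> y) = f x \<oplus>\<^bsub>N\<^esub> f y) \<and>
    (\<forall>r\<in>carrier R. \<forall>x\<in>X. f (r \<odot>\<^bsub>M\<^esub> x) = r \<odot>\<^bsub>N\<^esub> f x)"

locale sublinear = M: module R M + N: module R N
  for R (structure) and M and N +
  fixes X f
  assumes X: "submodule X R M" and linear: "linear_on R M X N f"
begin

lemmas X_closed = X[unfolded M.submodule_iff]

lemma X_carrier: "x \<in> X \<Longrightarrow> x \<in> carrier M" using X_closed by blast

lemma f_closed: "x \<in> X \<Longrightarrow> f x \<in> carrier N"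
  and f_add: "x \<in> X \<Longrightarrow> y \<in> X \<Longrightarrow> f (x \<oplus>\<^bsub>M\<^esub> y) = f x \<oplus>\<^bsub>N\<^esub> f y"
  and f_smult: "r \<in> carrier R \<Longrightarrow> x \<in> X \<Longrightarrow> f (r \<odot>\<^bsub>M\<^esub> x) = r \<odot>\<^bsub>N\<^esub> f x"
  using linear unfolding linear_on_def by auto

lemma f_zero: "f \<zero>\<^bsub>M\<^esub> = \<zero>\<^bsub>N\<^esub>"
proof -
  have "\<zero>\<^bsub>M\<^esub> \<in> X" using X_closed by blast
  then have "f (\<zero> \<odot>\<^bsub>M\<^esub> \<zero>\<^bsub>M\<^esub>) = \<zero> \<odot>\<^bsub>N\<^esub> f \<zero>\<^bsub>M\<^esub>" "f \<zero>\<^bsub>M\<^esub> \<in> carrier N"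
    using f_smult[OF M.R.zero_closed] f_closed by blast+
  then show ?thesis by simp
qed

lemma f_minus:
  assumes "x \<in> X" "y \<in> X"
  shows "f (x \<ominus>\<^bsub>M\<^esub> y) = f x \<ominus>\<^bsub>N\<^esub> f y"
proof -
  have "f (\<ominus>\<^bsub>M\<^esub> y) = \<ominus>\<^bsub>N\<^esub> f y"
    using f_smult[of "\<ominus> \<one>" y] assms X_carrier f_closed by (simp add: M.smult_l_minus N.smult_l_minus)
  moreover have "\<ominus>\<^bsub>M\<^esub> y \<in> X" using M.submoduleE(3)[OF X] assms by blast
  ultimately show ?thesis using assms f_add by (simp add: M.M.minus_eq N.M.minus_eq)
qed

lemma submodule_vimage:
  assumes "submodule V R N"
  shows "submodule {x \<in> X. f x \<in> V} R M"
  using assms X_closed f_add f_smult f_zero unfolding M.submodule_iff N.submodule_iff by auto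

lemma submodule_image:
  assumes U: "submodule U R M" and "U \<subseteq> X"
  shows "submodule (f ` U) R N"
proof -
  note U' = U[unfolded M.submodule_iff]
  have "\<zero>\<^bsub>N\<^esub> \<in> f ` U" using U' f_zero by (metis imageI)
  moreover have "f x \<oplus>\<^bsub>N\<^esub> f y \<in> f ` U" if "x \<in> U" "y \<in> U" for x y
    using that U' assms(2) f_add by (metis imageI subsetD)
  moreover have "r \<odot>\<^bsub>N\<^esub> f x \<in> f ` U" if "r \<in> carrier R" "x \<in> U" for r x
    using that U' assms(2) f_smult by (metis imageI subsetD)
  ultimately show ?thesis using assms(2) f_closed by (auto simp: N.submodule_iff)
qed

end

section \<open>Hollow quotients and coassociated primes\<close>

text \<open>
  Elementwise form of "\<open>M / K\<close> is nonzero and hollow". Submodules of \<open>M / K\<close> are replaced by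
  submodules of \<open>M\<close> that contain \<open>K\<close>, so that cosets do not occur in the arguments.
\<close>

definition hollow_over :: "('r, 'a) ring_scheme \<Rightarrow> ('r, 'm, 'b) module_scheme \<Rightarrow> 'm set \<Rightarrow> bool"
  where "hollow_over R M K \<longleftrightarrow> submodule K R M \<and> K \<noteq> carrier M \<and>
    (\<forall>U V. submodule U R M \<longrightarrow> submodule V R M \<longrightarrow> K \<subseteq> U \<longrightarrow> K \<subseteq> V \<longrightarrow>
      carrier M = U <+>\<^bsub>M\<^esub> V \<longrightarrow> U = carrier M \<or> V = carrier M)"

text \<open>
  The set \<open>{a. a N' \<noteq> N'}\<close> for \<open>N' = M / K\<close>, since \<open>a (M / K) = (a M + K) / K\<close>.
\<close>

definition coass_prime :: "('r, 'a) ring_scheme \<Rightarrow> ('r, 'm, 'b) module_scheme \<Rightarrow> 'm set \<Rightarrow> 'r set"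
  where "coass_prime R M K =
    {a \<in> carrier R. ((\<lambda>x. a \<odot>\<^bsub>M\<^esub> x) ` carrier M) <+>\<^bsub>M\<^esub> K \<noteq> carrier M}"

lemma hollow_overD:
  assumes "hollow_over R M K"
  shows "submodule K R M" "K \<noteq> carrier M"
  using assms by (auto simp: hollow_over_def)

context module
begin

lemma set_add_eq_carrierI:
  assumes "submodule U R M" "submodule V R M" "carrier M \<subseteq> U <+>\<^bsub>M\<^esub> V"
  shows "U <+>\<^bsub>M\<^esub> V = carrier M"
  using assms submodule_set_add[OF assms(1,2)] by (auto simp: submodule_iff)

text \<open>
  How hollowness is used: the submodules need not contain \<open>K\<close>, it suffices to add \<open>K\<close> to them.
\<close>

lemma hollow_over_cases:
  assumes K: "hollow_over R M K" and U: "submodule U R M" and V: "submodule V R M"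
    and cover: "(U <+>\<^bsub>M\<^esub> V) <+>\<^bsub>M\<^esub> K = carrier M"
  shows "U <+>\<^bsub>M\<^esub> K = carrier M \<or> V <+>\<^bsub>M\<^esub> K = carrier M"
proof -
  note K' = hollow_overD(1)[OF K]
  let ?U = "U <+>\<^bsub>M\<^esub> K" and ?V = "V <+>\<^bsub>M\<^esub> K"
  have U': "submodule ?U R M" and V': "submodule ?V R M"
    using U V K' by (auto intro: submodule_set_add)
  have UV: "submodule (?U <+>\<^bsub>M\<^esub> ?V) R M" using U' V' by (rule submodule_set_add)
  have "U \<subseteq> ?U <+>\<^bsub>M\<^esub> ?V" "V \<subseteq> ?U <+>\<^bsub>M\<^esub> ?V" "K \<subseteq> ?U <+>\<^bsub>M\<^esub> ?V"
    using set_add_upper1[OF U' V'] set_add_upper2[OF U' V'] set_add_upper1[OF U K']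
      set_add_upper1[OF V K'] set_add_upper2[OF U K'] by auto
  then have "(U <+>\<^bsub>M\<^esub> V) <+>\<^bsub>M\<^esub> K \<subseteq> ?U <+>\<^bsub>M\<^esub> ?V"
    by (intro set_add_least UV)
  then have "carrier M = ?U <+>\<^bsub>M\<^esub> ?V"
    using set_add_eq_carrierI[OF U' V'] cover by simp
  moreover have "K \<subseteq> ?U" "K \<subseteq> ?V"
    using set_add_upper2[OF U K'] set_add_upper2[OF V K'] .
  ultimately show ?thesis using K U' V' unfolding hollow_over_def by blast
qed

lemma set_add_self:
  assumes "submodule U R M" "submodule K R M" "U \<subseteq> K"
  shows "U <+>\<^bsub>M\<^esub> K = K"
  using set_add_upper2[OF assms(1,2)] set_add_least[OF assms(2) assms(3) order_refl] by blast

text \<open>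
  Closure under addition is where hollowness enters: \<open>(a + b) M\<close> lies in \<open>a M + b M\<close>, and two
  submodules that do not cover \<open>M\<close> modulo \<open>K\<close> cannot do so together. For primeness, surjectivity of
  \<open>a\<close> and of \<open>b\<close> on \<open>M / K\<close> gives surjectivity of \<open>a b\<close>.
\<close>

lemma coass_prime_prime:
  assumes K: "hollow_over R M K"
  shows "primeideal (coass_prime R M K) R"
proof -
  note K' = hollow_overD(1)[OF K]
  define D where "D a = (\<lambda>x. a \<odot>\<^bsub>M\<^esub> x) ` carrier M" for a
  have D: "submodule (D a) R M" if "a \<in> carrier R" for a
    unfolding D_def by (rule submodule_scalar_image[OF that submodule_carrier])
  have mem: "a \<in> coass_prime R M K \<longleftrightarrow> D a <+>\<^bsub>M\<^esub> K \<noteq> carrier M" if "a \<in> carrier R" for a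
    using that by (simp add: coass_prime_def D_def)
  have mono: "b \<in> coass_prime R M K"
    if "a \<in> coass_prime R M K" "b \<in> carrier R" "D b \<subseteq> D a <+>\<^bsub>M\<^esub> K" for a b
  proof -
    have a: "a \<in> carrier R" using that(1) by (simp add: coass_prime_def)
    have "D b <+>\<^bsub>M\<^esub> K \<subseteq> D a <+>\<^bsub>M\<^esub> K"
      using that(3) set_add_upper2[OF D[OF a] K'] submodule_set_add[OF D[OF a] K']
      by (intro set_add_least)
    moreover have "D a <+>\<^bsub>M\<^esub> K \<subseteq> carrier M"
      using submodule_set_add[OF D[OF a] K'] by (simp add: submodule_iff)
    ultimately show ?thesis using that(1) mem a that(2) by blast
  qed
  have add: "a \<oplus> b \<in> coass_prime R M K"
    if "a \<in> coass_prime R M K" "b \<in> coass_prime R M K" for a b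
  proof (rule ccontr)
    have ab: "a \<in> carrier R" "b \<in> carrier R" using that by (auto simp: coass_prime_def)
    assume "\<not> ?thesis"
    then have cover: "D (a \<oplus> b) <+>\<^bsub>M\<^esub> K = carrier M" using ab mem by blast
    have "D (a \<oplus> b) \<subseteq> D a <+>\<^bsub>M\<^esub> D b"
      using ab by (auto simp: D_def smult_l_distr mem_set_add_iff intro!: bexI)
    then have "D (a \<oplus> b) <+>\<^bsub>M\<^esub> K \<subseteq> (D a <+>\<^bsub>M\<^esub> D b) <+>\<^bsub>M\<^esub> K"
      by (intro set_add_mono order_refl)
    then have "(D a <+>\<^bsub>M\<^esub> D b) <+>\<^bsub>M\<^esub> K = carrier M"
      using cover set_add_eq_carrierI[OF submodule_set_add[OF D D] K'] ab by simp
    then have "D a <+>\<^bsub>M\<^esub> K = carrier M \<or> D b <+>\<^bsub>M\<^esub> K = carrier M"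
      by (rule hollow_over_cases[OF K D[OF ab(1)] D[OF ab(2)]])
    then show False using that mem[OF ab(1)] mem[OF ab(2)] by simp
  qed
  have mult: "x \<otimes> a \<in> coass_prime R M K" if "a \<in> coass_prime R M K" "x \<in> carrier R" for a x
  proof (rule mono[OF that(1)])
    have a: "a \<in> carrier R" using that(1) by (simp add: coass_prime_def)
    show "x \<otimes> a \<in> carrier R" using a that by simp
    have "D (x \<otimes> a) \<subseteq> D a"
    proof -
      have "(x \<otimes> a) \<odot>\<^bsub>M\<^esub> m = a \<odot>\<^bsub>M\<^esub> (x \<odot>\<^bsub>M\<^esub> m)" if "m \<in> carrier M" for m
        using \<open>x \<in> carrier R\<close> a that by (simp add: R.m_comm flip: smult_assoc1)
      then show ?thesis using that(2) by (auto simp: D_def)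
    qed
    then show "D (x \<otimes> a) \<subseteq> D a <+>\<^bsub>M\<^esub> K" using set_add_upper1[OF D[OF a] K'] by blast
  qed
  have carr: "coass_prime R M K \<subseteq> carrier R" by (auto simp: coass_prime_def)
  have zero: "\<zero> \<in> coass_prime R M K"
  proof -
    have "D \<zero> = {\<zero>\<^bsub>M\<^esub>}" by (auto simp: D_def)
    then have "D \<zero> <+>\<^bsub>M\<^esub> K = K"
      using K' D[of \<zero>] by (intro set_add_self) (auto simp: submodule_iff)
    then show ?thesis using mem[of \<zero>] hollow_overD(2)[OF K] by simp
  qed
  have one: "\<one> \<notin> coass_prime R M K"
  proof -
    have "D \<one> = carrier M" by (auto simp: D_def)
    then show ?thesis
      using mem[of \<one>] set_add_upper1[OF D[of \<one>] K'] set_add_eq_carrierI[OF D[of \<one>] K'] by auto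
  qed
  have prime: "a \<otimes> b \<notin> coass_prime R M K"
    if "a \<in> carrier R" "b \<in> carrier R" "a \<notin> coass_prime R M K" "b \<notin> coass_prime R M K" for a b
  proof -
    have Da: "D a <+>\<^bsub>M\<^esub> K = carrier M" and Db: "D b <+>\<^bsub>M\<^esub> K = carrier M"
      using that mem by auto
    have ab: "submodule (D (a \<otimes> b)) R M" using D that by simp
    have "x \<in> D (a \<otimes> b) <+>\<^bsub>M\<^esub> K" if x: "x \<in> carrier M" for x
    proof -
      obtain y k where 1: "y \<in> carrier M" "k \<in> K" "x = a \<odot>\<^bsub>M\<^esub> y \<oplus>\<^bsub>M\<^esub> k"
        using x[folded Da] by (auto simp: D_def mem_set_add_iff)
      obtain z k' where 2: "z \<in> carrier M" "k' \<in> K" "y = b \<odot>\<^bsub>M\<^esub> z \<oplus>\<^bsub>M\<^esub> k'"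
        using 1(1)[folded Db] by (auto simp: D_def mem_set_add_iff)
      have kk: "k \<in> carrier M" "k' \<in> carrier M" and kK: "a \<odot>\<^bsub>M\<^esub> k' \<oplus>\<^bsub>M\<^esub> k \<in> K"
        using 1 2 K' \<open>a \<in> carrier R\<close> by (auto simp: submodule_iff)
      have "x = (a \<otimes> b) \<odot>\<^bsub>M\<^esub> z \<oplus>\<^bsub>M\<^esub> (a \<odot>\<^bsub>M\<^esub> k' \<oplus>\<^bsub>M\<^esub> k)"
        using 1(3) 2(1,3) kk \<open>a \<in> carrier R\<close> \<open>b \<in> carrier R\<close>
        by (simp add: smult_r_distr smult_assoc1 M.a_assoc)
      then show ?thesis using kK 2(1) unfolding mem_set_add_iff D_def by blast
    qed
    then show ?thesis
      using mem[of "a \<otimes> b"] set_add_eq_carrierI[OF ab K'] that by blast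
  qed
  show ?thesis
  proof (rule primeidealI[OF idealI[OF R.ring_axioms] R.cring_axioms])
    show "subgroup (coass_prime R M K) (add_monoid R)"
    proof (rule R.add.subgroupI)
      show "\<ominus> a \<in> coass_prime R M K" if "a \<in> coass_prime R M K" for a
      proof -
        have "a \<in> carrier R" using that carr by blast
        then have "\<ominus> \<one> \<otimes> a = \<ominus> a" by (simp add: R.l_minus)
        then show ?thesis using mult[OF that, of "\<ominus> \<one>"] by simp
      qed
    qed (use carr zero add in auto)
    show "carrier R \<noteq> coass_prime R M K" using one by blast
    show "a \<in> coass_prime R M K \<or> b \<in> coass_prime R M K"
      if "a \<in> carrier R" "b \<in> carrier R" "a \<otimes> b \<in> coass_prime R M K" for a b
      using prime that by blast
    show "a \<otimes> x \<in> coass_prime R M K" if "a \<in> coass_prime R M K" "x \<in> carrier R" for a x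
      using mult[OF that] that carr by (metis R.m_comm subsetD)
  qed (use mult in auto)
qed

end

context sublinear
begin

text \<open>
  Let \<open>f\<close> map a submodule \<open>X\<close> of \<open>M\<close> onto \<open>N\<close>. If \<open>X + K = M\<close>, then \<open>M / (ker f + K)\<close> is isomorphic to
  \<open>N / f (X \<inter> K)\<close>. It is a quotient of the hollow module \<open>M / K\<close>, hence hollow as soon as it is
  nonzero, and nonzero quotients of a hollow module have the same prime: if \<open>a M + ker f + K = M\<close> but
  \<open>ker f + K \<noteq> M\<close>, then already \<open>a M + K = M\<close>. This moves a coassociated prime from \<open>M\<close> to the
  subquotient \<open>N\<close>.
\<close>

lemma hollow_over_image:
  assumes K: "hollow_over R M K" and surj: "f ` X = carrier N"
    and XK: "X <+>\<^bsub>M\<^esub> K = carrier M" and ker: "{x \<in> X. f x = \<zero>\<^bsub>N\<^esub>} <+>\<^bsub>M\<^esub> K \<noteq> carrier M"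
  shows "hollow_over R N (f ` (X \<inter> K))"
    and "coass_prime R N (f ` (X \<inter> K)) = coass_prime R M K"
proof -
  let ?K = "f ` (X \<inter> K)" and ?ker = "{x \<in> X. f x = \<zero>\<^bsub>N\<^esub>}"
  note Ksub = hollow_overD(1)[OF K]
  note Kc = Ksub[unfolded M.submodule_iff]
  have K': "submodule ?K R N" by (rule submodule_image[OF M.submodule_Int[OF X Ksub]]) blast
  have ker_sub: "submodule ?ker R M" using submodule_vimage[OF N.submodule_zero] by simp
  have cover: "W <+>\<^bsub>M\<^esub> K = carrier M" if W: "submodule W R M" and XW: "X \<subseteq> W <+>\<^bsub>M\<^esub> K" for W
    using M.set_add_least[OF M.submodule_set_add[OF W Ksub] XW M.set_add_upper2[OF W Ksub]] XK
      M.set_add_eq_carrierI[OF W Ksub] by simp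
  \<comment> \<open>A submodule above \<open>?K\<close> whose preimage covers \<open>M\<close> modulo \<open>K\<close> is everything: in \<open>x = u + k\<close> with \<open>x, u \<in> X\<close>
    also \<open>k \<in> X \<inter> K\<close>.\<close>
  have full: "U = carrier N"
    if U: "submodule U R N" "?K \<subseteq> U" "{x \<in> X. f x \<in> U} <+>\<^bsub>M\<^esub> K = carrier M" for U
  proof -
    have "f x \<in> U" if x: "x \<in> X" for x
    proof -
      have "x \<in> {x \<in> X. f x \<in> U} <+>\<^bsub>M\<^esub> K" using U(3) X_carrier[OF x] by simp
      then obtain u k where *: "u \<in> X" "f u \<in> U" "k \<in> K" "x = u \<oplus>\<^bsub>M\<^esub> k"
        unfolding mem_set_add_iff by blast
      have c: "u \<in> carrier M" "k \<in> carrier M" using * Kc X_carrier by auto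
      have "k = x \<ominus>\<^bsub>M\<^esub> u" using *(4) c by (simp add: M.M.minus_eq M.M.a_ac M.M.r_neg M.M.r_neg1 M.M.r_neg2)
      then have "k \<in> X" using M.submodule_minus_closed[OF X x *(1)] by simp
      then show ?thesis using * U by (auto simp: f_add N.submodule_iff)
    qed
    then have "carrier N \<subseteq> U" unfolding surj[symmetric] by blast
    then show ?thesis using U(1) by (auto simp: N.submodule_iff)
  qed
  have proper: "?K \<noteq> carrier N"
  proof
    assume eq: "?K = carrier N"
    have "x \<in> ?ker <+>\<^bsub>M\<^esub> K" if x: "x \<in> X" for x
    proof -
      have "f x \<in> ?K" using eq f_closed[OF x] by simp
      then obtain k where k: "k \<in> X" "k \<in> K" "f x = f k" by blast
      have "x \<ominus>\<^bsub>M\<^esub> k \<in> ?ker"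
        using M.submodule_minus_closed[OF X x k(1)] k x f_closed by (simp add: f_minus N.M.minus_eq N.M.r_neg)
      moreover have "x = (x \<ominus>\<^bsub>M\<^esub> k) \<oplus>\<^bsub>M\<^esub> k"
        using X_carrier x k by (simp add: M.M.minus_eq M.M.a_assoc M.M.l_neg)
      ultimately show ?thesis using k unfolding mem_set_add_iff by blast
    qed
    then show False using cover[OF ker_sub] ker by blast
  qed
  show "hollow_over R N ?K"
    unfolding hollow_over_def
  proof (intro conjI allI impI K' proper)
    fix U V assume U: "submodule U R N" "?K \<subseteq> U" and V: "submodule V R N" "?K \<subseteq> V"
      and UV: "carrier N = U <+>\<^bsub>N\<^esub> V"
    let ?U = "{x \<in> X. f x \<in> U}" and ?V = "{x \<in> X. f x \<in> V}"
    have U': "submodule ?U R M" and V': "submodule ?V R M" using U V by (auto intro: submodule_vimage)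
    have "x \<in> ?U <+>\<^bsub>M\<^esub> ?V" if x: "x \<in> X" for x
    proof -
      obtain u v where uv: "u \<in> U" "v \<in> V" "f x = u \<oplus>\<^bsub>N\<^esub> v"
        using UV f_closed[OF x] by (auto simp: mem_set_add_iff)
      have uvc: "u \<in> carrier N" "v \<in> carrier N" using uv U V by (auto simp: N.submodule_iff)
      obtain y where y: "y \<in> X" "u = f y" using surj uvc(1) by (metis imageE)
      have "f (x \<ominus>\<^bsub>M\<^esub> y) = v" using uv uvc y x
        by (simp add: f_minus N.M.minus_eq N.M.a_ac N.M.r_neg N.M.r_neg1 N.M.r_neg2)
      then have "x \<ominus>\<^bsub>M\<^esub> y \<in> ?V" using M.submodule_minus_closed[OF X x y(1)] uv by simp
      moreover have "x = y \<oplus>\<^bsub>M\<^esub> (x \<ominus>\<^bsub>M\<^esub> y)" using x y X_carrier by (intro M.eq_minus_add) auto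
      ultimately show ?thesis using y uv unfolding mem_set_add_iff by blast
    qed
    then have "X \<subseteq> (?U <+>\<^bsub>M\<^esub> ?V) <+>\<^bsub>M\<^esub> K"
      using M.set_add_upper1[OF M.submodule_set_add[OF U' V'] Ksub] by blast
    then have "(?U <+>\<^bsub>M\<^esub> ?V) <+>\<^bsub>M\<^esub> K = carrier M"
      by (intro cover M.submodule_set_add U' V')
    then show "U = carrier N \<or> V = carrier N"
      using M.hollow_over_cases[OF K U' V'] full U V by blast
  qed
  have "((\<lambda>z. a \<odot>\<^bsub>N\<^esub> z) ` carrier N) <+>\<^bsub>N\<^esub> ?K = carrier N \<longleftrightarrow>
      ((\<lambda>x. a \<odot>\<^bsub>M\<^esub> x) ` carrier M) <+>\<^bsub>M\<^esub> K = carrier M" (is "?DN <+>\<^bsub>N\<^esub> ?K = _ \<longleftrightarrow> ?DM <+>\<^bsub>M\<^esub> K = _")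
    if a: "a \<in> carrier R" for a
  proof
    have DN: "submodule ?DN R N" and DM: "submodule ?DM R M"
      using N.submodule_scalar_image[OF a N.submodule_carrier]
        M.submodule_scalar_image[OF a M.submodule_carrier] .
    show "?DM <+>\<^bsub>M\<^esub> K = carrier M" if eq: "?DN <+>\<^bsub>N\<^esub> ?K = carrier N"
    proof -
      have "x \<in> (?DM <+>\<^bsub>M\<^esub> ?ker) <+>\<^bsub>M\<^esub> K" if x: "x \<in> X" for x
      proof -
        have "f x \<in> ?DN <+>\<^bsub>N\<^esub> ?K" using eq f_closed[OF x] by simp
        then obtain z k where zk: "z \<in> carrier N" "k \<in> X" "k \<in> K" "f x = a \<odot>\<^bsub>N\<^esub> z \<oplus>\<^bsub>N\<^esub> f k"
          by (auto simp: mem_set_add_iff)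
        obtain y where y: "y \<in> X" "z = f y" using zk(1) surj by (metis imageE)
        let ?e = "x \<ominus>\<^bsub>M\<^esub> (a \<odot>\<^bsub>M\<^esub> y \<oplus>\<^bsub>M\<^esub> k)"
        have ay: "a \<odot>\<^bsub>M\<^esub> y \<oplus>\<^bsub>M\<^esub> k \<in> X" using X_closed a y zk by blast
        have "f (a \<odot>\<^bsub>M\<^esub> y \<oplus>\<^bsub>M\<^esub> k) = f x" using zk y a X_closed by (simp add: f_add f_smult)
        then have e: "?e \<in> ?ker"
          using M.submodule_minus_closed[OF X x ay] x ay f_closed[OF x]
          by (simp add: f_minus N.M.minus_eq N.M.r_neg)
        have c: "?e \<in> carrier M" "a \<odot>\<^bsub>M\<^esub> y \<in> carrier M" "k \<in> carrier M" "x \<in> carrier M"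
          using e X_carrier zk x y a by auto
        have "x = (a \<odot>\<^bsub>M\<^esub> y \<oplus>\<^bsub>M\<^esub> k) \<oplus>\<^bsub>M\<^esub> ?e" using x ay X_carrier by (intro M.eq_minus_add) auto
        also have "\<dots> = (a \<odot>\<^bsub>M\<^esub> y \<oplus>\<^bsub>M\<^esub> ?e) \<oplus>\<^bsub>M\<^esub> k" using c(1-3) by (simp add: M.M.a_ac)
        finally have "x = (a \<odot>\<^bsub>M\<^esub> y \<oplus>\<^bsub>M\<^esub> ?e) \<oplus>\<^bsub>M\<^esub> k" .
        moreover have "a \<odot>\<^bsub>M\<^esub> y \<oplus>\<^bsub>M\<^esub> ?e \<in> ?DM <+>\<^bsub>M\<^esub> ?ker"
          unfolding mem_set_add_iff using e X_carrier[OF y(1)] by blast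
        ultimately show ?thesis using zk(3) unfolding mem_set_add_iff[of x] by blast
      qed
      then have "(?DM <+>\<^bsub>M\<^esub> ?ker) <+>\<^bsub>M\<^esub> K = carrier M"
        by (intro cover M.submodule_set_add DM ker_sub) blast
      then show ?thesis using M.hollow_over_cases[OF K DM ker_sub] ker by blast
    qed
    show "?DN <+>\<^bsub>N\<^esub> ?K = carrier N" if eq: "?DM <+>\<^bsub>M\<^esub> K = carrier M"
    proof -
      have "f x \<in> ?DN <+>\<^bsub>N\<^esub> ?K" if x: "x \<in> X" for x
      proof -
        have "x \<in> ?DM <+>\<^bsub>M\<^esub> K" using eq X_carrier[OF x] by simp
        then obtain m k where mk: "m \<in> carrier M" "k \<in> K" "x = a \<odot>\<^bsub>M\<^esub> m \<oplus>\<^bsub>M\<^esub> k"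
          by (auto simp: mem_set_add_iff)
        have "m \<in> X <+>\<^bsub>M\<^esub> K" using XK mk by simp
        then obtain y k' where yk: "y \<in> X" "k' \<in> K" "m = y \<oplus>\<^bsub>M\<^esub> k'"
          unfolding mem_set_add_iff by blast
        let ?k = "a \<odot>\<^bsub>M\<^esub> k' \<oplus>\<^bsub>M\<^esub> k"
        have c: "k \<in> carrier M" "k' \<in> carrier M" "y \<in> carrier M" "a \<odot>\<^bsub>M\<^esub> y \<in> X" "?k \<in> K"
          using mk yk Kc X_closed a by auto
        have xeq: "x = a \<odot>\<^bsub>M\<^esub> y \<oplus>\<^bsub>M\<^esub> ?k" using mk(3) yk(3) c(1-3) a
          by (simp add: M.smult_r_distr M.M.a_assoc)
        then have "?k = x \<ominus>\<^bsub>M\<^esub> a \<odot>\<^bsub>M\<^esub> y"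
          using c(1-3) a by (simp add: M.M.minus_eq M.M.a_ac M.M.r_neg M.M.r_neg1 M.M.r_neg2)
        then have "?k \<in> X" using M.submodule_minus_closed[OF X x c(4)] by simp
        then have "f x = a \<odot>\<^bsub>N\<^esub> f y \<oplus>\<^bsub>N\<^esub> f ?k" "f ?k \<in> ?K"
          using xeq c(4,5) yk(1) a by (auto simp: f_add f_smult)
        then show ?thesis using f_closed[OF yk(1)] unfolding mem_set_add_iff by blast
      qed
      then have "f ` X \<subseteq> ?DN <+>\<^bsub>N\<^esub> ?K" by (rule image_subsetI)
      then show ?thesis using N.set_add_eq_carrierI[OF DN K'] by (simp only: surj)
    qed
  qed
  then show "coass_prime R N ?K = coass_prime R M K"
    by (auto simp: coass_prime_def)
qed

text \<open>
  A quotient of the quotient \<open>N\<close> of \<open>M\<close> is a quotient of \<open>M\<close>, so coassociated primes of \<open>N\<close> are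
  coassociated to \<open>M\<close>.
\<close>

lemma hollow_over_vimage:
  assumes X_def: "X = carrier M" and surj: "f ` X = carrier N" and K: "hollow_over R N K"
  shows "hollow_over R M {x \<in> X. f x \<in> K}"
    and "coass_prime R M {x \<in> X. f x \<in> K} = coass_prime R N K"
proof -
  let ?K = "{x \<in> X. f x \<in> K}"
  note Kc = hollow_overD(1)[OF K, unfolded N.submodule_iff]
  have K': "submodule ?K R M" by (rule submodule_vimage[OF hollow_overD(1)[OF K]])
  have img: "f ` (X \<inter> ?K) = K" using surj Kc by (auto simp: image_iff subset_iff)
  have full: "U = carrier M" if U: "submodule U R M" "?K \<subseteq> U" "f ` U = carrier N" for U
  proof -
    note Uc = U(1)[unfolded M.submodule_iff]
    have "x \<in> U" if x: "x \<in> carrier M" for x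
    proof -
      obtain u where u: "u \<in> U" "f x = f u" using U(3) f_closed x X_def by (metis imageE)
      have uX: "u \<in> X" using u Uc X_def by blast
      then have "f (x \<ominus>\<^bsub>M\<^esub> u) = \<zero>\<^bsub>N\<^esub>"
        using x u X_def f_closed[of u] by (simp add: f_minus N.M.minus_eq N.M.r_neg)
      then have "x \<ominus>\<^bsub>M\<^esub> u \<in> U" using U(2) Kc x uX X_def by auto
      moreover have "x = u \<oplus>\<^bsub>M\<^esub> (x \<ominus>\<^bsub>M\<^esub> u)" using x uX X_def by (intro M.eq_minus_add) auto
      ultimately show ?thesis using u Uc by metis
    qed
    then show ?thesis using Uc by blast
  qed
  have proper: "?K \<noteq> carrier M"
  proof
    assume "?K = carrier M"
    then have "X \<inter> ?K = X" using X_def by blast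
    then show False using img surj hollow_overD(2)[OF K] by simp
  qed
  show hollow: "hollow_over R M ?K"
    unfolding hollow_over_def
  proof (intro conjI allI impI K' proper)
    fix U V assume U: "submodule U R M" "?K \<subseteq> U" and V: "submodule V R M" "?K \<subseteq> V"
      and UV: "carrier M = U <+>\<^bsub>M\<^esub> V"
    have sub: "U \<subseteq> X" "V \<subseteq> X" using U V X_def by (auto simp: M.submodule_iff)
    have fU: "submodule (f ` U) R N" "submodule (f ` V) R N"
      using U V sub by (auto intro: submodule_image)
    have "carrier N \<subseteq> f ` U <+>\<^bsub>N\<^esub> f ` V"
    proof
      fix z assume "z \<in> carrier N"
      then obtain x where x: "x \<in> carrier M" "z = f x" using surj X_def by (metis imageE)
      then obtain u v where "u \<in> U" "v \<in> V" "x = u \<oplus>\<^bsub>M\<^esub> v" using UV by (auto simp: mem_set_add_iff)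
      then show "z \<in> f ` U <+>\<^bsub>N\<^esub> f ` V" using x sub f_add unfolding mem_set_add_iff by blast
    qed
    then have "carrier N = f ` U <+>\<^bsub>N\<^esub> f ` V" using N.set_add_eq_carrierI[OF fU] by simp
    moreover have "f ` (X \<inter> ?K) \<subseteq> f ` U" "f ` (X \<inter> ?K) \<subseteq> f ` V" using U V by blast+
    then have "K \<subseteq> f ` U" "K \<subseteq> f ` V" by (simp_all only: img)
    ultimately have "f ` U = carrier N \<or> f ` V = carrier N"
      using K fU unfolding hollow_over_def by blast
    then show "U = carrier M \<or> V = carrier M" using full U V by blast
  qed
  have ker_sub: "submodule {x \<in> X. f x = \<zero>\<^bsub>N\<^esub>} R M" using submodule_vimage[OF N.submodule_zero] by simp
  have "X <+>\<^bsub>M\<^esub> ?K = carrier M"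
    using M.set_add_upper1[OF X K'] M.set_add_eq_carrierI[OF X K'] X_def by blast
  moreover have "{x \<in> X. f x = \<zero>\<^bsub>N\<^esub>} <+>\<^bsub>M\<^esub> ?K = ?K"
    by (rule M.set_add_self[OF ker_sub K']) (use Kc in auto)
  ultimately show "coass_prime R M ?K = coass_prime R N K"
    using hollow_over_image(2)[OF hollow surj] proper img by simp
qed

end

text \<open>
  The projection to the quotient links the coset construction to the elementwise notions.
\<close>

lemma quot_projection:
  assumes M: "module R M" and K: "submodule K R M"
  shows "sublinear R M (quot_module M K) (carrier M) (\<lambda>x. K +>\<^bsub>M\<^esub> x)"
    and "(\<lambda>x. K +>\<^bsub>M\<^esub> x) ` carrier M = carrier (quot_module M K)"
    and "{x \<in> carrier M. K +>\<^bsub>M\<^esub> x = \<zero>\<^bsub>quot_module M K\<^esub>} = K"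
proof -
  interpret M: module R M by fact
  interpret Q: module R "quot_module M K" using assms by (rule module_quot_module)
  interpret K: additive_subgroup K M using K by (intro additive_subgroup.intro submodule.axioms)
  interpret K: abelian_subgroup K M
    by (rule abelian_subgroupI3[OF K.additive_subgroup_axioms M.abelian_group_axioms])
  note Kc = K[unfolded M.submodule_iff]
  show img: "(\<lambda>x. K +>\<^bsub>M\<^esub> x) ` carrier M = carrier (quot_module M K)"
    by (auto simp: quot_module_def A_RCOSETS_def')
  have smult: "(\<Union>z\<in>K +>\<^bsub>M\<^esub> x. K +>\<^bsub>M\<^esub> (a \<odot>\<^bsub>M\<^esub> z)) = K +>\<^bsub>M\<^esub> (a \<odot>\<^bsub>M\<^esub> x)"
    if a: "a \<in> carrier R" and x: "x \<in> carrier M" for a x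
  proof -
    have "K +>\<^bsub>M\<^esub> (a \<odot>\<^bsub>M\<^esub> z) = K +>\<^bsub>M\<^esub> (a \<odot>\<^bsub>M\<^esub> x)" if z: "z \<in> K +>\<^bsub>M\<^esub> x" for z
    proof -
      obtain k where k: "k \<in> K" "z = k \<oplus>\<^bsub>M\<^esub> x" using z by (auto simp: a_r_coset_def')
      then have "a \<odot>\<^bsub>M\<^esub> z = a \<odot>\<^bsub>M\<^esub> k \<oplus>\<^bsub>M\<^esub> a \<odot>\<^bsub>M\<^esub> x" "a \<odot>\<^bsub>M\<^esub> k \<in> K"
        using Kc a x by (auto simp: M.smult_r_distr)
      then have "a \<odot>\<^bsub>M\<^esub> z \<in> K +>\<^bsub>M\<^esub> (a \<odot>\<^bsub>M\<^esub> x)" by (auto simp: a_r_coset_def')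
      then show ?thesis using K.a_repr_independence' a x by auto
    qed
    moreover have "x \<in> K +>\<^bsub>M\<^esub> x" using K.a_rcos_self x by blast
    ultimately show ?thesis by blast
  qed
  have "linear_on R M (carrier M) (quot_module M K) (\<lambda>x. K +>\<^bsub>M\<^esub> x)"
    unfolding linear_on_def img[symmetric] by (auto simp: quot_module_def smult K.a_rcos_sum)
  then show "sublinear R M (quot_module M K) (carrier M) (\<lambda>x. K +>\<^bsub>M\<^esub> x)"
    by unfold_locales (simp_all add: M.submodule_carrier)
  show "{x \<in> carrier M. K +>\<^bsub>M\<^esub> x = \<zero>\<^bsub>quot_module M K\<^esub>} = K"
    using K.a_rcos_self K.a_rcos_const Kc by (auto simp: quot_module_def)
qed

lemma hollow_over_zero_iff:
  assumes "module R M"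
  shows "hollow_over R M {\<zero>\<^bsub>M\<^esub>} \<longleftrightarrow> carrier M \<noteq> {\<zero>\<^bsub>M\<^esub>} \<and> hollow R M"
proof -
  interpret module R M by fact
  have "{\<zero>\<^bsub>M\<^esub>} \<subseteq> U" if "submodule U R M" for U
    using that by (simp add: submodule_iff)
  then show ?thesis
    unfolding hollow_over_def hollow_def using submodule_zero by metis
qed

text \<open>
  Coassociated primes in terms of submodules; primality comes from \<open>coass_prime_prime\<close>. Both
  directions compare \<open>K\<close> in \<open>M\<close> with the zero submodule of \<open>M / K\<close>.
\<close>

lemma Coass_eq:
  assumes M: "module R M"
  shows "Coass R M = {coass_prime R M K | K. hollow_over R M K}"
proof -
  interpret M: module R M by fact
  have quot: "carrier (quot_module M K) \<noteq> {\<zero>\<^bsub>quot_module M K\<^esub>} \<and> hollow R (quot_module M K)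
      \<longleftrightarrow> hollow_over R M K" (is "?l \<longleftrightarrow> _")
    and prime: "hollow_over R M K \<Longrightarrow> {a \<in> carrier R. (\<lambda>x. a \<odot>\<^bsub>quot_module M K\<^esub> x) ` carrier (quot_module M K)
        \<noteq> carrier (quot_module M K)} = coass_prime R M K" (is "_ \<Longrightarrow> ?P = _")
    if K: "submodule K R M" for K
  proof -
    let ?Q = "quot_module M K"
    interpret Q: module R ?Q using M K by (rule module_quot_module)
    interpret p: sublinear R M ?Q "carrier M" "\<lambda>x. K +>\<^bsub>M\<^esub> x" using quot_projection[OF M K] by blast
    note surj = quot_projection(2)[OF M K] and ker = quot_projection(3)[OF M K]
    have img: "(\<lambda>x. K +>\<^bsub>M\<^esub> x) ` (carrier M \<inter> K) = {\<zero>\<^bsub>?Q\<^esub>}"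
    proof -
      have "\<zero>\<^bsub>M\<^esub> \<in> carrier M \<inter> K" using K by (auto simp: M.submodule_iff)
      moreover have "\<forall>x\<in>K. K +>\<^bsub>M\<^esub> x = \<zero>\<^bsub>?Q\<^esub>" using ker by blast
      ultimately show ?thesis by blast
    qed
    have XK: "carrier M <+>\<^bsub>M\<^esub> K = carrier M"
      using M.set_add_upper1[OF M.submodule_carrier K] M.set_add_eq_carrierI[OF M.submodule_carrier K] by blast
    have kK: "{x \<in> carrier M. K +>\<^bsub>M\<^esub> x = \<zero>\<^bsub>?Q\<^esub>} <+>\<^bsub>M\<^esub> K = K"
      unfolding ker by (rule M.set_add_self[OF K K order_refl])
    have fwd: "hollow_over R ?Q {\<zero>\<^bsub>?Q\<^esub>}" "coass_prime R ?Q {\<zero>\<^bsub>?Q\<^esub>} = coass_prime R M K"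
      if "hollow_over R M K"
      using p.hollow_over_image[OF that surj XK] hollow_overD(2)[OF that] unfolding kK img by auto
    have "hollow_over R M K" if "hollow_over R ?Q {\<zero>\<^bsub>?Q\<^esub>}"
      using p.hollow_over_vimage(1)[OF refl surj that] ker by simp
    with fwd show "?l \<longleftrightarrow> hollow_over R M K"
      using hollow_over_zero_iff[OF Q.module_axioms] by blast
    have zero: "A <+>\<^bsub>?Q\<^esub> {\<zero>\<^bsub>?Q\<^esub>} = A" if "A \<subseteq> carrier ?Q" for A
      using that by (auto simp: mem_set_add_iff subset_iff)
    have "((\<lambda>x. a \<odot>\<^bsub>?Q\<^esub> x) ` carrier ?Q) <+>\<^bsub>?Q\<^esub> {\<zero>\<^bsub>?Q\<^esub>} = (\<lambda>x. a \<odot>\<^bsub>?Q\<^esub> x) ` carrier ?Q"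
      if "a \<in> carrier R" for a using that by (intro zero image_subsetI Q.smult_closed)
    then show "?P = coass_prime R M K" if "hollow_over R M K"
      unfolding fwd(2)[OF that, symmetric]
      unfolding coass_prime_def by (simp cong: conj_cong)
  qed
  show ?thesis
  proof (intro equalityI subsetI)
    fix P assume "P \<in> Coass R M"
    then obtain K where K: "submodule K R M"
      and h: "carrier (quot_module M K) \<noteq> {\<zero>\<^bsub>quot_module M K\<^esub>} \<and> hollow R (quot_module M K)"
      and P: "P = {a \<in> carrier R. (\<lambda>x. a \<odot>\<^bsub>quot_module M K\<^esub> x) ` carrier (quot_module M K)
        \<noteq> carrier (quot_module M K)}"
      unfolding Coass_def Let_def by blast
    have "hollow_over R M K" using quot[OF K] h by simp
    then show "P \<in> {coass_prime R M K | K. hollow_over R M K}"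
      using P prime[OF K] by auto
  next
    fix P assume "P \<in> {coass_prime R M K | K. hollow_over R M K}"
    then obtain K where K: "hollow_over R M K" and P: "P = coass_prime R M K" by blast
    note K' = hollow_overD(1)[OF K]
    have "P \<in> Spec R" using M.coass_prime_prime[OF K] P by (simp add: Spec_def)
    moreover have "submodule K R M \<and> (let N' = quot_module M K in
      carrier N' \<noteq> {\<zero>\<^bsub>N'\<^esub>} \<and> hollow R N' \<and>
      P = {a \<in> carrier R. (\<lambda>x. a \<odot>\<^bsub>N'\<^esub> x) ` carrier N' \<noteq> carrier N'})"
      unfolding Let_def P prime[OF K' K] using K' K quot[OF K'] by simp
    ultimately show "P \<in> Coass R M" unfolding Coass_def by blast
  qed
qed

section \<open>Existence of hollow quotients over Noetherian rings\<close>

text \<open>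
  The descending chain condition for the submodules contained in \<open>X\<close>, in the form of the minimum
  condition.
\<close>

definition min_cond :: "('r, 'a) ring_scheme \<Rightarrow> ('r, 'm, 'b) module_scheme \<Rightarrow> 'm set \<Rightarrow> bool"
  where "min_cond R M X \<longleftrightarrow> (\<forall>\<U>. \<U> \<noteq> {} \<longrightarrow> (\<forall>U\<in>\<U>. submodule U R M \<and> U \<subseteq> X) \<longrightarrow>
    (\<exists>U\<in>\<U>. \<forall>V\<in>\<U>. V \<subseteq> U \<longrightarrow> V = U))"

lemma min_condD:
  assumes "min_cond R M X" "\<U> \<noteq> {}" "\<And>U. U \<in> \<U> \<Longrightarrow> submodule U R M \<and> U \<subseteq> X"
  shows "\<exists>U\<in>\<U>. \<forall>V\<in>\<U>. V \<subseteq> U \<longrightarrow> V = U"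
  using assms(1)[unfolded min_cond_def, THEN spec, THEN mp, THEN mp, OF assms(2) ballI[OF assms(3)]] .

lemma (in noetherian_ring) exists_maximal_ideal_in:
  assumes "\<J> \<noteq> {}" and ideals: "\<And>I. I \<in> \<J> \<Longrightarrow> ideal I R"
  shows "\<exists>I\<in>\<J>. \<forall>J\<in>\<J>. I \<subseteq> J \<longrightarrow> J = I"
proof (rule subset_Zorn_nonempty[OF assms(1)])
  fix C assume C: "C \<noteq> {}" "subset.chain \<J> C"
  then have "subset.chain {I. ideal I R} C" using ideals by (auto simp: subset.chain_def)
  then have "\<Union>C \<in> C" using C(1) by (rule ideal_chain_is_trivial[rotated])
  then show "\<Union>C \<in> \<J>" using C(2) by (auto simp: subset.chain_def)
qed

context module
begin

lemma submodule_annihilated: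
  assumes "submodule U R M" "a \<in> carrier R"
  shows "submodule {x \<in> U. a \<odot>\<^bsub>M\<^esub> x = \<zero>\<^bsub>M\<^esub>} R M"
proof -
  have "a \<odot>\<^bsub>M\<^esub> (b \<odot>\<^bsub>M\<^esub> x) = b \<odot>\<^bsub>M\<^esub> (a \<odot>\<^bsub>M\<^esub> x)" if "b \<in> carrier R" "x \<in> carrier M" for b x
    using that assms(2) by (simp add: R.m_comm flip: smult_assoc1)
  then show ?thesis
    using assms unfolding submodule_iff by (auto simp: smult_r_distr subset_iff)
qed

lemma pow_smult_Suc:
  assumes "a \<in> carrier R" "x \<in> carrier M"
  shows "a [^] Suc n \<odot>\<^bsub>M\<^esub> x = a [^] n \<odot>\<^bsub>M\<^esub> (a \<odot>\<^bsub>M\<^esub> x)"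
    and "a [^] Suc n \<odot>\<^bsub>M\<^esub> x = a \<odot>\<^bsub>M\<^esub> (a [^] n \<odot>\<^bsub>M\<^esub> x)"
proof -
  show 1: "a [^] Suc n \<odot>\<^bsub>M\<^esub> x = a [^] n \<odot>\<^bsub>M\<^esub> (a \<odot>\<^bsub>M\<^esub> x)"
    using assms by (simp add: smult_assoc1)
  then show "a [^] Suc n \<odot>\<^bsub>M\<^esub> x = a \<odot>\<^bsub>M\<^esub> (a [^] n \<odot>\<^bsub>M\<^esub> x)"
    using assms by (simp add: R.m_comm flip: smult_assoc1)
qed

text \<open>
  Let \<open>A\<close> be the kernel of the locally nilpotent action of \<open>a\<close> on \<open>X\<close>. A submodule \<open>U\<close> of \<open>X\<close> leaves the traces \<open>V j U = {a\<^sup>j x | x \<in> U, a\<^sup>j\<^sup>+\<^sup>1 x = 0}\<close> in \<open>A\<close>, which decrease with \<open>j\<close>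
  and increase with \<open>U\<close>, and nested submodules with the same traces are equal, by induction on the
  exponent that kills an element. A minimal one among all the traces, at \<open>j0\<close> and \<open>U0\<close>, settles the
  indices from \<open>j0\<close> on for all \<open>U \<subseteq> U0\<close>; the finitely many traces with smaller index are then
  minimized one after the other. This is dual to the proof of Hilbert's basis theorem.
\<close>

lemma min_cond_of_annihilated:
  assumes X: "submodule X R M" and a: "a \<in> carrier R"
    and nil: "\<And>x. x \<in> X \<Longrightarrow> \<exists>n::nat. a [^] n \<odot>\<^bsub>M\<^esub> x = \<zero>\<^bsub>M\<^esub>"
    and min: "min_cond R M {x \<in> X. a \<odot>\<^bsub>M\<^esub> x = \<zero>\<^bsub>M\<^esub>}"
  shows "min_cond R M X"
  unfolding min_cond_def
proof (intro allI impI)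
  fix \<U> assume ne: "\<U> \<noteq> {}" and sub: "\<forall>U\<in>\<U>. submodule U R M \<and> U \<subseteq> X"
  let ?A = "{x \<in> X. a \<odot>\<^bsub>M\<^esub> x = \<zero>\<^bsub>M\<^esub>}"
  note Xc = X[unfolded submodule_iff]
  define V where "V j U = (\<lambda>x. a [^] j \<odot>\<^bsub>M\<^esub> x) ` {x \<in> U. a [^] Suc j \<odot>\<^bsub>M\<^esub> x = \<zero>\<^bsub>M\<^esub>}" for j :: nat and U
  have V_sub: "submodule (V j U) R M \<and> V j U \<subseteq> ?A" if U: "U \<in> \<U>" for j U
  proof
    have US: "submodule U R M" "U \<subseteq> X" using U sub by auto
    have aj: "a [^] j \<in> carrier R" "a [^] Suc j \<in> carrier R" using a by (auto intro: R.nat_pow_closed)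
    show "submodule (V j U) R M"
      unfolding V_def by (intro submodule_scalar_image submodule_annihilated US aj)
    show "V j U \<subseteq> ?A"
    proof
      fix y assume "y \<in> V j U"
      then obtain x where x: "x \<in> U" "a [^] Suc j \<odot>\<^bsub>M\<^esub> x = \<zero>\<^bsub>M\<^esub>" "y = a [^] j \<odot>\<^bsub>M\<^esub> x"
        unfolding V_def by blast
      have "x \<in> X" "x \<in> carrier M" using x US Xc by auto
      then show "y \<in> ?A" using x Xc aj(1) pow_smult_Suc(2)[OF a, of x j] by auto
    qed
  qed
  have V_dec: "V (Suc j) U \<subseteq> V j U" if U: "U \<in> \<U>" for j U
  proof
    fix y assume "y \<in> V (Suc j) U"
    then obtain x where x: "x \<in> U" "a [^] Suc (Suc j) \<odot>\<^bsub>M\<^esub> x = \<zero>\<^bsub>M\<^esub>" "y = a [^] Suc j \<odot>\<^bsub>M\<^esub> x"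
      unfolding V_def by blast
    have "x \<in> carrier M" and ax: "a \<odot>\<^bsub>M\<^esub> x \<in> U" using x(1) U sub a by (auto simp: submodule_iff)
    then have "y = a [^] j \<odot>\<^bsub>M\<^esub> (a \<odot>\<^bsub>M\<^esub> x)" "a [^] Suc j \<odot>\<^bsub>M\<^esub> (a \<odot>\<^bsub>M\<^esub> x) = \<zero>\<^bsub>M\<^esub>"
      using x pow_smult_Suc(1)[OF a] by metis+
    then show "y \<in> V j U" using ax unfolding V_def by blast
  qed
  have V_antimono: "V i U \<subseteq> V j U" if "U \<in> \<U>" "j \<le> i" for i j U
    using that(2) by (induction rule: dec_induct) (use V_dec[OF that(1)] in blast)+
  have V_mono: "V j U \<subseteq> V j U'" if "U \<subseteq> U'" for j U U'
    using that unfolding V_def by blast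
  obtain j0 U0 where U0: "U0 \<in> \<U>"
    and min0: "\<And>j U. U \<in> \<U> \<Longrightarrow> V j U \<subseteq> V j0 U0 \<Longrightarrow> V j U = V j0 U0"
  proof -
    have "\<exists>W\<in>{V j U | j U. U \<in> \<U>}. \<forall>W'\<in>{V j U | j U. U \<in> \<U>}. W' \<subseteq> W \<longrightarrow> W' = W"
    proof (rule min_condD[OF min])
      show "{V j U | j U. U \<in> \<U>} \<noteq> {}" using ne by blast
      show "submodule W R M \<and> W \<subseteq> ?A" if "W \<in> {V j U | j U. U \<in> \<U>}" for W
        using that V_sub by auto
    qed
    then obtain j U where "U \<in> \<U>"
      "\<forall>W'\<in>{V j U | j U. U \<in> \<U>}. W' \<subseteq> V j U \<longrightarrow> W' = V j U" by auto
    then show thesis by (intro that[of U j]) auto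
  qed
  \<comment> \<open>Lexicographic minimization of \<open>V 0, \<dots>, V (j - 1)\<close> among the members of \<open>\<U>\<close> below \<open>U0\<close>.\<close>
  have lex: "\<exists>U1\<in>\<U>. U1 \<subseteq> U0 \<and> (\<forall>U\<in>\<U>. U \<subseteq> U1 \<longrightarrow> (\<forall>i<j. V i U = V i U1))" for j
  proof (induction j)
    case 0
    then show ?case using U0 by auto
  next
    case (Suc j)
    then obtain U1 where U1: "U1 \<in> \<U>" "U1 \<subseteq> U0"
      and eq: "\<forall>U\<in>\<U>. U \<subseteq> U1 \<longrightarrow> (\<forall>i<j. V i U = V i U1)" by blast
    have "\<exists>W\<in>V j ` {U \<in> \<U>. U \<subseteq> U1}. \<forall>W'\<in>V j ` {U \<in> \<U>. U \<subseteq> U1}. W' \<subseteq> W \<longrightarrow> W' = W"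
      by (rule min_condD[OF min]) (use U1 V_sub in auto)
    then obtain W where W: "W \<in> V j ` {U \<in> \<U>. U \<subseteq> U1}"
      and W_min: "\<forall>W'\<in>V j ` {U \<in> \<U>. U \<subseteq> U1}. W' \<subseteq> W \<longrightarrow> W' = W" by blast
    from W obtain U2 where U2: "U2 \<in> \<U>" "U2 \<subseteq> U1" "W = V j U2" by blast
    have "V i U = V i U2" if U: "U \<in> \<U>" "U \<subseteq> U2" and i: "i < Suc j" for U i
    proof (cases "i = j")
      case True
      have "V j U \<in> V j ` {U \<in> \<U>. U \<subseteq> U1}" using U U2 by auto
      moreover have "V j U \<subseteq> W" using V_mono[OF U(2), of j] U2(3) by simp
      ultimately have "V j U = W" using W_min by blast
      then show ?thesis using U2(3) True by simp
    next
      case False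
      then have "i < j" using i by simp
      then show ?thesis using eq U(1) subset_trans[OF U(2) U2(2)] U2(1,2) by simp
    qed
    then show ?case using U2 U1 by blast
  qed
  obtain U1 where U1: "U1 \<in> \<U>" "U1 \<subseteq> U0"
    and low: "\<forall>U\<in>\<U>. U \<subseteq> U1 \<longrightarrow> (\<forall>i<j0. V i U = V i U1)"
    using lex[of j0] by blast
  have high: "V i U = V j0 U0" if "U \<in> \<U>" "U \<subseteq> U1" "\<not> i < j0" for U i
  proof (rule min0[OF that(1)])
    have "V i U \<subseteq> V j0 U" using that V_antimono by simp
    also have "\<dots> \<subseteq> V j0 U0" using that U1 by (intro V_mono) blast
    finally show "V i U \<subseteq> V j0 U0" .
  qed
  have V_eq: "V i U = V i U1" if "U \<in> \<U>" "U \<subseteq> U1" for U i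
    using low that high[OF that, of i] high[OF U1(1) order_refl, of i] by (cases "i < j0") auto
  show "\<exists>U\<in>\<U>. \<forall>V\<in>\<U>. V \<subseteq> U \<longrightarrow> V = U"
  proof (intro bexI[OF _ U1(1)] ballI impI)
    fix U assume U: "U \<in> \<U>" "U \<subseteq> U1"
    have US: "submodule U R M" and US1: "submodule U1 R M" "U1 \<subseteq> X" using U U1 sub by auto
    note Uc = US[unfolded submodule_iff] and U1c = US1(1)[unfolded submodule_iff]
    have "x \<in> U" if "x \<in> U1" "a [^] n \<odot>\<^bsub>M\<^esub> x = \<zero>\<^bsub>M\<^esub>" for n :: nat and x
      using that
    proof (induction n arbitrary: x)
      case 0
      then show ?case using Uc U1c by auto
    next
      case (Suc n)
      have "a [^] n \<odot>\<^bsub>M\<^esub> x \<in> V n U1" using Suc.prems unfolding V_def by blast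
      then have "a [^] n \<odot>\<^bsub>M\<^esub> x \<in> V n U" using V_eq[OF U] by simp
      then obtain u where u: "u \<in> U" "a [^] n \<odot>\<^bsub>M\<^esub> x = a [^] n \<odot>\<^bsub>M\<^esub> u" unfolding V_def by blast
      have c: "x \<in> carrier M" "u \<in> carrier M" "a [^] n \<in> carrier R"
        using Suc.prems u U1c Uc a by (auto intro: R.nat_pow_closed)
      have "x \<ominus>\<^bsub>M\<^esub> u \<in> U1" using submodule_minus_closed[OF US1(1)] Suc.prems u U by blast
      moreover have "a [^] n \<odot>\<^bsub>M\<^esub> (x \<ominus>\<^bsub>M\<^esub> u) = \<zero>\<^bsub>M\<^esub>"
        using u c by (simp add: M.minus_eq smult_r_distr smult_r_minus M.r_neg)
      ultimately have "x \<ominus>\<^bsub>M\<^esub> u \<in> U" by (rule Suc.IH)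
      then have "u \<oplus>\<^bsub>M\<^esub> (x \<ominus>\<^bsub>M\<^esub> u) \<in> U" using u Uc by blast
      then show ?case using eq_minus_add[OF c(1,2)] by simp
    qed
    then show "U = U1" using nil US1(2) U(2) by blast
  qed
qed

lemma submodule_annihilated_set:
  assumes "F \<subseteq> carrier R"
  shows "submodule {x \<in> carrier M. \<forall>a\<in>F. a \<odot>\<^bsub>M\<^esub> x = \<zero>\<^bsub>M\<^esub>} R M"
proof -
  have "a \<odot>\<^bsub>M\<^esub> (b \<odot>\<^bsub>M\<^esub> x) = b \<odot>\<^bsub>M\<^esub> (a \<odot>\<^bsub>M\<^esub> x)"
    if "a \<in> F" "b \<in> carrier R" "x \<in> carrier M" for a b x
  proof -
    have "a \<in> carrier R" using that(1) assms by blast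
    then show ?thesis using that by (simp add: R.m_comm flip: smult_assoc1)
  qed
  then show ?thesis
    using assms unfolding submodule_iff by (auto simp: smult_r_distr subset_iff)
qed

lemma annihilator_eq_colon: "{r \<in> carrier R. r \<odot>\<^bsub>M\<^esub> x = \<zero>\<^bsub>M\<^esub>} = {r \<in> carrier R. r \<odot>\<^bsub>M\<^esub> x \<in> {\<zero>\<^bsub>M\<^esub>}}"
  by simp

lemma ideal_annihilator:
  "x \<in> carrier M \<Longrightarrow> ideal {r \<in> carrier R. r \<odot>\<^bsub>M\<^esub> x = \<zero>\<^bsub>M\<^esub>} R"
  unfolding annihilator_eq_colon by (rule ideal_colon[OF submodule_zero])

text \<open>
  By the last assumption \<open>s\<close> generates a simple essential socle. Let \<open>\<mm>\<close> be the annihilator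
  of \<open>s\<close>. Elements of \<open>\<mm>\<close> are locally nilpotent: the annihilators of
  the \<open>a\<^sup>n x\<close> become constant, and if \<open>a\<^sup>n x \<noteq> 0\<close>, then \<open>s = b a\<^sup>n x\<close> for some \<open>b\<close>, which kills \<open>a\<^sup>n\<^sup>+\<^sup>1 x\<close>
  but not \<open>a\<^sup>n x\<close>. The submodule killed by \<open>\<mm>\<close> is simple. It is cut out by finitely many generators of
  \<open>\<mm>\<close>, and \<open>min_cond_of_annihilated\<close> removes these conditions one at a time.
\<close>

lemma cocyclic_min_cond:
  assumes noeth: "noetherian_ring R"
    and s: "s \<in> carrier M" "s \<noteq> \<zero>\<^bsub>M\<^esub>"
    and ess: "\<And>U. submodule U R M \<Longrightarrow> U \<noteq> {\<zero>\<^bsub>M\<^esub>} \<Longrightarrow> s \<in> U"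
  shows "min_cond R M (carrier M)"
proof -
  interpret N: noetherian_ring R by fact
  define \<mm> where "\<mm> = {r \<in> carrier R. r \<odot>\<^bsub>M\<^esub> s = \<zero>\<^bsub>M\<^esub>}"
  have cyc: "\<exists>b\<in>carrier R. s = b \<odot>\<^bsub>M\<^esub> x" if "x \<in> carrier M" "x \<noteq> \<zero>\<^bsub>M\<^esub>" for x
    using ess[OF submodule_cyclic[OF that(1)]] mem_cyclic[OF that(1)] that(2) by blast
  have nil: "\<exists>n::nat. a [^] n \<odot>\<^bsub>M\<^esub> x = \<zero>\<^bsub>M\<^esub>" if a: "a \<in> \<mm>" and x: "x \<in> carrier M" for a x
  proof -
    have aR: "a \<in> carrier R" and as: "a \<odot>\<^bsub>M\<^esub> s = \<zero>\<^bsub>M\<^esub>" using a by (auto simp: \<mm>_def)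
    have px: "a [^] n \<odot>\<^bsub>M\<^esub> x \<in> carrier M" for n :: nat using aR x by simp
    define J where "J n = {r \<in> carrier R. r \<odot>\<^bsub>M\<^esub> (a [^] n \<odot>\<^bsub>M\<^esub> x) = \<zero>\<^bsub>M\<^esub>}" for n :: nat
    have "ideal (J n) R" for n unfolding J_def using px by (rule ideal_annihilator)
    then have "\<exists>I\<in>range J. \<forall>I'\<in>range J. I \<subseteq> I' \<longrightarrow> I' = I"
      by (intro N.exists_maximal_ideal_in) auto
    then obtain n where n: "\<And>k. J n \<subseteq> J k \<Longrightarrow> J k = J n" by auto
    have comm: "r \<odot>\<^bsub>M\<^esub> (a [^] Suc n \<odot>\<^bsub>M\<^esub> x) = a \<odot>\<^bsub>M\<^esub> (r \<odot>\<^bsub>M\<^esub> (a [^] n \<odot>\<^bsub>M\<^esub> x))"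
      if "r \<in> carrier R" for r
    proof -
      have "r \<odot>\<^bsub>M\<^esub> (a \<odot>\<^bsub>M\<^esub> (a [^] n \<odot>\<^bsub>M\<^esub> x)) = a \<odot>\<^bsub>M\<^esub> (r \<odot>\<^bsub>M\<^esub> (a [^] n \<odot>\<^bsub>M\<^esub> x))"
        using that aR px by (simp add: R.m_comm flip: smult_assoc1)
      then show ?thesis by (simp only: pow_smult_Suc(2)[OF aR x])
    qed
    have "J n \<subseteq> J (Suc n)" using comm aR by (auto simp: J_def simp del: R.nat_pow_Suc)
    then have J: "J (Suc n) = J n" by (rule n)
    show ?thesis
    proof (intro exI[of _ n], rule ccontr)
      assume "a [^] n \<odot>\<^bsub>M\<^esub> x \<noteq> \<zero>\<^bsub>M\<^esub>"
      then obtain b where b: "b \<in> carrier R" "s = b \<odot>\<^bsub>M\<^esub> (a [^] n \<odot>\<^bsub>M\<^esub> x)" using cyc px by blast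
      then have "b \<in> J (Suc n)" using comm as by (simp add: J_def del: R.nat_pow_Suc)
      then have "b \<in> J n" using J by simp
      then show False using b s by (simp add: J_def)
    qed
  qed
  define Soc where "Soc F = {x \<in> carrier M. \<forall>a\<in>F. a \<odot>\<^bsub>M\<^esub> x = \<zero>\<^bsub>M\<^esub>}" for F
  have "ideal \<mm> R" unfolding \<mm>_def using s(1) by (rule ideal_annihilator)
  then obtain F where F: "F \<subseteq> carrier R" "finite F" "\<mm> = Idl F"
    using N.finetely_gen by blast
  have F\<mm>: "F \<subseteq> \<mm>" using R.genideal_self[OF F(1)] F(3) by simp
  have SocF: "Soc F = Soc \<mm>"
  proof
    show "Soc \<mm> \<subseteq> Soc F" using F\<mm> by (auto simp: Soc_def)
    show "Soc F \<subseteq> Soc \<mm>"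
    proof
      fix x assume x: "x \<in> Soc F"
      then have "F \<subseteq> {r \<in> carrier R. r \<odot>\<^bsub>M\<^esub> x = \<zero>\<^bsub>M\<^esub>}" using F(1) by (auto simp: Soc_def)
      then have "\<mm> \<subseteq> {r \<in> carrier R. r \<odot>\<^bsub>M\<^esub> x = \<zero>\<^bsub>M\<^esub>}"
        unfolding F(3) using x by (intro R.genideal_minimal ideal_annihilator) (auto simp: Soc_def)
      then show "x \<in> Soc \<mm>" using x by (auto simp: Soc_def)
    qed
  qed
  \<comment> \<open>A nonzero \<open>U\<close> contains \<open>s\<close>; any \<open>x\<close> killed by \<open>\<mm>\<close> is a multiple of \<open>s\<close>, since \<open>s = b x\<close> with \<open>b\<close> invertible
    modulo \<open>\<mm>\<close>.\<close>
  have simple: "U = Soc \<mm>" if U: "submodule U R M" "U \<subseteq> Soc \<mm>" "U \<noteq> {\<zero>\<^bsub>M\<^esub>}" for U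
  proof (rule antisym[OF U(2)], rule subsetI)
    fix x assume x: "x \<in> Soc \<mm>"
    then have xc: "x \<in> carrier M" by (simp add: Soc_def)
    note Uc = U(1)[unfolded submodule_iff]
    have sU: "s \<in> U" by (rule ess[OF U(1,3)])
    show "x \<in> U"
    proof (cases "x = \<zero>\<^bsub>M\<^esub>")
      case False
      then obtain b where b: "b \<in> carrier R" "s = b \<odot>\<^bsub>M\<^esub> x" using cyc xc by blast
      have "b \<odot>\<^bsub>M\<^esub> s \<noteq> \<zero>\<^bsub>M\<^esub>"
      proof
        assume "b \<odot>\<^bsub>M\<^esub> s = \<zero>\<^bsub>M\<^esub>"
        then have "b \<in> \<mm>" using b by (simp add: \<mm>_def)
        then show False using x b s by (simp add: Soc_def)
      qed
      then obtain c where c: "c \<in> carrier R" "s = c \<odot>\<^bsub>M\<^esub> (b \<odot>\<^bsub>M\<^esub> s)" using cyc b s by blast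
      have "\<one> \<ominus> c \<otimes> b \<in> \<mm>"
        using c b s(1) by (simp add: \<mm>_def R.minus_eq smult_l_distr smult_l_minus smult_assoc1 M.r_neg)
      then have "(\<one> \<ominus> c \<otimes> b) \<odot>\<^bsub>M\<^esub> x = \<zero>\<^bsub>M\<^esub>" using x by (simp add: Soc_def)
      then have "x \<ominus>\<^bsub>M\<^esub> c \<odot>\<^bsub>M\<^esub> s = \<zero>\<^bsub>M\<^esub>"
        using c(1) b xc by (simp add: R.minus_eq M.minus_eq smult_l_distr smult_l_minus smult_assoc1)
      then have "x = c \<odot>\<^bsub>M\<^esub> s" using eq_minus_add[OF xc, of "c \<odot>\<^bsub>M\<^esub> s"] c(1) s(1) by simp
      then show ?thesis using sU c(1) Uc by simp
    qed (use Uc in simp)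
  qed
  have base: "min_cond R M (Soc F)"
    unfolding min_cond_def SocF
  proof (intro allI impI)
    fix \<U> assume ne: "\<U> \<noteq> {}" and sub: "\<forall>U\<in>\<U>. submodule U R M \<and> U \<subseteq> Soc \<mm>"
    show "\<exists>U\<in>\<U>. \<forall>V\<in>\<U>. V \<subseteq> U \<longrightarrow> V = U"
    proof (cases "{\<zero>\<^bsub>M\<^esub>} \<in> \<U>")
      case True
      then show ?thesis using sub by (intro bexI[of _ "{\<zero>\<^bsub>M\<^esub>}"]) (auto simp: submodule_iff)
    next
      case False
      have all: "U = Soc \<mm>" if "U \<in> \<U>" for U
        using sub that False by (intro simple) auto
      obtain U where U: "U \<in> \<U>" using ne by blast
      show ?thesis by (rule bexI[OF _ U]) (metis all U)
    qed
  qed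
  have "min_cond R M (Soc G) \<longrightarrow> min_cond R M (carrier M)" if "finite G" "G \<subseteq> \<mm>" for G
    using that
  proof (induction G)
    case empty
    then show ?case by (simp add: Soc_def)
  next
    case (insert a G)
    have a: "a \<in> carrier R" and GR: "G \<subseteq> carrier R" using insert.prems by (auto simp: \<mm>_def)
    have "Soc (insert a G) = {x \<in> Soc G. a \<odot>\<^bsub>M\<^esub> x = \<zero>\<^bsub>M\<^esub>}" by (auto simp: Soc_def)
    moreover have "submodule (Soc G) R M" unfolding Soc_def by (rule submodule_annihilated_set[OF GR])
    moreover have "\<exists>n::nat. a [^] n \<odot>\<^bsub>M\<^esub> x = \<zero>\<^bsub>M\<^esub>" if "x \<in> Soc G" for x
      using nil[of a x] insert.prems that by (simp add: Soc_def)
    ultimately have "min_cond R M (Soc (insert a G)) \<longrightarrow> min_cond R M (Soc G)"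
      using min_cond_of_annihilated[of "Soc G" a] a by simp
    then show ?case using insert.IH insert.prems by simp
  qed
  then show ?thesis using base F(2) F\<mm> by blast
qed

text \<open>
  A submodule \<open>U\<close> that is minimal with \<open>U + V = M\<close> for some proper \<open>V\<close> makes \<open>M / V\<close> hollow: if \<open>X + Y = M\<close> with
  \<open>X\<close> and \<open>Y\<close> above \<open>V\<close> and \<open>Y\<close> proper, then \<open>(U \<inter> X) + Y = M\<close>, whence \<open>U \<subseteq> X\<close> by minimality and \<open>X = M\<close>.
\<close>

lemma min_cond_hollow:
  assumes min: "min_cond R M (carrier M)" and nz: "carrier M \<noteq> {\<zero>\<^bsub>M\<^esub>}"
  shows "\<exists>K. hollow_over R M K"
proof -
  define \<U> where "\<U> = {U. submodule U R M \<and> (\<exists>V. submodule V R M \<and> V \<noteq> carrier M \<and> U <+>\<^bsub>M\<^esub> V = carrier M)}"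
  have "carrier M <+>\<^bsub>M\<^esub> {\<zero>\<^bsub>M\<^esub>} = carrier M"
    using set_add_upper1[OF submodule_carrier submodule_zero]
    by (intro set_add_eq_carrierI submodule_carrier submodule_zero)
  then have "carrier M \<in> \<U>" unfolding \<U>_def using nz submodule_carrier submodule_zero by blast
  moreover have "submodule U R M \<and> U \<subseteq> carrier M" if "U \<in> \<U>" for U
    using that by (auto simp: \<U>_def submodule_iff)
  ultimately have "\<exists>U\<in>\<U>. \<forall>W\<in>\<U>. W \<subseteq> U \<longrightarrow> W = U" by (intro min_condD[OF min]) auto
  then obtain U where U: "U \<in> \<U>" and U_min: "\<forall>W\<in>\<U>. W \<subseteq> U \<longrightarrow> W = U" by blast
  then obtain V where US: "submodule U R M" and V: "submodule V R M" "V \<noteq> carrier M" "U <+>\<^bsub>M\<^esub> V = carrier M"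
    unfolding \<U>_def by blast
  have "X = carrier M \<or> Y = carrier M"
    if X: "submodule X R M" "V \<subseteq> X" and Y: "submodule Y R M" "V \<subseteq> Y" and XY: "carrier M = X <+>\<^bsub>M\<^esub> Y" for X Y
  proof (rule disjCI)
    assume Y_proper: "Y \<noteq> carrier M"
    note Xc = X(1)[unfolded submodule_iff] and Yc = Y(1)[unfolded submodule_iff]
    have UX: "submodule (U \<inter> X) R M" by (rule submodule_Int[OF US X(1)])
    have "z \<in> (U \<inter> X) <+>\<^bsub>M\<^esub> Y" if z: "z \<in> carrier M" for z
    proof -
      obtain x y where xy: "x \<in> X" "y \<in> Y" "z = x \<oplus>\<^bsub>M\<^esub> y"
        using z[unfolded XY] by (auto simp: mem_set_add_iff)
      have xc: "x \<in> carrier M" using xy Xc by blast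
      then obtain u v where uv: "u \<in> U" "v \<in> V" "x = u \<oplus>\<^bsub>M\<^esub> v"
        using V(3)[symmetric] by (auto simp: mem_set_add_iff)
      have c: "u \<in> carrier M" "v \<in> carrier M" "y \<in> carrier M"
        using uv US V(1) xy Yc by (auto simp: submodule_iff)
      have "u = x \<ominus>\<^bsub>M\<^esub> v" using uv(3) c by (simp add: M.minus_eq M.a_assoc M.r_neg)
      then have "u \<in> X" using submodule_minus_closed[OF X(1) xy(1)] uv X(2) by blast
      moreover have "z = u \<oplus>\<^bsub>M\<^esub> (v \<oplus>\<^bsub>M\<^esub> y)" using xy uv c by (simp add: M.a_assoc)
      moreover have "v \<oplus>\<^bsub>M\<^esub> y \<in> Y" using uv xy Y(2) Yc by blast
      ultimately show ?thesis using uv unfolding mem_set_add_iff by blast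
    qed
    then have "(U \<inter> X) <+>\<^bsub>M\<^esub> Y = carrier M" using set_add_eq_carrierI[OF UX Y(1)] by blast
    then have "U \<inter> X \<in> \<U>" unfolding \<U>_def using UX Y(1) Y_proper by blast
    then have "U \<inter> X = U" using U_min by simp
    then have "U \<subseteq> X" by blast
    then have "U <+>\<^bsub>M\<^esub> V \<subseteq> X" by (rule set_add_least[OF X(1) _ X(2)])
    then show "X = carrier M" using V(3) Xc by blast
  qed
  then have "hollow_over R M V" unfolding hollow_over_def using V(1,2) by blast
  then show ?thesis ..
qed

text \<open>
  A submodule \<open>K\<close> that is maximal without a given nonzero element \<open>x\<close> makes \<open>M / K\<close> a module in which
  every nonzero submodule contains the class of \<open>x\<close>. Such a quotient is Artinian, hence has a hollow
  quotient.
\<close>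

theorem exists_hollow_over:
  assumes noeth: "noetherian_ring R" and nz: "carrier M \<noteq> {\<zero>\<^bsub>M\<^esub>}"
  shows "\<exists>K. hollow_over R M K"
proof -
  obtain x where x: "x \<in> carrier M" "x \<noteq> \<zero>\<^bsub>M\<^esub>" using nz by blast
  define \<A> where "\<A> = {K. submodule K R M \<and> x \<notin> K}"
  have "\<exists>K\<in>\<A>. \<forall>U\<in>\<A>. K \<subseteq> U \<longrightarrow> U = K"
  proof (rule subset_Zorn_nonempty)
    show "\<A> \<noteq> {}" unfolding \<A>_def using submodule_zero x(2) by blast
    fix C assume C: "C \<noteq> {}" "subset.chain \<A> C"
    then have sub: "\<And>U. U \<in> C \<Longrightarrow> submodule U R M \<and> x \<notin> U" unfolding subset.chain_def \<A>_def by blast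
    have two: "\<exists>U\<in>C. u \<in> U \<and> v \<in> U" if "u \<in> \<Union>C" "v \<in> \<Union>C" for u v
      using that C(2) unfolding subset.chain_def by blast
    have "submodule (\<Union>C) R M"
      unfolding submodule_iff
    proof (intro conjI ballI)
      show "\<Union>C \<subseteq> carrier M" "\<zero>\<^bsub>M\<^esub> \<in> \<Union>C" using sub C(1) unfolding submodule_iff by blast+
      show "u \<oplus>\<^bsub>M\<^esub> v \<in> \<Union>C" if "u \<in> \<Union>C" "v \<in> \<Union>C" for u v
        using two[OF that] sub unfolding submodule_iff by blast
      show "a \<odot>\<^bsub>M\<^esub> u \<in> \<Union>C" if "a \<in> carrier R" "u \<in> \<Union>C" for a u
        using that sub unfolding submodule_iff by blast
    qed
    then show "\<Union>C \<in> \<A>" unfolding \<A>_def using sub by blast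
  qed
  then obtain K where K: "submodule K R M" "x \<notin> K"
    and K_max: "\<forall>U. submodule U R M \<longrightarrow> x \<notin> U \<longrightarrow> K \<subseteq> U \<longrightarrow> U = K" unfolding \<A>_def by blast
  let ?Q = "quot_module M K" and ?p = "\<lambda>y. K +>\<^bsub>M\<^esub> y"
  have M: "module R M" by (rule module_axioms)
  interpret Q: module R ?Q using M K(1) by (rule module_quot_module)
  interpret p: sublinear R M ?Q "carrier M" ?p by (rule quot_projection(1)[OF M K(1)])
  note surj = quot_projection(2)[OF M K(1)] and ker = quot_projection(3)[OF M K(1)]
  have px: "?p x \<in> carrier ?Q" "?p x \<noteq> \<zero>\<^bsub>?Q\<^esub>" using p.f_closed x(1) ker K(2) by auto
  have ess: "?p x \<in> U" if U: "submodule U R ?Q" "U \<noteq> {\<zero>\<^bsub>?Q\<^esub>}" for U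
  proof (rule ccontr)
    assume "?p x \<notin> U"
    let ?W = "{y \<in> carrier M. ?p y \<in> U}"
    note Uc = U(1)[unfolded Q.submodule_iff]
    have "K \<subseteq> ?W"
    proof
      fix k assume "k \<in> K"
      then have "k \<in> carrier M" "?p k = \<zero>\<^bsub>?Q\<^esub>" using ker by auto
      then show "k \<in> ?W" using Uc by simp
    qed
    then have W: "?W = K" using K_max p.submodule_vimage[OF U(1)] \<open>?p x \<notin> U\<close> by blast
    have "q = \<zero>\<^bsub>?Q\<^esub>" if q: "q \<in> U" for q
    proof -
      have "q \<in> ?p ` carrier M" using q Uc surj by blast
      then obtain y where y: "y \<in> carrier M" "q = ?p y" by blast
      then have "y \<in> K" using W q by blast
      then show ?thesis using ker y by blast
    qed
    then show False using U(2) Uc by blast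
  qed
  have "min_cond R ?Q (carrier ?Q)"
    using noeth px ess by (rule Q.cocyclic_min_cond)
  moreover have "carrier ?Q \<noteq> {\<zero>\<^bsub>?Q\<^esub>}" using px by blast
  ultimately obtain V where "hollow_over R ?Q V" using Q.min_cond_hollow by blast
  then show ?thesis using p.hollow_over_vimage(1)[OF refl surj] by blast
qed

end

section \<open>The modules \<open>(0 :\<^sub>M p)\<close>\<close>

context module
begin

lemma annihilating_in_coass_prime:
  assumes K: "hollow_over R M K" and a: "a \<in> carrier R" and ann: "\<And>x. x \<in> carrier M \<Longrightarrow> a \<odot>\<^bsub>M\<^esub> x = \<zero>\<^bsub>M\<^esub>"
  shows "a \<in> coass_prime R M K"
proof -
  note K' = hollow_overD[OF K]
  have "(\<lambda>x. a \<odot>\<^bsub>M\<^esub> x) ` carrier M \<subseteq> K"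
    using ann K'(1) by (auto simp: submodule_iff)
  then have "((\<lambda>x. a \<odot>\<^bsub>M\<^esub> x) ` carrier M) <+>\<^bsub>M\<^esub> K = K"
    by (rule set_add_self[OF submodule_scalar_image[OF a submodule_carrier] K'(1)])
  then show ?thesis using a K'(2) by (simp add: coass_prime_def)
qed

lemma surjective_not_in_coass_prime:
  assumes K: "submodule K R M" and a: "a \<in> carrier R" and surj: "(\<lambda>x. a \<odot>\<^bsub>M\<^esub> x) ` carrier M = carrier M"
  shows "a \<notin> coass_prime R M K"
  using set_add_upper1[OF submodule_carrier K] set_add_eq_carrierI[OF submodule_carrier K]
  by (simp add: coass_prime_def surj)

lemma Coass_eq_empty_iff:
  assumes "noetherian_ring R"
  shows "Coass R M = {} \<longleftrightarrow> carrier M = {\<zero>\<^bsub>M\<^esub>}"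
proof
  assume "Coass R M = {}"
  then show "carrier M = {\<zero>\<^bsub>M\<^esub>}"
    using exists_hollow_over[OF assms] by (auto simp: Coass_eq[OF module_axioms])
next
  assume zero: "carrier M = {\<zero>\<^bsub>M\<^esub>}"
  have "K = carrier M" if "submodule K R M" for K
    using that unfolding submodule_iff zero by auto
  then have "\<not> hollow_over R M K" for K by (auto simp: hollow_over_def)
  then show "Coass R M = {}" by (auto simp: Coass_eq[OF module_axioms])
qed

end

text \<open>
  Maps into an injective module extend. The partial map is given by its graph \<open>G\<close>, because the maps
  to be extended come as formulas in a non-unique representation of their argument; well-definedness
  then is the last assumption alone.
\<close>

lemma injective_extend_graph:
  fixes R :: "('r, 'a) ring_scheme" and L :: "('r, 'l, 'b) module_scheme"
    and M :: "('r, 'm, 'c) module_scheme"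
  assumes inj: "injective_module TYPE('r) R M" and L: "module R L"
    and G: "G \<subseteq> carrier L \<times> carrier M" "G \<noteq> {}"
    and G_add: "\<And>x m x' m'. (x, m) \<in> G \<Longrightarrow> (x', m') \<in> G \<Longrightarrow> (x \<oplus>\<^bsub>L\<^esub> x', m \<oplus>\<^bsub>M\<^esub> m') \<in> G"
    and G_smult: "\<And>r x m. r \<in> carrier R \<Longrightarrow> (x, m) \<in> G \<Longrightarrow> (r \<odot>\<^bsub>L\<^esub> x, r \<odot>\<^bsub>M\<^esub> m) \<in> G"
    and G_fun: "\<And>m. (\<zero>\<^bsub>L\<^esub>, m) \<in> G \<Longrightarrow> m = \<zero>\<^bsub>M\<^esub>"
  shows "\<exists>h\<in>mod_homs R L M. \<forall>x m. (x, m) \<in> G \<longrightarrow> h x = m"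
proof -
  interpret M: module R M using inj by (simp add: injective_module_def)
  interpret L: module R L by fact
  define X where "X = fst ` G"
  have single: "m = m'" if xm: "(x, m) \<in> G" "(x, m') \<in> G" for x m m'
  proof -
    have c: "x \<in> carrier L" "m \<in> carrier M" "m' \<in> carrier M" using xm G(1) by auto
    have "((\<ominus>\<^bsub>R\<^esub> \<one>\<^bsub>R\<^esub>) \<odot>\<^bsub>L\<^esub> x, (\<ominus>\<^bsub>R\<^esub> \<one>\<^bsub>R\<^esub>) \<odot>\<^bsub>M\<^esub> m') \<in> G" by (rule G_smult[OF _ xm(2)]) simp
    then have "(x \<oplus>\<^bsub>L\<^esub> \<ominus>\<^bsub>L\<^esub> x, m \<oplus>\<^bsub>M\<^esub> \<ominus>\<^bsub>M\<^esub> m') \<in> G"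
      using G_add[OF xm(1)] c by (simp add: L.smult_l_minus M.smult_l_minus)
    then have "m \<oplus>\<^bsub>M\<^esub> \<ominus>\<^bsub>M\<^esub> m' = \<zero>\<^bsub>M\<^esub>" using G_fun c by (simp add: L.M.r_neg)
    then show ?thesis using c M.eq_minus_add[of m m'] by (simp add: M.M.minus_eq)
  qed
  define \<phi> where "\<phi> x = (THE m. (x, m) \<in> G)" for x
  have \<phi>: "\<phi> x = m" if "(x, m) \<in> G" for x m unfolding \<phi>_def using that single by blast
  have XG: "(x, \<phi> x) \<in> G" if "x \<in> X" for x using that \<phi> by (auto simp: X_def)
  have XI: "x \<in> X" if "(x, m) \<in> G" for x m using that by (force simp: X_def)
  have zero: "(\<zero>\<^bsub>L\<^esub>, \<zero>\<^bsub>M\<^esub>) \<in> G"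
  proof -
    obtain x m where xm: "(x, m) \<in> G" using G(2) by auto
    then show ?thesis using G_smult[OF M.R.zero_closed xm] G(1) by auto
  qed
  have X: "submodule X R L"
    unfolding L.submodule_iff
  proof (intro conjI ballI)
    show "X \<subseteq> carrier L" using G(1) by (auto simp: X_def)
    show "\<zero>\<^bsub>L\<^esub> \<in> X" using zero by (rule XI)
    show "x \<oplus>\<^bsub>L\<^esub> y \<in> X" if "x \<in> X" "y \<in> X" for x y using G_add[OF XG XG] that XI by blast
    show "a \<odot>\<^bsub>L\<^esub> x \<in> X" if "a \<in> carrier R" "x \<in> X" for a x using G_smult[OF _ XG] that XI by blast
  qed
  define B where "B = restrict_scalars (\<lambda>r. r) L"
  define A where "A = B\<lparr>carrier := X\<rparr>"
  have B: "module R B"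
    unfolding B_def using L M.R.cring_axioms by (intro module_restrict_scalars[of R R]) (auto simp: ring_hom_def)
  have "submodule X R B"
    unfolding module.submodule_iff[OF B] using X unfolding L.submodule_iff by (simp add: B_def restrict_scalars_def)
  then have A: "module R A" unfolding A_def using B by (rule submodule.submodule_is_module)
  have XL: "x \<in> carrier L" if "x \<in> X" for x using X that by (auto simp: L.submodule_iff)
  have i: "(\<lambda>x\<in>X. x) \<in> mod_homs R A B"
    using X XL unfolding L.submodule_iff by (auto simp: mod_homs_def A_def B_def restrict_scalars_def)
  have "\<phi> x \<in> carrier M" if "x \<in> X" for x using XG[OF that] G(1) by auto
  moreover have "\<phi> (x \<oplus>\<^bsub>L\<^esub> y) = \<phi> x \<oplus>\<^bsub>M\<^esub> \<phi> y" if "x \<in> X" "y \<in> X" for x y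
    using that by (intro \<phi> G_add XG)
  moreover have "\<phi> (r \<odot>\<^bsub>L\<^esub> x) = r \<odot>\<^bsub>M\<^esub> \<phi> x" if "r \<in> carrier R" "x \<in> X" for r x
    using that by (intro \<phi> G_smult XG)
  ultimately have f: "restrict \<phi> X \<in> mod_homs R A M"
    using X unfolding L.submodule_iff by (auto simp: mod_homs_def A_def B_def restrict_scalars_def)
  have "inj_on (\<lambda>x\<in>X. x) (carrier A)" by (auto simp: A_def inj_on_def)
  then obtain h where h: "h \<in> mod_homs R B M" "\<forall>x\<in>carrier A. h ((\<lambda>x\<in>X. x) x) = restrict \<phi> X x"
    using injective_module_any_type[OF inj, where 'u = 'l] i f A B unfolding injective_module_def by blast
  have "h \<in> mod_homs R L M" using h(1) by (simp add: mod_homs_def B_def restrict_scalars_def)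
  moreover have "h x = m" if "(x, m) \<in> G" for x m
    using h(2) XI[OF that] \<phi>[OF that] by (simp add: A_def)
  ultimately show ?thesis by blast
qed

lemma module_regular:
  assumes "cring R"
  shows "module R \<lparr>carrier = carrier R, monoid.mult = monoid.mult R, one = one R,
      ring.zero = ring.zero R, add = add R, smult = monoid.mult R\<rparr>" (is "module R ?B")
proof -
  interpret cring R by fact
  have "abelian_group ?B"
    by (rule abelian_groupI) (auto simp: a_ac intro: l_neg a_inv_closed)
  then show ?thesis
    by (intro moduleI cring_axioms) (auto simp: l_distr r_distr m_assoc)
qed

locale injective_restriction =
  fixes R :: "('r, 'a) ring_scheme" and S :: "('s, 'b) ring_scheme" and g :: "'r \<Rightarrow> 's"
    and M :: "('s, 'm, 'd) module_scheme"
  assumes R: "cring R" and R_noetherian: "noetherian_ring R"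
    and S_noetherian: "noetherian_ring S"
    and g: "g \<in> ring_hom R S" and M: "module S M"
    and injective: "injective_module TYPE('r) R (restrict_scalars g M)"
begin

sublocale R: cring R by (rule R)
sublocale M: module S M by (rule M)

abbreviation MR where "MR \<equiv> restrict_scalars g M"

sublocale MR: module R MR by (rule module_restrict_scalars[OF R M g])

lemma MR_simps:
  "carrier MR = carrier M" "\<zero>\<^bsub>MR\<^esub> = \<zero>\<^bsub>M\<^esub>" "x \<oplus>\<^bsub>MR\<^esub> y = x \<oplus>\<^bsub>M\<^esub> y" "r \<odot>\<^bsub>MR\<^esub> x = g r \<odot>\<^bsub>M\<^esub> x"
  by (simp_all add: restrict_scalars_def)

lemma g_closed: "r \<in> carrier R \<Longrightarrow> g r \<in> carrier S"
  using g by (rule ring_hom_closed)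

text \<open>
  The map \<open>r t + q \<mapsto> t z\<close>, for \<open>t \<in> R\<close> and \<open>q \<in> p\<close>, is well defined since \<open>r t \<in> p\<close> implies \<open>t \<in> p\<close>, and then \<open>t z = 0\<close>. An
  extension to \<open>R\<close> sends \<open>1\<close> to an element \<open>m\<close> with \<open>r m = z\<close> and \<open>p m = 0\<close>.
\<close>

lemma zero_colon_divisible:
  assumes p: "primeideal p R" and r: "r \<in> carrier R" "r \<notin> p" and z: "z \<in> zero_colon MR p"
  shows "\<exists>m\<in>zero_colon MR p. g r \<odot>\<^bsub>M\<^esub> m = z"
proof -
  interpret p: primeideal p R by fact
  define B where "B = \<lparr>carrier = carrier R, monoid.mult = monoid.mult R, one = one R,
      ring.zero = ring.zero R, add = add R, smult = monoid.mult R\<rparr>"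
  have B: "module R B" unfolding B_def by (rule module_regular[OF R])
  have B_simps: "carrier B = carrier R" "\<zero>\<^bsub>B\<^esub> = \<zero>\<^bsub>R\<^esub>" "x \<oplus>\<^bsub>B\<^esub> y = x \<oplus>\<^bsub>R\<^esub> y" "x \<odot>\<^bsub>B\<^esub> y = x \<otimes>\<^bsub>R\<^esub> y"
    for x y by (simp_all add: B_def)
  have zc: "z \<in> carrier MR" "\<And>a. a \<in> p \<Longrightarrow> a \<odot>\<^bsub>MR\<^esub> z = \<zero>\<^bsub>MR\<^esub>" using z by (auto simp: zero_colon_def)
  have pc: "a \<in> carrier R" if "a \<in> p" for a using that p.a_subset by blast
  define G where "G = {(r \<otimes>\<^bsub>R\<^esub> t \<oplus>\<^bsub>R\<^esub> q, t \<odot>\<^bsub>MR\<^esub> z) | t q. t \<in> carrier R \<and> q \<in> p}"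
  have GI: "(x, m) \<in> G" if "x = r \<otimes>\<^bsub>R\<^esub> t \<oplus>\<^bsub>R\<^esub> q" "m = t \<odot>\<^bsub>MR\<^esub> z" "t \<in> carrier R" "q \<in> p" for x m t q
    using that by (auto simp: G_def)
  have "\<exists>h\<in>mod_homs R B MR. \<forall>x m. (x, m) \<in> G \<longrightarrow> h x = m"
  proof (rule injective_extend_graph[OF injective B])
    show "G \<subseteq> carrier B \<times> carrier MR" using r zc(1) pc by (auto simp: G_def B_simps)
    show "G \<noteq> {}" using GI[OF refl refl R.zero_closed p.zero_closed] by blast
    show "(x \<oplus>\<^bsub>B\<^esub> x', m \<oplus>\<^bsub>MR\<^esub> m') \<in> G" if xm: "(x, m) \<in> G" "(x', m') \<in> G" for x m x' m'
    proof -
      obtain t q t' q' where *: "x = r \<otimes>\<^bsub>R\<^esub> t \<oplus>\<^bsub>R\<^esub> q" "m = t \<odot>\<^bsub>MR\<^esub> z" "t \<in> carrier R" "q \<in> p"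
        "x' = r \<otimes>\<^bsub>R\<^esub> t' \<oplus>\<^bsub>R\<^esub> q'" "m' = t' \<odot>\<^bsub>MR\<^esub> z" "t' \<in> carrier R" "q' \<in> p"
        using xm unfolding G_def by blast
      show ?thesis
        by (rule GI[of _ "t \<oplus>\<^bsub>R\<^esub> t'" "q \<oplus>\<^bsub>R\<^esub> q'"])
          (use * r zc(1) pc in \<open>auto simp: B_simps R.r_distr R.a_ac MR.M.a_ac MR.smult_l_distr\<close>)
    qed
    show "(s \<odot>\<^bsub>B\<^esub> x, s \<odot>\<^bsub>MR\<^esub> m) \<in> G" if s: "s \<in> carrier R" and xm: "(x, m) \<in> G" for s x m
    proof -
      obtain t q where *: "x = r \<otimes>\<^bsub>R\<^esub> t \<oplus>\<^bsub>R\<^esub> q" "m = t \<odot>\<^bsub>MR\<^esub> z" "t \<in> carrier R" "q \<in> p"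
        using xm unfolding G_def by blast
      show ?thesis
        by (rule GI[of _ "s \<otimes>\<^bsub>R\<^esub> t" "s \<otimes>\<^bsub>R\<^esub> q"])
          (use * s r zc(1) pc p.I_l_closed in
            \<open>auto simp: B_simps R.r_distr R.m_lcomm MR.smult_assoc1\<close>)
    qed
    show "m = \<zero>\<^bsub>MR\<^esub>" if zm: "(\<zero>\<^bsub>B\<^esub>, m) \<in> G" for m
    proof -
      obtain t q where *: "\<zero>\<^bsub>R\<^esub> = r \<otimes>\<^bsub>R\<^esub> t \<oplus>\<^bsub>R\<^esub> q" "m = t \<odot>\<^bsub>MR\<^esub> z" "t \<in> carrier R" "q \<in> p"
        using zm unfolding G_def B_simps by blast
      have "r \<otimes>\<^bsub>R\<^esub> t = \<ominus>\<^bsub>R\<^esub> q" using *(1,3,4) r pc by (intro R.minus_equality[symmetric]) auto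
      then have "r \<otimes>\<^bsub>R\<^esub> t \<in> p" using *(4) by simp
      then have "t \<in> p" using p.I_prime r *(3) by blast
      then show ?thesis using zc(2) *(2) by simp
    qed
  qed
  then obtain h where h: "h \<in> mod_homs R B MR" and hG: "\<And>x m. (x, m) \<in> G \<Longrightarrow> h x = m" by blast
  let ?m = "h \<one>\<^bsub>R\<^esub>"
  have mc: "?m \<in> carrier MR" using h by (auto simp: mod_homs_def B_simps)
  have h_eq: "h a = a \<odot>\<^bsub>MR\<^esub> ?m" if "a \<in> carrier R" for a
  proof -
    have "h (a \<otimes>\<^bsub>R\<^esub> \<one>\<^bsub>R\<^esub>) = a \<odot>\<^bsub>MR\<^esub> ?m"
      using h that R.one_closed unfolding mod_homs_def B_simps by blast
    then show ?thesis using that by simp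
  qed
  have "a \<odot>\<^bsub>MR\<^esub> ?m = \<zero>\<^bsub>MR\<^esub>" if a: "a \<in> p" for a
    unfolding h_eq[OF pc[OF a], symmetric]
    by (rule hG, rule GI[of _ "\<zero>\<^bsub>R\<^esub>" a]) (use a pc r zc(1) in auto)
  moreover have "r \<odot>\<^bsub>MR\<^esub> ?m = z"
    unfolding h_eq[OF r(1), symmetric]
    by (rule hG, rule GI[of _ "\<one>\<^bsub>R\<^esub>" "\<zero>\<^bsub>R\<^esub>"]) (use r zc(1) in auto)
  ultimately show ?thesis using mc by (auto simp: zero_colon_def MR_simps)
qed

abbreviation Z where "Z p \<equiv> M\<lparr>carrier := zero_colon MR p\<rparr>"

lemma module_Z: "p \<subseteq> carrier R \<Longrightarrow> module S (Z p)"
  by (rule submodule.submodule_is_module[OF submodule_zero_colon[OF M R g] M])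

text \<open>
  The dichotomy that determines all primes in the first part: a scalar of \<open>R\<close> kills \<open>(0 :\<^sub>M p)\<close> or acts
  surjectively on it, and both properties pass to all its quotients, over \<open>R\<close> as well as over \<open>S\<close>.
\<close>

lemma zero_colon_scalars:
  assumes p: "primeideal p R" and r: "r \<in> carrier R"
  shows "r \<in> p \<Longrightarrow> z \<in> zero_colon MR p \<Longrightarrow> g r \<odot>\<^bsub>M\<^esub> z = \<zero>\<^bsub>M\<^esub>"
    and "r \<notin> p \<Longrightarrow> (\<lambda>z. g r \<odot>\<^bsub>M\<^esub> z) ` zero_colon MR p = zero_colon MR p"
proof -
  have pR: "p \<subseteq> carrier R" using p by (simp add: primeideal_def ideal_def additive_subgroup.a_subset)
  interpret Z: module S "Z p" by (rule module_Z[OF pR])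
  show "r \<in> p \<Longrightarrow> z \<in> zero_colon MR p \<Longrightarrow> g r \<odot>\<^bsub>M\<^esub> z = \<zero>\<^bsub>M\<^esub>"
    by (auto simp: zero_colon_def MR_simps)
  show "(\<lambda>z. g r \<odot>\<^bsub>M\<^esub> z) ` zero_colon MR p = zero_colon MR p" if "r \<notin> p"
  proof
    show "(\<lambda>z. g r \<odot>\<^bsub>M\<^esub> z) ` zero_colon MR p \<subseteq> zero_colon MR p"
      using Z.smult_closed[OF g_closed[OF r]] by auto
    show "zero_colon MR p \<subseteq> (\<lambda>z. g r \<odot>\<^bsub>M\<^esub> z) ` zero_colon MR p"
      using zero_colon_divisible[OF p r that] by blast
  qed
qed

lemma Coass_S_zero_colon:
  assumes p: "primeideal p R" and Q: "Q \<in> Coass S (Z p)"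
  shows "spec_map R g Q = p"
proof -
  have pR: "p \<subseteq> carrier R" using p by (simp add: primeideal_def ideal_def additive_subgroup.a_subset)
  interpret Z: module S "Z p" by (rule module_Z[OF pR])
  obtain K where K: "hollow_over S (Z p) K" and QK: "Q = coass_prime S (Z p) K"
    using Q by (auto simp: Coass_eq[OF Z.module_axioms])
  have "g r \<in> Q \<longleftrightarrow> r \<in> p" if r: "r \<in> carrier R" for r
  proof
    show "r \<in> p" if "g r \<in> Q"
    proof (rule ccontr)
      assume "r \<notin> p"
      then show False
        using Z.surjective_not_in_coass_prime[OF hollow_overD(1)[OF K] g_closed[OF r]]
          zero_colon_scalars(2)[OF p r] that QK by simp
    qed
    show "g r \<in> Q" if "r \<in> p"
      unfolding QK using zero_colon_scalars(1)[OF p r that]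
      by (intro Z.annihilating_in_coass_prime[OF K g_closed[OF r]]) simp
  qed
  then show ?thesis using pR by (auto simp: spec_map_def)
qed

lemma Coass_R_zero_colon:
  assumes p: "primeideal p R"
  shows "Coass R (restrict_scalars g (Z p)) \<subseteq> {p}"
proof
  fix P assume P: "P \<in> Coass R (restrict_scalars g (Z p))"
  have pR: "p \<subseteq> carrier R" using p by (simp add: primeideal_def ideal_def additive_subgroup.a_subset)
  let ?Z = "restrict_scalars g (Z p)"
  interpret Z: module R ?Z by (rule module_restrict_scalars[OF R module_Z[OF pR] g])
  obtain K where K: "hollow_over R ?Z K" and PK: "P = coass_prime R ?Z K"
    using P by (auto simp: Coass_eq[OF Z.module_axioms])
  have "r \<in> P \<longleftrightarrow> r \<in> p" if r: "r \<in> carrier R" for r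
  proof
    show "r \<in> p" if "r \<in> P"
    proof (rule ccontr)
      assume "r \<notin> p"
      then show False
        using Z.surjective_not_in_coass_prime[OF hollow_overD(1)[OF K] r]
          zero_colon_scalars(2)[OF p r] that PK by (simp add: restrict_scalars_def)
    qed
    show "r \<in> P" if "r \<in> p"
      unfolding PK using zero_colon_scalars(1)[OF p r that]
      by (intro Z.annihilating_in_coass_prime[OF K r]) (simp add: restrict_scalars_def)
  qed
  moreover have "P \<subseteq> carrier R" by (auto simp: PK coass_prime_def)
  ultimately show "P \<in> {p}" using pR by blast
qed

text \<open>
  Both sides can only contain \<open>p\<close>, so that it remains to see that they are empty at the same time. By
  \<open>Coass_eq_empty_iff\<close>, over either ring this means that \<open>(0 :\<^sub>M p)\<close> vanishes.
\<close>

theorem spec_map_Coass_zero_colon: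
  assumes p: "primeideal p R"
  shows "spec_map R g ` Coass S (Z p) = Coass R (restrict_scalars g (Z p))"
proof -
  have pR: "p \<subseteq> carrier R" using p by (simp add: primeideal_def ideal_def additive_subgroup.a_subset)
  interpret Z: module S "Z p" by (rule module_Z[OF pR])
  interpret ZR: module R "restrict_scalars g (Z p)" by (rule module_restrict_scalars[OF R module_Z[OF pR] g])
  have "Coass S (Z p) = {} \<longleftrightarrow> Coass R (restrict_scalars g (Z p)) = {}"
    unfolding Z.Coass_eq_empty_iff[OF S_noetherian] ZR.Coass_eq_empty_iff[OF R_noetherian]
    by (simp add: restrict_scalars_def)
  then show ?thesis
    using Coass_S_zero_colon[OF p] Coass_R_zero_colon[OF p] by (cases "Coass S (Z p) = {}") auto
qed

end

section \<open>Finitely generated modules over Noetherian rings\<close>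

text \<open>
  The ascending chain condition for the submodules contained in \<open>X\<close>, in the form of the maximum
  condition.
\<close>

definition max_cond :: "('r, 'a) ring_scheme \<Rightarrow> ('r, 'm, 'b) module_scheme \<Rightarrow> 'm set \<Rightarrow> bool"
  where "max_cond R M X \<longleftrightarrow> (\<forall>\<U>. \<U> \<noteq> {} \<longrightarrow> (\<forall>U\<in>\<U>. submodule U R M \<and> U \<subseteq> X) \<longrightarrow>
    (\<exists>U\<in>\<U>. \<forall>V\<in>\<U>. U \<subseteq> V \<longrightarrow> V = U))"

lemma max_condD:
  assumes "max_cond R M X" "\<U> \<noteq> {}" "\<And>U. U \<in> \<U> \<Longrightarrow> submodule U R M \<and> U \<subseteq> X"
  shows "\<exists>U\<in>\<U>. \<forall>V\<in>\<U>. U \<subseteq> V \<longrightarrow> V = U"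
  using assms(1)[unfolded max_cond_def, THEN spec, THEN mp, THEN mp, OF assms(2) ballI[OF assms(3)]] .

context module
begin

text \<open>
  A submodule \<open>U\<close> of \<open>X + R x\<close> is measured by the ideal \<open>(U + X : x)\<close> and by \<open>U \<inter> X\<close>. Nested submodules that
  agree in both are equal, so it suffices to maximize the ideal first and the intersection next.
\<close>

lemma max_cond_add_cyclic:
  assumes noeth: "noetherian_ring R" and X: "submodule X R M" and x: "x \<in> carrier M"
    and max: "max_cond R M X"
  shows "max_cond R M (X <+>\<^bsub>M\<^esub> (\<lambda>a. a \<odot>\<^bsub>M\<^esub> x) ` carrier R)"
  unfolding max_cond_def
proof (intro allI impI)
  interpret N: noetherian_ring R by fact
  fix \<U> assume ne: "\<U> \<noteq> {}"
    and sub: "\<forall>U\<in>\<U>. submodule U R M \<and> U \<subseteq> X <+>\<^bsub>M\<^esub> (\<lambda>a. a \<odot>\<^bsub>M\<^esub> x) ` carrier R"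
  note Xc = X[unfolded submodule_iff]
  define c where "c U = {r \<in> carrier R. r \<odot>\<^bsub>M\<^esub> x \<in> U <+>\<^bsub>M\<^esub> X}" for U
  have "ideal (c U) R" if "U \<in> \<U>" for U
    unfolding c_def using that sub X x by (intro ideal_colon submodule_set_add) auto
  then have "\<exists>I\<in>c ` \<U>. \<forall>J\<in>c ` \<U>. I \<subseteq> J \<longrightarrow> J = I"
    using ne by (intro N.exists_maximal_ideal_in) auto
  then obtain I where I: "I \<in> c ` \<U>" "\<forall>J\<in>c ` \<U>. I \<subseteq> J \<longrightarrow> J = I" by blast
  let ?\<V> = "{U \<in> \<U>. c U = I}"
  have "\<exists>W\<in>(\<lambda>U. U \<inter> X) ` ?\<V>. \<forall>W'\<in>(\<lambda>U. U \<inter> X) ` ?\<V>. W \<subseteq> W' \<longrightarrow> W' = W"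
  proof (rule max_condD[OF max])
    show "(\<lambda>U. U \<inter> X) ` ?\<V> \<noteq> {}" using I(1) by auto
    show "submodule W R M \<and> W \<subseteq> X" if "W \<in> (\<lambda>U. U \<inter> X) ` ?\<V>" for W
      using that sub X by (auto intro: submodule_Int)
  qed
  then obtain U0 where U0: "U0 \<in> \<U>" "c U0 = I"
    and W_max: "\<forall>U\<in>?\<V>. U0 \<inter> X \<subseteq> U \<inter> X \<longrightarrow> U \<inter> X = U0 \<inter> X" by auto
  show "\<exists>U\<in>\<U>. \<forall>V\<in>\<U>. U \<subseteq> V \<longrightarrow> V = U"
  proof (intro bexI[OF _ U0(1)] ballI impI)
    fix V assume V: "V \<in> \<U>" "U0 \<subseteq> V"
    have VS: "submodule V R M" and US: "submodule U0 R M" using V U0 sub by auto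
    note Vc = VS[unfolded submodule_iff] and Uc = US[unfolded submodule_iff]
    have "c U0 \<subseteq> c V" unfolding c_def using set_add_mono[OF V(2) order_refl, of X] by blast
    then have cV: "c V = I" using I(2) V(1) U0(2) by simp
    then have "V \<in> ?\<V>" using V(1) by simp
    moreover have "U0 \<inter> X \<subseteq> V \<inter> X" using V(2) by blast
    ultimately have VX: "V \<inter> X = U0 \<inter> X" using W_max by blast
    have "v \<in> U0" if v: "v \<in> V" for v
    proof -
      have "v \<in> X <+>\<^bsub>M\<^esub> (\<lambda>a. a \<odot>\<^bsub>M\<^esub> x) ` carrier R" using v V(1) sub by blast
      then obtain y r where yr: "y \<in> X" "r \<in> carrier R" "v = y \<oplus>\<^bsub>M\<^esub> r \<odot>\<^bsub>M\<^esub> x"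
        by (auto simp: mem_set_add_iff)
      have cs: "v \<in> carrier M" "y \<in> carrier M" "r \<odot>\<^bsub>M\<^esub> x \<in> carrier M" using v Vc yr Xc x by auto
      have "r \<odot>\<^bsub>M\<^esub> x = v \<oplus>\<^bsub>M\<^esub> \<ominus>\<^bsub>M\<^esub> y" using yr(3) cs by (simp add: M.a_ac M.r_neg1 M.r_neg2 M.r_neg)
      moreover have "\<ominus>\<^bsub>M\<^esub> y \<in> X" using submoduleE(3)[OF X yr(1)] .
      ultimately have "r \<in> c V" unfolding c_def mem_set_add_iff using yr(2) v by blast
      then have "r \<odot>\<^bsub>M\<^esub> x \<in> U0 <+>\<^bsub>M\<^esub> X" using cV U0(2) by (auto simp: c_def)
      then obtain u y' where u: "u \<in> U0" "y' \<in> X" "r \<odot>\<^bsub>M\<^esub> x = u \<oplus>\<^bsub>M\<^esub> y'"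
        unfolding mem_set_add_iff by blast
      have cu: "u \<in> carrier M" "y' \<in> carrier M" using u Uc Xc by auto
      have "v \<ominus>\<^bsub>M\<^esub> u = y \<oplus>\<^bsub>M\<^esub> y'"
      proof -
        have "v = u \<oplus>\<^bsub>M\<^esub> (y \<oplus>\<^bsub>M\<^esub> y')" using yr(3) u(3) cs(2) cu by (simp add: M.a_ac)
        then show ?thesis using add_minus_cancel_left[of u "y \<oplus>\<^bsub>M\<^esub> y'"] cs(2) cu by simp
      qed
      then have "v \<ominus>\<^bsub>M\<^esub> u \<in> X" using yr(1) u(2) Xc by simp
      moreover have "v \<ominus>\<^bsub>M\<^esub> u \<in> V" using submodule_minus_closed[OF VS v] u(1) V(2) by blast
      ultimately have "v \<ominus>\<^bsub>M\<^esub> u \<in> U0" using VX by blast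
      then have "u \<oplus>\<^bsub>M\<^esub> (v \<ominus>\<^bsub>M\<^esub> u) \<in> U0" using u(1) Uc by blast
      then show ?thesis using eq_minus_add[OF cs(1) cu(1)] by simp
    qed
    then show "V = U0" using V(2) by blast
  qed
qed

lemma fin_gen_max_cond:
  assumes noeth: "noetherian_ring R" and fg: "fin_gen_module R M"
  shows "max_cond R M (carrier M)"
proof -
  obtain F where F: "finite F" "F \<subseteq> carrier M" "(\<lambda>N. submodule N R M) hull F = carrier M"
    using fg unfolding fin_gen_module_def by blast
  have "\<exists>X. submodule X R M \<and> F' \<subseteq> X \<and> max_cond R M X" if "finite F'" "F' \<subseteq> carrier M" for F'
    using that
  proof (induction F')
    case empty
    have "max_cond R M {\<zero>\<^bsub>M\<^esub>}"
      unfolding max_cond_def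
    proof (intro allI impI)
      fix \<U> assume ne: "\<U> \<noteq> {}" and sub: "\<forall>U\<in>\<U>. submodule U R M \<and> U \<subseteq> {\<zero>\<^bsub>M\<^esub>}"
      obtain U where U: "U \<in> \<U>" using ne by blast
      have "V \<subseteq> U" if "V \<in> \<U>" for V
      proof -
        have "V \<subseteq> {\<zero>\<^bsub>M\<^esub>}" using sub that by blast
        moreover have "\<zero>\<^bsub>M\<^esub> \<in> U" using sub U by (simp add: submodule_iff)
        ultimately show ?thesis by blast
      qed
      then show "\<exists>U\<in>\<U>. \<forall>V\<in>\<U>. U \<subseteq> V \<longrightarrow> V = U" using U by blast
    qed
    then show ?case using submodule_zero by blast
  next
    case (insert x F')
    then obtain X where X: "submodule X R M" "F' \<subseteq> X" "max_cond R M X" by auto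
    have x: "x \<in> carrier M" using insert.prems by blast
    let ?C = "(\<lambda>a. a \<odot>\<^bsub>M\<^esub> x) ` carrier R"
    have C: "submodule ?C R M" by (rule submodule_cyclic[OF x])
    have "insert x F' \<subseteq> X <+>\<^bsub>M\<^esub> ?C"
      using set_add_upper1[OF X(1) C] set_add_upper2[OF X(1) C] mem_cyclic[OF x] X(2) by blast
    then show ?case
      using max_cond_add_cyclic[OF noeth X(1) x X(3)] submodule_set_add[OF X(1) C] by blast
  qed
  then obtain X where X: "submodule X R M" "F \<subseteq> X" "max_cond R M X" using F(1,2) by blast
  have "carrier M \<subseteq> X" using hull_minimal[of F X "\<lambda>N. submodule N R M"] X(1,2) F(3) by simp
  then have "X = carrier M" using X(1) by (auto simp: submodule_iff)
  then show ?thesis using X(3) by simp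
qed

text \<open>
  An associated prime of \<open>M / X\<close>: a maximal one among the annihilators of nonzero elements is prime.
\<close>

lemma exists_prime_colon:
  assumes noeth: "noetherian_ring R" and X: "submodule X R M" "X \<noteq> carrier M"
  shows "\<exists>x\<in>carrier M - X. primeideal {r \<in> carrier R. r \<odot>\<^bsub>M\<^esub> x \<in> X} R"
proof -
  interpret N: noetherian_ring R by fact
  note Xc = X(1)[unfolded submodule_iff]
  define c where "c x = {r \<in> carrier R. r \<odot>\<^bsub>M\<^esub> x \<in> X}" for x
  have c: "ideal (c x) R" if "x \<in> carrier M" for x unfolding c_def by (rule ideal_colon[OF X(1) that])
  have "\<exists>I\<in>c ` (carrier M - X). \<forall>J\<in>c ` (carrier M - X). I \<subseteq> J \<longrightarrow> J = I"
    using X(2) Xc c by (intro N.exists_maximal_ideal_in) auto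
  then obtain x where x: "x \<in> carrier M" "x \<notin> X"
    and x_max: "\<forall>y\<in>carrier M - X. c x \<subseteq> c y \<longrightarrow> c y = c x" by auto
  have "primeideal (c x) R"
  proof (rule primeidealI[OF c[OF x(1)] R.cring_axioms])
    have "\<one> \<notin> c x" using x by (simp add: c_def)
    then show "carrier R \<noteq> c x" by blast
    fix a b assume ab: "a \<in> carrier R" "b \<in> carrier R" "a \<otimes> b \<in> c x"
    show "a \<in> c x \<or> b \<in> c x"
    proof (rule disjCI)
      assume "b \<notin> c x"
      then have bx: "b \<odot>\<^bsub>M\<^esub> x \<in> carrier M - X" using ab x by (auto simp: c_def)
      have "c x \<subseteq> c (b \<odot>\<^bsub>M\<^esub> x)"
      proof
        fix r assume r: "r \<in> c x"
        then have "r \<odot>\<^bsub>M\<^esub> (b \<odot>\<^bsub>M\<^esub> x) = b \<odot>\<^bsub>M\<^esub> (r \<odot>\<^bsub>M\<^esub> x)"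
          using ab(2) x(1) by (simp add: c_def R.m_comm flip: smult_assoc1)
        then show "r \<in> c (b \<odot>\<^bsub>M\<^esub> x)" using r ab(2) Xc by (simp add: c_def)
      qed
      then have "c (b \<odot>\<^bsub>M\<^esub> x) = c x" using x_max bx by blast
      moreover have "a \<in> c (b \<odot>\<^bsub>M\<^esub> x)" using ab x(1) by (simp add: c_def smult_assoc1)
      ultimately show "a \<in> c x" by simp
    qed
  qed
  then show ?thesis using x unfolding c_def by blast
qed

end

section \<open>Homomorphisms into a module that is injective over the base\<close>

locale hom_to_injective = injective_restriction R S g M
  for R :: "('r, 'a) ring_scheme" and S :: "('s, 'b) ring_scheme" and g :: "'r \<Rightarrow> 's"
    and M :: "('s, 'm, 'd) module_scheme" +
  fixes L :: "('r, 'l, 'c) module_scheme"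
  assumes L: "module R L" and L_fin_gen: "fin_gen_module R L"
begin

sublocale L: module R L by (rule L)

abbreviation H where "H \<equiv> hom_module R g L M"

sublocale H: module S H by (rule module_hom_module[OF L M g])

lemma hom_in_H: "f \<in> carrier H \<longleftrightarrow> f \<in> mod_homs R L MR"
  by (simp add: hom_module_def)

lemma hom_closed: "f \<in> carrier H \<Longrightarrow> x \<in> carrier L \<Longrightarrow> f x \<in> carrier M"
  and hom_add: "f \<in> carrier H \<Longrightarrow> x \<in> carrier L \<Longrightarrow> y \<in> carrier L \<Longrightarrow> f (x \<oplus>\<^bsub>L\<^esub> y) = f x \<oplus>\<^bsub>M\<^esub> f y"
  and hom_smult: "f \<in> carrier H \<Longrightarrow> r \<in> carrier R \<Longrightarrow> x \<in> carrier L \<Longrightarrow> f (r \<odot>\<^bsub>L\<^esub> x) = g r \<odot>\<^bsub>M\<^esub> f x"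
  unfolding hom_in_H mod_homs_def by (auto simp: MR_simps)

lemma hom_zero: "f \<in> carrier H \<Longrightarrow> f \<zero>\<^bsub>L\<^esub> = \<zero>\<^bsub>M\<^esub>"
proof -
  assume f: "f \<in> carrier H"
  have "f (\<zero>\<^bsub>R\<^esub> \<odot>\<^bsub>L\<^esub> \<zero>\<^bsub>L\<^esub>) = \<zero>\<^bsub>R\<^esub> \<odot>\<^bsub>MR\<^esub> f \<zero>\<^bsub>L\<^esub>"
    using hom_smult[OF f R.zero_closed L.M.zero_closed] by (simp add: MR_simps)
  then show ?thesis using hom_closed[OF f L.M.zero_closed] MR.smult_l_null by (simp add: MR_simps)
qed

lemma hom_ext:
  assumes "f \<in> carrier H" "h \<in> carrier H" "\<And>x. x \<in> carrier L \<Longrightarrow> f x = h x"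
  shows "f = h"
  using assms unfolding hom_in_H mod_homs_def
  by (intro PiE_ext[of f "carrier L" "\<lambda>_. carrier MR" h]) auto

lemma H_apply:
  assumes "x \<in> carrier L"
  shows "\<zero>\<^bsub>H\<^esub> x = \<zero>\<^bsub>M\<^esub>" "(f \<oplus>\<^bsub>H\<^esub> h) x = f x \<oplus>\<^bsub>M\<^esub> h x" "(s \<odot>\<^bsub>H\<^esub> f) x = s \<odot>\<^bsub>M\<^esub> f x"
  using assms by (simp_all add: hom_module_def)

text \<open>
  The submodule \<open>Hom(L / X, M)\<close> of \<open>Hom(L, M)\<close>.
\<close>

definition perp where "perp X = {f \<in> carrier H. \<forall>x\<in>X. f x = \<zero>\<^bsub>M\<^esub>}"

lemma perp_submodule: "X \<subseteq> carrier L \<Longrightarrow> submodule (perp X) S H"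
  unfolding H.submodule_iff perp_def by (auto simp: H_apply subset_iff hom_closed)

lemma perp_antimono: "X \<subseteq> Y \<Longrightarrow> perp Y \<subseteq> perp X"
  by (auto simp: perp_def)

lemma perp_zero: "perp {\<zero>\<^bsub>L\<^esub>} = carrier H"
  by (auto simp: perp_def hom_zero)

lemma perp_carrier: "perp (carrier L) = {\<zero>\<^bsub>H\<^esub>}"
  using H.M.zero_closed by (auto simp: perp_def H_apply intro: hom_ext)

lemma evaluation_sublinear:
  assumes X: "submodule X S H" and x: "x \<in> carrier L"
  shows "sublinear S H M X (\<lambda>f. f x)"
proof (intro sublinear.intro sublinear_axioms.intro H.module_axioms M.module_axioms X)
  show "linear_on S H X M (\<lambda>f. f x)"
    using X x unfolding linear_on_def H.submodule_iff by (auto simp: H_apply hom_closed subset_iff)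
qed

lemma hom_extend_graph:
  assumes "G \<subseteq> carrier L \<times> carrier M" "G \<noteq> {}"
    and "\<And>x m x' m'. (x, m) \<in> G \<Longrightarrow> (x', m') \<in> G \<Longrightarrow> (x \<oplus>\<^bsub>L\<^esub> x', m \<oplus>\<^bsub>M\<^esub> m') \<in> G"
    and "\<And>r x m. r \<in> carrier R \<Longrightarrow> (x, m) \<in> G \<Longrightarrow> (r \<odot>\<^bsub>L\<^esub> x, g r \<odot>\<^bsub>M\<^esub> m) \<in> G"
    and "\<And>m. (\<zero>\<^bsub>L\<^esub>, m) \<in> G \<Longrightarrow> m = \<zero>\<^bsub>M\<^esub>"
  shows "\<exists>h\<in>carrier H. \<forall>x m. (x, m) \<in> G \<longrightarrow> h x = m"
  using injective_extend_graph[OF injective L, of G] assms by (simp add: MR_simps Bex_def hom_in_H)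

text \<open>
  If \<open>f\<close> vanishes on \<open>X \<inter> Y\<close>, then \<open>x + y \<mapsto> f x\<close> is well defined on \<open>X + Y\<close>. An extension \<open>h\<close> vanishes on \<open>Y\<close> and
  agrees with \<open>f\<close> on \<open>X\<close>, so \<open>f = (f - h) + h\<close> is the required decomposition.
\<close>

lemma perp_Int_subset:
  assumes X: "submodule X R L" and Y: "submodule Y R L"
  shows "perp (X \<inter> Y) \<subseteq> perp X <+>\<^bsub>H\<^esub> perp Y"
proof
  fix f assume f: "f \<in> perp (X \<inter> Y)"
  then have fH: "f \<in> carrier H" by (simp add: perp_def)
  note Xc = X[unfolded L.submodule_iff] and Yc = Y[unfolded L.submodule_iff]
  have XL: "x \<in> carrier L" if "x \<in> X" for x using that Xc by blast
  have YL: "y \<in> carrier L" if "y \<in> Y" for y using that Yc by blast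
  define G where "G = {(x \<oplus>\<^bsub>L\<^esub> y, f x) | x y. x \<in> X \<and> y \<in> Y}"
  have GI: "(a, m) \<in> G" if "a = x \<oplus>\<^bsub>L\<^esub> y" "m = f x" "x \<in> X" "y \<in> Y" for a m x y
    using that by (auto simp: G_def)
  have "\<exists>h\<in>carrier H. \<forall>x m. (x, m) \<in> G \<longrightarrow> h x = m"
  proof (rule hom_extend_graph)
    show "G \<subseteq> carrier L \<times> carrier M" using XL YL hom_closed[OF fH] by (auto simp: G_def)
    have "\<zero>\<^bsub>L\<^esub> \<in> X" "\<zero>\<^bsub>L\<^esub> \<in> Y" using Xc Yc by auto
    then show "G \<noteq> {}" using GI[OF refl refl] by blast
    show "(a \<oplus>\<^bsub>L\<^esub> a', m \<oplus>\<^bsub>M\<^esub> m') \<in> G" if am: "(a, m) \<in> G" "(a', m') \<in> G" for a m a' m'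
    proof -
      obtain x y x' y' where *: "a = x \<oplus>\<^bsub>L\<^esub> y" "m = f x" "x \<in> X" "y \<in> Y"
        "a' = x' \<oplus>\<^bsub>L\<^esub> y'" "m' = f x'" "x' \<in> X" "y' \<in> Y"
        using am unfolding G_def by blast
      show ?thesis
        by (rule GI[of _ "x \<oplus>\<^bsub>L\<^esub> x'" "y \<oplus>\<^bsub>L\<^esub> y'"])
          (use * Xc Yc XL YL in \<open>auto simp: L.M.a_ac M.M.a_ac hom_add[OF fH] hom_closed[OF fH]\<close>)
    qed
    show "(r \<odot>\<^bsub>L\<^esub> a, g r \<odot>\<^bsub>M\<^esub> m) \<in> G" if r: "r \<in> carrier R" and am: "(a, m) \<in> G" for r a m
    proof -
      obtain x y where *: "a = x \<oplus>\<^bsub>L\<^esub> y" "m = f x" "x \<in> X" "y \<in> Y"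
        using am unfolding G_def by blast
      show ?thesis
        by (rule GI[of _ "r \<odot>\<^bsub>L\<^esub> x" "r \<odot>\<^bsub>L\<^esub> y"])
          (use * r Xc Yc XL YL in \<open>auto simp: L.smult_r_distr hom_smult[OF fH]\<close>)
    qed
    show "m = \<zero>\<^bsub>M\<^esub>" if am: "(\<zero>\<^bsub>L\<^esub>, m) \<in> G" for m
    proof -
      obtain x y where *: "\<zero>\<^bsub>L\<^esub> = x \<oplus>\<^bsub>L\<^esub> y" "m = f x" "x \<in> X" "y \<in> Y"
        using am unfolding G_def by blast
      have "x = \<ominus>\<^bsub>L\<^esub> y" using *(1,3,4) XL YL by (intro L.M.minus_equality[symmetric]) auto
      then have "x \<in> X \<inter> Y" using * L.submoduleE(3)[OF Y] by simp
      then show ?thesis using f *(2) by (simp add: perp_def)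
    qed
  qed
  then obtain h where h: "h \<in> carrier H" and hG: "\<forall>x m. (x, m) \<in> G \<longrightarrow> h x = m" by blast
  have hX: "h x = f x" if "x \<in> X" for x
    using hG GI[of x x "\<zero>\<^bsub>L\<^esub>" "f x"] that XL Yc by simp
  have hY: "h y = \<zero>\<^bsub>M\<^esub>" if "y \<in> Y" for y
    using hG GI[of y "\<zero>\<^bsub>L\<^esub>" y "\<zero>\<^bsub>M\<^esub>"] that YL Xc hom_zero[OF fH] by simp
  have "(f \<ominus>\<^bsub>H\<^esub> h) x = \<zero>\<^bsub>M\<^esub>" if x: "x \<in> X" for x
  proof -
    interpret ev: sublinear S H M "carrier H" "\<lambda>f. f x"
      by (rule evaluation_sublinear[OF H.submodule_carrier XL[OF x]])
    show ?thesis using ev.f_minus[OF fH h] hX[OF x] hom_closed[OF h XL[OF x]]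
      by (simp add: M.M.minus_eq M.M.r_neg)
  qed
  then have "f \<ominus>\<^bsub>H\<^esub> h \<in> perp X" using fH h by (simp add: perp_def)
  moreover have "h \<in> perp Y" using h hY by (simp add: perp_def)
  moreover have "f = (f \<ominus>\<^bsub>H\<^esub> h) \<oplus>\<^bsub>H\<^esub> h"
    using fH h by (simp add: H.M.minus_eq H.M.a_assoc H.M.l_neg)
  ultimately show "f \<in> perp X <+>\<^bsub>H\<^esub> perp Y" unfolding mem_set_add_iff by blast
qed

text \<open>
  Multiplication by \<open>r\<close> on \<open>Hom(L, M)\<close> is composition with \<open>r : L \<rightarrow> L\<close>. A homomorphism that vanishes on
  the kernel of \<open>r\<close> factors through \<open>r L\<close>, and the factor extends to \<open>L\<close>.
\<close>

lemma perp_annihilated_eq: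
  assumes r: "r \<in> carrier R"
  shows "perp {x \<in> carrier L. r \<odot>\<^bsub>L\<^esub> x = \<zero>\<^bsub>L\<^esub>} = (\<lambda>f. g r \<odot>\<^bsub>H\<^esub> f) ` carrier H"
proof
  have apply_smult: "(g r \<odot>\<^bsub>H\<^esub> h) x = h (r \<odot>\<^bsub>L\<^esub> x)" if "h \<in> carrier H" "x \<in> carrier L" for h x
    using that r by (simp add: H_apply hom_smult)
  show "(\<lambda>f. g r \<odot>\<^bsub>H\<^esub> f) ` carrier H \<subseteq> perp {x \<in> carrier L. r \<odot>\<^bsub>L\<^esub> x = \<zero>\<^bsub>L\<^esub>}"
    using g_closed[OF r] by (auto simp: perp_def apply_smult hom_zero)
  show "perp {x \<in> carrier L. r \<odot>\<^bsub>L\<^esub> x = \<zero>\<^bsub>L\<^esub>} \<subseteq> (\<lambda>f. g r \<odot>\<^bsub>H\<^esub> f) ` carrier H"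
  proof
    fix f assume f: "f \<in> perp {x \<in> carrier L. r \<odot>\<^bsub>L\<^esub> x = \<zero>\<^bsub>L\<^esub>}"
    then have fH: "f \<in> carrier H" by (simp add: perp_def)
    define G where "G = (\<lambda>x. (r \<odot>\<^bsub>L\<^esub> x, f x)) ` carrier L"
    have GI: "(a, m) \<in> G" if "a = r \<odot>\<^bsub>L\<^esub> x" "m = f x" "x \<in> carrier L" for a m x
      using that by (auto simp: G_def)
    have "\<exists>h\<in>carrier H. \<forall>x m. (x, m) \<in> G \<longrightarrow> h x = m"
    proof (rule hom_extend_graph)
      show "G \<subseteq> carrier L \<times> carrier M" using r hom_closed[OF fH] by (auto simp: G_def)
      show "G \<noteq> {}" using L.M.zero_closed by (auto simp: G_def)
      show "(a \<oplus>\<^bsub>L\<^esub> a', m \<oplus>\<^bsub>M\<^esub> m') \<in> G" if am: "(a, m) \<in> G" "(a', m') \<in> G" for a m a' m'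
      proof -
        obtain x x' where "a = r \<odot>\<^bsub>L\<^esub> x" "m = f x" "x \<in> carrier L"
          "a' = r \<odot>\<^bsub>L\<^esub> x'" "m' = f x'" "x' \<in> carrier L"
          using am unfolding G_def by blast
        then show ?thesis
          using r by (intro GI[of _ "x \<oplus>\<^bsub>L\<^esub> x'"]) (auto simp: L.smult_r_distr hom_add[OF fH])
      qed
      show "(s \<odot>\<^bsub>L\<^esub> a, g s \<odot>\<^bsub>M\<^esub> m) \<in> G" if s: "s \<in> carrier R" and am: "(a, m) \<in> G" for s a m
      proof -
        obtain x where x: "a = r \<odot>\<^bsub>L\<^esub> x" "m = f x" "x \<in> carrier L" using am unfolding G_def by blast
        have "s \<odot>\<^bsub>L\<^esub> (r \<odot>\<^bsub>L\<^esub> x) = r \<odot>\<^bsub>L\<^esub> (s \<odot>\<^bsub>L\<^esub> x)"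
          using r s x(3) by (simp add: R.m_comm flip: L.smult_assoc1)
        then show ?thesis
          using s x by (intro GI[of _ "s \<odot>\<^bsub>L\<^esub> x"]) (auto simp: hom_smult[OF fH])
      qed
      show "m = \<zero>\<^bsub>M\<^esub>" if am: "(\<zero>\<^bsub>L\<^esub>, m) \<in> G" for m
        using am f by (auto simp: G_def perp_def)
    qed
    then obtain h where h: "h \<in> carrier H" and hG: "\<forall>x m. (x, m) \<in> G \<longrightarrow> h x = m" by blast
    have "f x = (g r \<odot>\<^bsub>H\<^esub> h) x" if "x \<in> carrier L" for x
      using hG GI[OF refl refl that] apply_smult[OF h that] by simp
    then have "f = g r \<odot>\<^bsub>H\<^esub> h" using fH h g_closed[OF r] by (intro hom_ext) auto
    then show "f \<in> (\<lambda>f. g r \<odot>\<^bsub>H\<^esub> f) ` carrier H" using h by blast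
  qed
qed

text \<open>
  With \<open>p = (X : x)\<close> and \<open>Y = X + R x\<close>, the quotient \<open>Y / X\<close> is \<open>R / p\<close>, and restriction to it is evaluation at \<open>x\<close>.
  So this surjectivity and \<open>perp_add_cyclic\<close>, which computes the kernel, amount to
  \<open>perp X / perp Y \<cong> Hom(R / p, M) \<cong> (0 :\<^sub>M p)\<close>.
\<close>

lemma evaluation_perp_surj:
  assumes X: "submodule X R L" and x: "x \<in> carrier L"
  shows "(\<lambda>f. f x) ` perp X = zero_colon MR {r \<in> carrier R. r \<odot>\<^bsub>L\<^esub> x \<in> X}" (is "_ = zero_colon MR ?p")
proof
  note Xc = X[unfolded L.submodule_iff]
  have XL: "u \<in> carrier L" if "u \<in> X" for u using that Xc by blast
  show "(\<lambda>f. f x) ` perp X \<subseteq> zero_colon MR ?p"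
  proof
    fix z assume "z \<in> (\<lambda>f. f x) ` perp X"
    then obtain f where f: "f \<in> carrier H" "\<forall>u\<in>X. f u = \<zero>\<^bsub>M\<^esub>" "z = f x" by (auto simp: perp_def)
    have "g r \<odot>\<^bsub>M\<^esub> f x = \<zero>\<^bsub>M\<^esub>" if "r \<in> carrier R" "r \<odot>\<^bsub>L\<^esub> x \<in> X" for r
      using hom_smult[OF f(1) that(1) x] f(2) that(2) by simp
    then show "z \<in> zero_colon MR ?p"
      using f(3) hom_closed[OF f(1) x] by (auto simp: zero_colon_def MR_simps)
  qed
  show "zero_colon MR ?p \<subseteq> (\<lambda>f. f x) ` perp X"
  proof
    fix z assume "z \<in> zero_colon MR ?p"
    then have z: "z \<in> carrier MR" "\<And>r. r \<in> carrier R \<Longrightarrow> r \<odot>\<^bsub>L\<^esub> x \<in> X \<Longrightarrow> r \<odot>\<^bsub>MR\<^esub> z = \<zero>\<^bsub>MR\<^esub>"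
      by (auto simp: zero_colon_def)
    define G where "G = {(u \<oplus>\<^bsub>L\<^esub> r \<odot>\<^bsub>L\<^esub> x, r \<odot>\<^bsub>MR\<^esub> z) | u r. u \<in> X \<and> r \<in> carrier R}"
    have GI: "(a, m) \<in> G" if "a = u \<oplus>\<^bsub>L\<^esub> r \<odot>\<^bsub>L\<^esub> x" "m = r \<odot>\<^bsub>MR\<^esub> z" "u \<in> X" "r \<in> carrier R" for a m u r
      using that by (auto simp: G_def)
    have "\<exists>h\<in>carrier H. \<forall>x m. (x, m) \<in> G \<longrightarrow> h x = m"
    proof (rule hom_extend_graph[folded MR_simps])
      show "G \<subseteq> carrier L \<times> carrier MR" using XL x z(1) by (auto simp: G_def)
      have "\<zero>\<^bsub>L\<^esub> \<in> X" using Xc by blast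
      then show "G \<noteq> {}" using GI[OF refl refl _ R.zero_closed] by blast
      show "(a \<oplus>\<^bsub>L\<^esub> a', m \<oplus>\<^bsub>MR\<^esub> m') \<in> G" if am: "(a, m) \<in> G" "(a', m') \<in> G" for a m a' m'
      proof -
        obtain u r u' r' where *: "a = u \<oplus>\<^bsub>L\<^esub> r \<odot>\<^bsub>L\<^esub> x" "m = r \<odot>\<^bsub>MR\<^esub> z" "u \<in> X" "r \<in> carrier R"
          "a' = u' \<oplus>\<^bsub>L\<^esub> r' \<odot>\<^bsub>L\<^esub> x" "m' = r' \<odot>\<^bsub>MR\<^esub> z" "u' \<in> X" "r' \<in> carrier R"
          using am unfolding G_def by blast
        show ?thesis
          by (rule GI[of _ "u \<oplus>\<^bsub>L\<^esub> u'" "r \<oplus>\<^bsub>R\<^esub> r'"])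
            (use * Xc XL x z(1) in \<open>auto simp: L.M.a_ac L.smult_l_distr MR.smult_l_distr\<close>)
      qed
      show "(s \<odot>\<^bsub>L\<^esub> a, s \<odot>\<^bsub>MR\<^esub> m) \<in> G" if s: "s \<in> carrier R" and am: "(a, m) \<in> G" for s a m
      proof -
        obtain u r where *: "a = u \<oplus>\<^bsub>L\<^esub> r \<odot>\<^bsub>L\<^esub> x" "m = r \<odot>\<^bsub>MR\<^esub> z" "u \<in> X" "r \<in> carrier R"
          using am unfolding G_def by blast
        show ?thesis
          by (rule GI[of _ "s \<odot>\<^bsub>L\<^esub> u" "s \<otimes>\<^bsub>R\<^esub> r"])
            (use * s Xc XL x z(1) in \<open>auto simp: L.smult_r_distr L.smult_assoc1 MR.smult_assoc1\<close>)
      qed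
      show "m = \<zero>\<^bsub>MR\<^esub>" if am: "(\<zero>\<^bsub>L\<^esub>, m) \<in> G" for m
      proof -
        obtain u r where *: "\<zero>\<^bsub>L\<^esub> = u \<oplus>\<^bsub>L\<^esub> r \<odot>\<^bsub>L\<^esub> x" "m = r \<odot>\<^bsub>MR\<^esub> z" "u \<in> X" "r \<in> carrier R"
          using am unfolding G_def by blast
        have "r \<odot>\<^bsub>L\<^esub> x \<oplus>\<^bsub>L\<^esub> u = \<zero>\<^bsub>L\<^esub>" using * XL x by (simp add: L.M.a_comm)
        then have "r \<odot>\<^bsub>L\<^esub> x = \<ominus>\<^bsub>L\<^esub> u" using *(3,4) XL x by (intro L.M.minus_equality[symmetric]) auto
        then have "r \<odot>\<^bsub>L\<^esub> x \<in> X" using L.submoduleE(3)[OF X *(3)] by simp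
        then show ?thesis using z(2)[OF *(4)] *(2) by simp
      qed
    qed
    then obtain h where h: "h \<in> carrier H" and hG: "\<forall>x m. (x, m) \<in> G \<longrightarrow> h x = m" by blast
    have "h u = \<zero>\<^bsub>M\<^esub>" if "u \<in> X" for u
      using hG GI[of u u "\<zero>\<^bsub>R\<^esub>" "\<zero>\<^bsub>MR\<^esub>"] that XL x z(1) by (simp add: MR_simps(2))
    then have "h \<in> perp X" using h by (simp add: perp_def)
    moreover have "h x = z"
      using hG GI[of x "\<zero>\<^bsub>L\<^esub>" "\<one>\<^bsub>R\<^esub>" z] x z(1) Xc by simp
    ultimately show "z \<in> (\<lambda>f. f x) ` perp X" by blast
  qed
qed

lemma evaluation_to_zero_colon:
  assumes X: "submodule X R L" and x: "x \<in> carrier L" and p: "p = {r \<in> carrier R. r \<odot>\<^bsub>L\<^esub> x \<in> X}"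
  shows "sublinear S H (Z p) (perp X) (\<lambda>f. f x)" and "(\<lambda>f. f x) ` perp X = carrier (Z p)"
proof -
  have XL: "X \<subseteq> carrier L" using X by (simp add: L.submodule_iff)
  interpret Z: module S "Z p" using p by (intro module_Z) auto
  show surj: "(\<lambda>f. f x) ` perp X = carrier (Z p)"
    using evaluation_perp_surj[OF X x] p by simp
  interpret ev: sublinear S H M "perp X" "\<lambda>f. f x"
    by (rule evaluation_sublinear[OF perp_submodule[OF XL] x])
  show "sublinear S H (Z p) (perp X) (\<lambda>f. f x)"
  proof (intro sublinear.intro sublinear_axioms.intro H.module_axioms Z.module_axioms perp_submodule[OF XL])
    have "(\<lambda>f. f x) \<in> perp X \<rightarrow> carrier (Z p)" unfolding surj[symmetric] by blast
    then show "linear_on S H (perp X) (Z p) (\<lambda>f. f x)"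
      using ev.linear unfolding linear_on_def by simp
  qed
qed

lemma perp_add_cyclic:
  assumes X: "submodule X R L" and x: "x \<in> carrier L"
  shows "{f \<in> perp X. f x = \<zero>\<^bsub>M\<^esub>} = perp (X <+>\<^bsub>L\<^esub> (\<lambda>r. r \<odot>\<^bsub>L\<^esub> x) ` carrier R)" (is "_ = perp (X <+>\<^bsub>L\<^esub> ?C)")
proof
  have C: "submodule ?C R L" by (rule L.submodule_cyclic[OF x])
  have XL: "u \<in> carrier L" if "u \<in> X" for u using that X by (auto simp: L.submodule_iff)
  show "{f \<in> perp X. f x = \<zero>\<^bsub>M\<^esub>} \<subseteq> perp (X <+>\<^bsub>L\<^esub> ?C)"
    using XL x g_closed by (auto simp: perp_def mem_set_add_iff hom_add hom_smult)
  show "perp (X <+>\<^bsub>L\<^esub> ?C) \<subseteq> {f \<in> perp X. f x = \<zero>\<^bsub>M\<^esub>}"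
    using L.set_add_upper1[OF X C] L.set_add_upper2[OF X C] L.mem_cyclic[OF x] by (auto simp: perp_def)
qed

text \<open>
  If \<open>p\<close> is the annihilator of \<open>x\<close>, then evaluation at \<open>x\<close> makes \<open>(0 :\<^sub>M p)\<close> a quotient of \<open>Hom(L, M)\<close>.
\<close>

lemma Coass_zero_colon_subset:
  assumes p: "p \<in> Ass R L"
  shows "Coass S (Z p) \<subseteq> Coass S H"
proof
  fix Q assume Q: "Q \<in> Coass S (Z p)"
  obtain x where x: "x \<in> carrier L" "p = {r \<in> carrier R. r \<odot>\<^bsub>L\<^esub> x \<in> {\<zero>\<^bsub>L\<^esub>}}"
    using p by (auto simp: Ass_def)
  interpret Z: module S "Z p" using x(2) by (intro module_Z) auto
  note ev = evaluation_to_zero_colon[OF L.submodule_zero x, unfolded perp_zero]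
  obtain K where K: "hollow_over S (Z p) K" "Q = coass_prime S (Z p) K"
    using Q by (auto simp: Coass_eq[OF Z.module_axioms])
  show "Q \<in> Coass S H"
    using sublinear.hollow_over_vimage[OF ev(1) refl ev(2) K(1)] K(2)
    unfolding Coass_eq[OF H.module_axioms] by blast
qed

text \<open>
  For \<open>r \<in> F\<close>, multiplication by \<open>r\<close> is not surjective on \<open>Hom(L, M) / K\<close>, that is, the homomorphisms
  vanishing on \<open>(0 :\<^sub>L r)\<close> do not cover \<open>Hom(L, M)\<close> modulo \<open>K\<close>. As \<open>perp\<close> turns finite intersections into sums,
  hollowness extends this to the intersection of the \<open>(0 :\<^sub>L r)\<close>.
\<close>

lemma finite_annihilated_perp:
  assumes K: "hollow_over S H K" and F: "finite F" "F \<subseteq> carrier R" "\<And>r. r \<in> F \<Longrightarrow> g r \<in> coass_prime S H K"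
  shows "perp {x \<in> carrier L. \<forall>r\<in>F. r \<odot>\<^bsub>L\<^esub> x = \<zero>\<^bsub>L\<^esub>} <+>\<^bsub>H\<^esub> K \<noteq> carrier H"
  using F
proof (induction F)
  case empty
  have "perp (carrier L) <+>\<^bsub>H\<^esub> K = K"
    unfolding perp_carrier using hollow_overD(1)[OF K] H.submodule_zero
    by (intro H.set_add_self) (auto simp: H.submodule_iff)
  then show ?case using hollow_overD(2)[OF K] by simp
next
  case (insert r F)
  note K' = hollow_overD(1)[OF K]
  let ?A = "{x \<in> carrier L. r \<odot>\<^bsub>L\<^esub> x = \<zero>\<^bsub>L\<^esub>}"
  let ?B = "{x \<in> carrier L. \<forall>a\<in>F. a \<odot>\<^bsub>L\<^esub> x = \<zero>\<^bsub>L\<^esub>}"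
  have r: "r \<in> carrier R" and FR: "F \<subseteq> carrier R" using insert.prems by auto
  have A: "submodule ?A R L" by (rule L.submodule_annihilated[OF L.submodule_carrier r])
  have B: "submodule ?B R L" by (rule L.submodule_annihilated_set[OF FR])
  have pA: "submodule (perp ?A) S H" and pB: "submodule (perp ?B) S H"
    by (auto intro: perp_submodule)
  have eq: "{x \<in> carrier L. \<forall>a\<in>insert r F. a \<odot>\<^bsub>L\<^esub> x = \<zero>\<^bsub>L\<^esub>} = ?A \<inter> ?B" by auto
  show ?case
  proof
    assume "perp {x \<in> carrier L. \<forall>a\<in>insert r F. a \<odot>\<^bsub>L\<^esub> x = \<zero>\<^bsub>L\<^esub>} <+>\<^bsub>H\<^esub> K = carrier H"
    then have "carrier H \<subseteq> (perp ?A <+>\<^bsub>H\<^esub> perp ?B) <+>\<^bsub>H\<^esub> K"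
      unfolding eq using H.set_add_mono[OF perp_Int_subset[OF A B] order_refl, of K] by simp
    then have "(perp ?A <+>\<^bsub>H\<^esub> perp ?B) <+>\<^bsub>H\<^esub> K = carrier H"
      by (rule H.set_add_eq_carrierI[OF H.submodule_set_add[OF pA pB] K'])
    then have "perp ?A <+>\<^bsub>H\<^esub> K = carrier H \<or> perp ?B <+>\<^bsub>H\<^esub> K = carrier H"
      by (rule H.hollow_over_cases[OF K pA pB])
    moreover have "perp ?A <+>\<^bsub>H\<^esub> K \<noteq> carrier H"
      using insert.prems(2)[of r] unfolding perp_annihilated_eq[OF r] by (simp add: coass_prime_def)
    ultimately show False using insert.IH FR insert.prems(2) by simp
  qed
qed

text \<open>
  Let \<open>T = (0 :\<^sub>L p)\<close>.
  As \<open>p\<close> is finitely generated, \<open>perp T + K \<noteq> Hom(L, M)\<close> by \<open>finite_annihilated_perp\<close>. Suppose that no element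
  of \<open>T\<close> has annihilator exactly \<open>p\<close>. Then each element is killed by a scalar outside \<open>p\<close>, and as \<open>T\<close> is
  Noetherian, a single \<open>r\<close> outside \<open>p\<close> kills all of \<open>T\<close>. So \<open>r Hom(L, M) \<subseteq> perp T\<close>; but \<open>r\<close> is surjective modulo
  \<open>K\<close>, a contradiction.
\<close>

lemma contraction_in_Ass:
  assumes K: "hollow_over S H K" and p: "primeideal p R" and pQ: "spec_map R g (coass_prime S H K) = p"
  shows "p \<in> Ass R L"
proof (rule ccontr)
  assume notin: "p \<notin> Ass R L"
  interpret p: primeideal p R by fact
  interpret N: noetherian_ring R by (rule R_noetherian)
  note K' = hollow_overD(1)[OF K]
  have mem: "r \<in> p \<longleftrightarrow> g r \<in> coass_prime S H K" if "r \<in> carrier R" for r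
    using pQ that by (auto simp: spec_map_def)
  let ?T = "\<lambda>F. {x \<in> carrier L. \<forall>r\<in>F. r \<odot>\<^bsub>L\<^esub> x = \<zero>\<^bsub>L\<^esub>}"
  have T: "submodule (?T p) R L" using p.a_subset by (rule L.submodule_annihilated_set)
  obtain F where F: "F \<subseteq> carrier R" "finite F" "p = Idl\<^bsub>R\<^esub> F"
    using N.finetely_gen[OF p.ideal_axioms] by blast
  have Fp: "F \<subseteq> p" using R.genideal_self[OF F(1)] F(3) by simp
  have "x \<in> ?T p" if x: "x \<in> ?T F" for x
  proof -
    have "F \<subseteq> {r \<in> carrier R. r \<odot>\<^bsub>L\<^esub> x = \<zero>\<^bsub>L\<^esub>}" using x F(1) by auto
    then have "p \<subseteq> {r \<in> carrier R. r \<odot>\<^bsub>L\<^esub> x = \<zero>\<^bsub>L\<^esub>}"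
      unfolding F(3) using x by (intro R.genideal_minimal L.ideal_annihilator) auto
    then show ?thesis using x by auto
  qed
  then have "?T F = ?T p" using Fp by blast
  moreover have "perp (?T F) <+>\<^bsub>H\<^esub> K \<noteq> carrier H"
    by (rule finite_annihilated_perp[OF K F(2,1)]) (use mem Fp F(1) in blast)
  ultimately have T_proper: "perp (?T p) <+>\<^bsub>H\<^esub> K \<noteq> carrier H" by simp
  define \<U> where "\<U> = {U. submodule U R L \<and> U \<subseteq> ?T p \<and> (\<exists>r\<in>carrier R - p. \<forall>u\<in>U. r \<odot>\<^bsub>L\<^esub> u = \<zero>\<^bsub>L\<^esub>)}"
  have one: "\<one>\<^bsub>R\<^esub> \<in> carrier R - p" using p.I_notcarr p.one_imp_carrier by auto
  have "{\<zero>\<^bsub>L\<^esub>} \<in> \<U>" using L.submodule_zero T one by (auto simp: \<U>_def L.submodule_iff)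
  then have "\<U> \<noteq> {}" by blast
  then have "\<exists>U\<in>\<U>. \<forall>V\<in>\<U>. U \<subseteq> V \<longrightarrow> V = U"
  proof (rule max_condD[OF L.fin_gen_max_cond[OF R_noetherian L_fin_gen]])
    show "submodule U R L \<and> U \<subseteq> carrier L" if "U \<in> \<U>" for U
      using that unfolding \<U>_def by blast
  qed
  then obtain U where U: "U \<in> \<U>" and U_max: "\<forall>V\<in>\<U>. U \<subseteq> V \<longrightarrow> V = U" by blast
  obtain r where US: "submodule U R L" "U \<subseteq> ?T p" and r: "r \<in> carrier R" "r \<notin> p" "\<forall>u\<in>U. r \<odot>\<^bsub>L\<^esub> u = \<zero>\<^bsub>L\<^esub>"
    using U unfolding \<U>_def by blast
  have "?T p \<subseteq> U"
  proof (rule subsetI, rule ccontr)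
    fix x assume x: "x \<in> ?T p" "x \<notin> U"
    have xL: "x \<in> carrier L" using x(1) by blast
    have "p \<in> Spec R" using p by (simp add: Spec_def)
    then have "p \<noteq> {a \<in> carrier R. a \<odot>\<^bsub>L\<^esub> x = \<zero>\<^bsub>L\<^esub>}" using notin xL unfolding Ass_def by blast
    moreover have "p \<subseteq> {a \<in> carrier R. a \<odot>\<^bsub>L\<^esub> x = \<zero>\<^bsub>L\<^esub>}" using x(1) p.a_subset by blast
    ultimately obtain s where s: "s \<in> carrier R" "s \<notin> p" "s \<odot>\<^bsub>L\<^esub> x = \<zero>\<^bsub>L\<^esub>" by blast
    let ?C = "(\<lambda>a. a \<odot>\<^bsub>L\<^esub> x) ` carrier R"
    have C: "submodule ?C R L" by (rule L.submodule_cyclic[OF xL])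
    have UL: "u \<in> carrier L" if "u \<in> U" for u using that US(2) by blast
    have "?C \<subseteq> ?T p" using T x(1) unfolding L.submodule_iff by blast
    then have sub: "U <+>\<^bsub>L\<^esub> ?C \<subseteq> ?T p" by (rule L.set_add_least[OF T US(2)])
    have kill: "(r \<otimes>\<^bsub>R\<^esub> s) \<odot>\<^bsub>L\<^esub> v = \<zero>\<^bsub>L\<^esub>" if v: "v \<in> U <+>\<^bsub>L\<^esub> ?C" for v
    proof -
      obtain u a where ua: "u \<in> U" "a \<in> carrier R" "v = u \<oplus>\<^bsub>L\<^esub> a \<odot>\<^bsub>L\<^esub> x"
        using v by (auto simp: mem_set_add_iff)
      have "(r \<otimes>\<^bsub>R\<^esub> s) \<odot>\<^bsub>L\<^esub> u = s \<odot>\<^bsub>L\<^esub> (r \<odot>\<^bsub>L\<^esub> u)"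
        using r(1) s(1) UL[OF ua(1)] by (simp add: R.m_comm flip: L.smult_assoc1)
      then have 1: "(r \<otimes>\<^bsub>R\<^esub> s) \<odot>\<^bsub>L\<^esub> u = \<zero>\<^bsub>L\<^esub>" using r(3) ua(1) s(1) by simp
      have "(r \<otimes>\<^bsub>R\<^esub> s) \<odot>\<^bsub>L\<^esub> (a \<odot>\<^bsub>L\<^esub> x) = (r \<otimes>\<^bsub>R\<^esub> a) \<odot>\<^bsub>L\<^esub> (s \<odot>\<^bsub>L\<^esub> x)"
        using r(1) s(1) ua(2) xL by (simp add: R.m_ac flip: L.smult_assoc1)
      then have 2: "(r \<otimes>\<^bsub>R\<^esub> s) \<odot>\<^bsub>L\<^esub> (a \<odot>\<^bsub>L\<^esub> x) = \<zero>\<^bsub>L\<^esub>" using s(3) r(1) ua(2) by simp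
      show ?thesis using 1 2 ua UL r(1) s(1) xL by (simp add: L.smult_r_distr)
    qed
    have "r \<otimes>\<^bsub>R\<^esub> s \<in> carrier R - p" using r s p.I_prime by blast
    then have "U <+>\<^bsub>L\<^esub> ?C \<in> \<U>"
      unfolding \<U>_def using L.submodule_set_add[OF US(1) C] sub kill by blast
    then have "U <+>\<^bsub>L\<^esub> ?C = U" using U_max L.set_add_upper1[OF US(1) C] by blast
    then show False using x(2) L.set_add_upper2[OF US(1) C] L.mem_cyclic[OF xL] by blast
  qed
  then have "?T p \<subseteq> {x \<in> carrier L. r \<odot>\<^bsub>L\<^esub> x = \<zero>\<^bsub>L\<^esub>}" using r(3) by blast
  then have "perp {x \<in> carrier L. r \<odot>\<^bsub>L\<^esub> x = \<zero>\<^bsub>L\<^esub>} \<subseteq> perp (?T p)" by (rule perp_antimono)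
  then have "(\<lambda>f. g r \<odot>\<^bsub>H\<^esub> f) ` carrier H \<subseteq> perp (?T p)"
    unfolding perp_annihilated_eq[OF r(1)] .
  then have "((\<lambda>f. g r \<odot>\<^bsub>H\<^esub> f) ` carrier H) <+>\<^bsub>H\<^esub> K \<subseteq> perp (?T p) <+>\<^bsub>H\<^esub> K"
    by (intro H.set_add_mono order_refl)
  moreover have "((\<lambda>f. g r \<odot>\<^bsub>H\<^esub> f) ` carrier H) <+>\<^bsub>H\<^esub> K = carrier H"
    using mem[OF r(1)] r(2) g_closed[OF r(1)] by (simp add: coass_prime_def)
  ultimately have "carrier H \<subseteq> perp (?T p) <+>\<^bsub>H\<^esub> K" by simp
  moreover have "submodule (perp (?T p)) S H" by (rule perp_submodule) blast
  ultimately show False using T_proper H.set_add_eq_carrierI[OF _ K', of "perp (?T p)"] by simp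
qed

text \<open>
  Let \<open>Hom(L, M) / K\<close> be hollow, and let \<open>X\<close> be maximal such that \<open>perp X\<close> covers \<open>Hom(L, M)\<close> modulo \<open>K\<close>. With a
  prime \<open>p = (X : x)\<close> and \<open>Y = X + R x\<close>, \<open>perp Y\<close> no longer covers, so by \<open>hollow_over_image\<close> the coassociated
  prime \<open>Q\<close> is already seen in \<open>perp X / perp Y \<cong> (0 :\<^sub>M p)\<close>. A priori \<open>p\<close> is an associated prime of \<open>L / X\<close>
  only; but then it is the contraction of \<open>Q\<close>, hence associated to \<open>L\<close> by \<open>contraction_in_Ass\<close>.
\<close>

lemma Coass_hom_subset:
  assumes Q: "Q \<in> Coass S H"
  shows "\<exists>p\<in>Ass R L. Q \<in> Coass S (Z p)"
proof -
  obtain K where K: "hollow_over S H K" and QK: "Q = coass_prime S H K"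
    using Q by (auto simp: Coass_eq[OF H.module_axioms])
  note K' = hollow_overD(1)[OF K]
  define \<X> where "\<X> = {X. submodule X R L \<and> perp X <+>\<^bsub>H\<^esub> K = carrier H}"
  have "perp {\<zero>\<^bsub>L\<^esub>} <+>\<^bsub>H\<^esub> K = carrier H"
    unfolding perp_zero
    by (rule H.set_add_eq_carrierI[OF H.submodule_carrier K' H.set_add_upper1[OF H.submodule_carrier K']])
  then have "{\<zero>\<^bsub>L\<^esub>} \<in> \<X>" using L.submodule_zero by (simp add: \<X>_def)
  then have "\<X> \<noteq> {}" by blast
  then have "\<exists>X\<in>\<X>. \<forall>Y\<in>\<X>. X \<subseteq> Y \<longrightarrow> Y = X"
  proof (rule max_condD[OF L.fin_gen_max_cond[OF R_noetherian L_fin_gen]])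
    show "submodule X R L \<and> X \<subseteq> carrier L" if "X \<in> \<X>" for X
      using that by (simp add: \<X>_def L.submodule_iff)
  qed
  then obtain X where "X \<in> \<X>" and X_max: "\<forall>Y\<in>\<X>. X \<subseteq> Y \<longrightarrow> Y = X" by blast
  then have X: "submodule X R L" and XK: "perp X <+>\<^bsub>H\<^esub> K = carrier H" by (auto simp: \<X>_def)
  have "X \<noteq> carrier L"
  proof
    assume "X = carrier L"
    moreover have "{\<zero>\<^bsub>H\<^esub>} <+>\<^bsub>H\<^esub> K = K"
      using K' H.submodule_zero by (intro H.set_add_self) (auto simp: H.submodule_iff)
    ultimately show False using XK hollow_overD(2)[OF K] by (simp add: perp_carrier)
  qed
  then obtain x where x: "x \<in> carrier L" "x \<notin> X" and prime: "primeideal {r \<in> carrier R. r \<odot>\<^bsub>L\<^esub> x \<in> X} R"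
    using L.exists_prime_colon[OF R_noetherian X] by blast
  define p where "p = {r \<in> carrier R. r \<odot>\<^bsub>L\<^esub> x \<in> X}"
  have p: "primeideal p R" using prime by (simp add: p_def)
  interpret Z: module S "Z p" by (rule module_Z) (auto simp: p_def)
  note ev = evaluation_to_zero_colon[OF X x(1) p_def]
  let ?C = "(\<lambda>r. r \<odot>\<^bsub>L\<^esub> x) ` carrier R"
  have C: "submodule ?C R L" by (rule L.submodule_cyclic[OF x(1)])
  have "X <+>\<^bsub>L\<^esub> ?C \<notin> \<X>"
  proof
    assume "X <+>\<^bsub>L\<^esub> ?C \<in> \<X>"
    then have "X <+>\<^bsub>L\<^esub> ?C = X" using X_max L.set_add_upper1[OF X C] by blast
    then show False using x L.set_add_upper2[OF X C] L.mem_cyclic[OF x(1)] by blast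
  qed
  then have "perp (X <+>\<^bsub>L\<^esub> ?C) <+>\<^bsub>H\<^esub> K \<noteq> carrier H"
    using L.submodule_set_add[OF X C] by (simp add: \<X>_def)
  then have ker: "{f \<in> perp X. f x = \<zero>\<^bsub>Z p\<^esub>} <+>\<^bsub>H\<^esub> K \<noteq> carrier H"
    using perp_add_cyclic[OF X x(1)] by simp
  have QZ: "Q \<in> Coass S (Z p)"
    using sublinear.hollow_over_image[OF ev(1) K ev(2) XK ker] QK
    unfolding Coass_eq[OF Z.module_axioms] by blast
  then have "p \<in> Ass R L"
    using contraction_in_Ass[OF K p] Coass_S_zero_colon[OF p] QK by blast
  then show ?thesis using QZ by blast
qed

theorem Coass_hom_module: "Coass S H = (\<Union>p\<in>Ass R L. Coass S (Z p))"
  using Coass_zero_colon_subset Coass_hom_subset by blast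

end

theorem theorem5p3:
  fixes R :: "('r, 'a) ring_scheme" and S :: "('s, 'b) ring_scheme" and g :: "'r \<Rightarrow> 's"
    and L :: "('r, 'l, 'c) module_scheme" and M :: "('s, 'm, 'd) module_scheme"
  assumes "cring R" "noetherian_ring R" "cring S" "noetherian_ring S"
    and "g \<in> ring_hom R S"
    and "module R L" "fin_gen_module R L"
    and "module S M" "injective_module TYPE('r) R (restrict_scalars g M)"
  shows "(\<forall>p \<in> Spec R.
      spec_map R g ` Coass S (M\<lparr>carrier := zero_colon (restrict_scalars g M) p\<rparr>)
        = Coass R (restrict_scalars g (M\<lparr>carrier := zero_colon (restrict_scalars g M) p\<rparr>)) \<and>
      Coass R (restrict_scalars g (M\<lparr>carrier := zero_colon (restrict_scalars g M) p\<rparr>)) \<subseteq> {p}) \<and>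
    Coass S (hom_module R g L M)
      = (\<Union>p \<in> Ass R L. Coass S (M\<lparr>carrier := zero_colon (restrict_scalars g M) p\<rparr>))"
proof -
  interpret hom_to_injective R S g M L
    using assms
    by (intro hom_to_injective.intro injective_restriction.intro hom_to_injective_axioms.intro)
  show ?thesis
    using spec_map_Coass_zero_colon Coass_R_zero_colon Coass_hom_module by (simp add: Spec_def)
qed

end
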